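(* Let $\mathcal{C}$ be a self-orthogonal subcategory of $\mathfrak{C}$ such that ${}_{\mathcal{C}}\mathscr{X}$ has a relative injective cogenerator and $\check{{}_{\mathcal{C}}\mathscr{X}}$ is finitely filtered. Then the assignment $\mathcal{T}\mapsto {}_{\mathcal{T}}\mathscr{X}=\mathcal{T}^{\bot}\cap{}_{\mathcal{C}}\mathscr{X}$ is a one-one correspondence from the class of finite $\mathcal{C}$-tilting subcategories $\mathcal{T}$ onto the class of subcategories $\mathcal{D}\subseteq{}_{\mathcal{C}}\mathscr{X}$ which are relative coresolving in ${}_{\mathcal{C}}\mathscr{X}$, strongly covariantly finite in ${}_{\mathcal{C}}\mathscr{X}$, and satisfy $\check{\mathcal{D}}=\check{{}_{\mathcal{C}}\mathscr{X}}$. The inverse map is given by $\mathcal{D}\mapsto {}^{\bot}\mathcal{D}\cap\mathcal{D}$.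
   Context: Standing assumptions: $(\mathfrak{C},\mathbb{E},\mathfrak{s})$ is a Krull-Schmidt extriangulated category (in the sense of Nakaoka-Palu) with enough projectives and enough injectives, satisfying the WIC condition: if $gf$ is an inflation then so is $f$; if $gf$ is a deflation then so is $g$. "Subcategory" means full additive subcategory closed under isomorphisms and direct summands. $\mathbb{E}$-triangles: $A\to B\to C\dashrightarrow$ is an $\mathbb{E}$-triangle if it realizes some element of $\mathbb{E}(C,A)$; then $A\to B$ is an inflation with cone $C$, and $B\to C$ a deflation with cocone $A$. Higher extensions are $\mathbb{E}^{i+1}(X,Y)\cong\mathbb{E}(X,\Sigma^{i}Y)\cong\mathbb{E}(\Omega^{i}X,Y)$ for $i\ge 0$, where $\Omega$, $\Sigma$ denote syzygy and cosyzygy. An $\mathbb{E}$-triangle sequence is a sequence of morphisms obtained by splicing $\mathbb{E}$-triangles $K_{i+1}\to W_i\to K_i\dashrightarrow$ (a finite sequence begins with the cocone term of the first spliced $\mathbb{E}$-triangle and ends with the cone term of the last). For a class $\omega$ of objects: $\omega^{\bot}=\{Y\mid \mathbb{E}^{i}(X,Y)=0\ \forall i\ge1,\ \forall X\in\omega\}$, ${}^{\bot}\omega=\{Y\mid \mathbb{E}^{i}(Y,X)=0\ \forall i\ge1,\ \forall X\in\omega\}$; $\omega$ is self-orthogonal if $\omega\subseteq\omega^{\bot}$. $\hat{\omega}$ (resp. $\check\omega$) is the class of $A$ admitting, for some $n\ge0$, an $\mathbb{E}$-triangle sequence $W_n\to\cdots\to W_0\to A$ (resp. $A\to W^0\to\cdots\to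 W^n$) with all terms other than $A$ in $\omega$; $\check{{}_{\mathcal{C}}\mathscr{X}}$ means $\check{\omega}$ for $\omega={}_{\mathcal{C}}\mathscr{X}$. For $\omega$ self-orthogonal, ${}_{\omega}\mathscr{X}$ is the class of $A$ admitting an $\mathbb{E}$-triangle sequence $\cdots\to W_1\to W_0\to A$, spliced from $\mathbb{E}$-triangles $K_{i+1}\to W_i\to K_i\dashrightarrow$ ($i\ge 0$, $K_0=A$), with all $W_i\in\omega$ and all $K_i\in\omega^{\bot}$. A pair $(\mathcal{C},\mathcal{T})$ of subcategories is a tilting pair if $\mathcal{C}$ and $\mathcal{T}$ are self-orthogonal, $\mathcal{T}\subseteq\hat{\mathcal{C}}$ and $\mathcal{C}\subseteq\check{\mathcal{T}}$; then $\mathcal{T}$ is called a $\mathcal{C}$-tilting subcategory. A subcategory is finite if it equals $\mathrm{add}(T)$ (direct summands of finite direct sums of copies of $T$) for some object $T$. For subcategories $\mathcal{D}\subseteq\mathcal{Y}$: $\mathcal{D}$ is strongly covariantly finite in $\mathcal{Y}$ if every $Y\in\mathcal{Y}$ admits an $\mathbb{E}$-triangle $Y\xrightarrow{g}D\to V\dashrightarrow$ with $g$ a left $\mathcal{D}$-approximation ($D\in\mathcal{D}$ and every morphism from $Y$ to an object of $\mathcal{D}$ factors through $g$). $\mathcal{D}$ is relative coresolving in $\mathcal{Y}$ if it is closed under extensions, direct summands and cones of inflations (for $\mathbb{E}$-triangles with terms in $\mathcal{Y}$) and contains all injective objects of $\mathcal{Y}$ (objects $I\in\mathcal{Y}$ such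 that for each $\mathbb{E}$-triangle $A\to B\to C\dashrightarrow$ with terms in $\mathcal{Y}$ every morphism $A\to I$ factors through $A\to B$). A relative injective cogenerator of $\mathcal{Y}$ is a subcategory $\mathcal{I}\subseteq\mathcal{Y}\cap\mathcal{Y}^{\bot}$ such that each $Y\in\mathcal{Y}$ admits an $\mathbb{E}$-triangle $Y\to I_Y\to Y'\dashrightarrow$ with $I_Y\in\mathcal{I}$, $Y'\in\mathcal{Y}$. A category $\mathcal{Y}$ is finitely filtered if there is a finite set $\mathcal{S}$ of objects of $\mathcal{Y}$ such that each $M\in\mathcal{Y}$ has a finite $\mathcal{S}$-filtration, i.e. $\mathbb{E}$-triangles $0\to M_1\to S_1\dashrightarrow$, $M_1\to M_2\to S_2\dashrightarrow$, $\dots$, $M_{n-1}\to M\to S_n\dashrightarrow$ with all $S_i\in\mathcal{S}$. *)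

theory Defs
  imports "HOL-Algebra.Ring"
begin

section \<open>Additive categories\<close>

record ('o, 'm) cat_struct =
  Obj :: "'o set"
  Arr :: "'m set"
  Dom :: "'m \<Rightarrow> 'o"
  Cod :: "'m \<Rightarrow> 'o"
  Idm :: "'o \<Rightarrow> 'm"
  Cmp :: "'m \<Rightarrow> 'm \<Rightarrow> 'm"  (infixr "\<cdot>\<index>" 70)
  Add :: "'m \<Rightarrow> 'm \<Rightarrow> 'm"  (infixl "\<boxplus>\<index>" 65)
  Zer :: "'o \<Rightarrow> 'o \<Rightarrow> 'm"

definition Hom :: "('o, 'm, 'z) cat_struct_scheme \<Rightarrow> 'o \<Rightarrow> 'o \<Rightarrow> 'm set" where
  "Hom K A B = {f \<in> Arr K. Dom K f = A \<and> Cod K f = B}"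

definition Hom_group :: "('o, 'm, 'z) cat_struct_scheme \<Rightarrow> 'o \<Rightarrow> 'o \<Rightarrow> 'm monoid" where
  "Hom_group K A B = \<lparr>carrier = Hom K A B, monoid.mult = Add K, one = Zer K A B\<rparr>"

locale preadditive_category =
  fixes K :: "('o, 'm, 'z) cat_struct_scheme" (structure)
  assumes Dom_Obj: "f \<in> Arr K \<Longrightarrow> Dom K f \<in> Obj K"
    and Cod_Obj: "f \<in> Arr K \<Longrightarrow> Cod K f \<in> Obj K"
    and Idm_Hom: "A \<in> Obj K \<Longrightarrow> Idm K A \<in> Hom K A A"
    and Cmp_Hom: "\<lbrakk>f \<in> Hom K A B; g \<in> Hom K B C\<rbrakk> \<Longrightarrow> g \<cdot> f \<in> Hom K A C"
    and Cmp_assoc: "\<lbrakk>f \<in> Hom K A B; g \<in> Hom K B C; h \<in> Hom K C D\<rbrakk>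
          \<Longrightarrow> h \<cdot> (g \<cdot> f) = (h \<cdot> g) \<cdot> f"
    and Idm_left: "f \<in> Hom K A B \<Longrightarrow> Idm K B \<cdot> f = f"
    and Idm_right: "f \<in> Hom K A B \<Longrightarrow> f \<cdot> Idm K A = f"
    and Hom_comm_group: "\<lbrakk>A \<in> Obj K; B \<in> Obj K\<rbrakk> \<Longrightarrow> comm_group (Hom_group K A B)"
    and Cmp_Add_left: "\<lbrakk>f \<in> Hom K A B; g \<in> Hom K B C; g' \<in> Hom K B C\<rbrakk>
          \<Longrightarrow> (g \<boxplus> g') \<cdot> f = (g \<cdot> f) \<boxplus> (g' \<cdot> f)"
    and Cmp_Add_right: "\<lbrakk>f \<in> Hom K A B; f' \<in> Hom K A B; g \<in> Hom K B C\<rbrakk>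
          \<Longrightarrow> g \<cdot> (f \<boxplus> f') = (g \<cdot> f) \<boxplus> (g \<cdot> f')"

definition isomorphism :: "('o, 'm, 'z) cat_struct_scheme \<Rightarrow> 'm \<Rightarrow> bool" where
  "isomorphism K f \<longleftrightarrow> f \<in> Arr K \<and>
     (\<exists>g \<in> Hom K (Cod K f) (Dom K f).
        g \<cdot>\<^bsub>K\<^esub> f = Idm K (Dom K f) \<and> f \<cdot>\<^bsub>K\<^esub> g = Idm K (Cod K f))"

definition isomorphic :: "('o, 'm, 'z) cat_struct_scheme \<Rightarrow> 'o \<Rightarrow> 'o \<Rightarrow> bool" where
  "isomorphic K A B \<longleftrightarrow> (\<exists>f \<in> Hom K A B. isomorphism K f)"

definition zero_object :: "('o, 'm, 'z) cat_struct_scheme \<Rightarrow> 'o \<Rightarrow> bool" where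
  "zero_object K Z \<longleftrightarrow> Z \<in> Obj K \<and>
     (\<forall>A \<in> Obj K. (\<exists>!f. f \<in> Hom K Z A) \<and> (\<exists>!f. f \<in> Hom K A Z))"

definition biproduct ::
  "('o, 'm, 'z) cat_struct_scheme \<Rightarrow> 'o \<Rightarrow> 'o \<Rightarrow> 'o \<Rightarrow> 'm \<Rightarrow> 'm \<Rightarrow> 'm \<Rightarrow> 'm \<Rightarrow> bool" where
  "biproduct K A1 A2 B i1 i2 p1 p2 \<longleftrightarrow>
     i1 \<in> Hom K A1 B \<and> i2 \<in> Hom K A2 B \<and> p1 \<in> Hom K B A1 \<and> p2 \<in> Hom K B A2 \<and>
     p1 \<cdot>\<^bsub>K\<^esub> i1 = Idm K A1 \<and> p2 \<cdot>\<^bsub>K\<^esub> i2 = Idm K A2 \<and>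
     p1 \<cdot>\<^bsub>K\<^esub> i2 = Zer K A2 A1 \<and> p2 \<cdot>\<^bsub>K\<^esub> i1 = Zer K A1 A2 \<and>
     (i1 \<cdot>\<^bsub>K\<^esub> p1) \<boxplus>\<^bsub>K\<^esub> (i2 \<cdot>\<^bsub>K\<^esub> p2) = Idm K B"

definition is_biproduct :: "('o, 'm, 'z) cat_struct_scheme \<Rightarrow> 'o \<Rightarrow> 'o \<Rightarrow> 'o \<Rightarrow> bool" where
  "is_biproduct K A1 A2 B \<longleftrightarrow> (\<exists>i1 i2 p1 p2. biproduct K A1 A2 B i1 i2 p1 p2)"

locale additive_category = preadditive_category +
  assumes ex_zero_object: "\<exists>Z. zero_object K Z"
    and ex_biproduct: "\<lbrakk>A1 \<in> Obj K; A2 \<in> Obj K\<rbrakk> \<Longrightarrow> \<exists>B. is_biproduct K A1 A2 B"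

definition direct_summand :: "('o, 'm, 'z) cat_struct_scheme \<Rightarrow> 'o \<Rightarrow> 'o \<Rightarrow> bool" where
  "direct_summand K X Y \<longleftrightarrow> (\<exists>X'. is_biproduct K X X' Y)"

inductive finite_direct_sum ::
    "('o, 'm, 'z) cat_struct_scheme \<Rightarrow> 'o list \<Rightarrow> 'o \<Rightarrow> bool" for K where
  Nil: "zero_object K Z \<Longrightarrow> finite_direct_sum K [] Z"
| Cons: "\<lbrakk>finite_direct_sum K Xs B'; is_biproduct K X B' B\<rbrakk> \<Longrightarrow> finite_direct_sum K (X # Xs) B"

text \<open>Full subcategories are given by their sets of objects.\<close>

definition subcategory :: "('o, 'm, 'z) cat_struct_scheme \<Rightarrow> 'o set \<Rightarrow> bool" where
  "subcategory K \<D> \<longleftrightarrow> \<D> \<subseteq> Obj K \<and>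
     (\<exists>Z \<in> \<D>. zero_object K Z) \<and>
     (\<forall>X \<in> \<D>. \<forall>Y \<in> \<D>. \<forall>B. is_biproduct K X Y B \<longrightarrow> B \<in> \<D>) \<and>
     (\<forall>X \<in> \<D>. \<forall>Y. isomorphic K X Y \<longrightarrow> Y \<in> \<D>) \<and>
     (\<forall>Y \<in> \<D>. \<forall>X. direct_summand K X Y \<longrightarrow> X \<in> \<D>)"

definition add_closure :: "('o, 'm, 'z) cat_struct_scheme \<Rightarrow> 'o \<Rightarrow> 'o set" where
  "add_closure K T = {X. \<exists>n Y. finite_direct_sum K (replicate n T) Y \<and> direct_summand K X Y}"

definition finite_subcategory :: "('o, 'm, 'z) cat_struct_scheme \<Rightarrow> 'o set \<Rightarrow> bool" where
  "finite_subcategory K \<T> \<longleftrightarrow> (\<exists>T \<in> Obj K. \<T> = add_closure K T)"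

definition End_ring :: "('o, 'm, 'z) cat_struct_scheme \<Rightarrow> 'o \<Rightarrow> 'm ring" where
  "End_ring K X = \<lparr>carrier = Hom K X X, monoid.mult = Cmp K, one = Idm K X,
                   zero = Zer K X X, add = Add K\<rparr>"

definition local_ring :: "('a, 'b) ring_scheme \<Rightarrow> bool" where
  "local_ring R \<longleftrightarrow> ring R \<and> \<one>\<^bsub>R\<^esub> \<noteq> \<zero>\<^bsub>R\<^esub> \<and>
     (\<forall>a \<in> carrier R - Units R. \<forall>b \<in> carrier R - Units R. a \<oplus>\<^bsub>R\<^esub> b \<in> carrier R - Units R)"

definition krull_schmidt :: "('o, 'm, 'z) cat_struct_scheme \<Rightarrow> bool" where
  "krull_schmidt K \<longleftrightarrow>
     (\<forall>A \<in> Obj K. \<exists>Xs. finite_direct_sum K Xs A \<and> (\<forall>X \<in> set Xs. local_ring (End_ring K X)))"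

section \<open>Extriangulated categories\<close>

text \<open>
  Extensions carry their end terms, as morphisms do: an element \<open>\<delta>\<close> of \<open>\<E>(C, A)\<close> has
  \<open>Ecov \<delta> = A\<close> and \<open>Econ \<delta> = C\<close>, the covariant and contravariant arguments.
  \<open>Push a \<delta>\<close> and \<open>Pull c \<delta>\<close> are \<open>a\<^sub>*\<delta> = \<E>(C, a)(\<delta>)\<close> and \<open>c\<^sup>*\<delta> = \<E>(c, A)(\<delta>)\<close>.
  \<open>Rlz \<delta>\<close> is the equivalence class of sequences \<open>A \<rightarrow> B \<rightarrow> C\<close> assigned to \<open>\<delta>\<close>,
  a sequence being the pair of its morphisms.
\<close>

record ('o, 'm, 'e) ext_struct = "('o, 'm) cat_struct" +
  Exts :: "'e set"
  Econ :: "'e \<Rightarrow> 'o"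
  Ecov :: "'e \<Rightarrow> 'o"
  EAdd :: "'e \<Rightarrow> 'e \<Rightarrow> 'e"
  EZer :: "'o \<Rightarrow> 'o \<Rightarrow> 'e"
  Push :: "'m \<Rightarrow> 'e \<Rightarrow> 'e"
  Pull :: "'m \<Rightarrow> 'e \<Rightarrow> 'e"
  Rlz :: "'e \<Rightarrow> ('m \<times> 'm) set"

definition Ext :: "('o, 'm, 'e, 'z) ext_struct_scheme \<Rightarrow> 'o \<Rightarrow> 'o \<Rightarrow> 'e set" where
  "Ext K C A = {\<delta> \<in> Exts K. Econ K \<delta> = C \<and> Ecov K \<delta> = A}"

definition Ext_group :: "('o, 'm, 'e, 'z) ext_struct_scheme \<Rightarrow> 'o \<Rightarrow> 'o \<Rightarrow> 'e monoid" where
  "Ext_group K C A = \<lparr>carrier = Ext K C A, monoid.mult = EAdd K, one = EZer K C A\<rparr>"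

definition sequences :: "('o, 'm, 'z) cat_struct_scheme \<Rightarrow> 'o \<Rightarrow> 'o \<Rightarrow> ('m \<times> 'm) set" where
  "sequences K A C = {(x, y). \<exists>B. x \<in> Hom K A B \<and> y \<in> Hom K B C}"

definition seq_equiv ::
  "('o, 'm, 'z) cat_struct_scheme \<Rightarrow> 'o \<Rightarrow> 'o \<Rightarrow> (('m \<times> 'm) \<times> ('m \<times> 'm)) set" where
  "seq_equiv K A C = {((x, y), (x', y')).
     (x, y) \<in> sequences K A C \<and> (x', y') \<in> sequences K A C \<and>
     (\<exists>b \<in> Hom K (Cod K x) (Cod K x'). isomorphism K b \<and> b \<cdot>\<^bsub>K\<^esub> x = x' \<and> y' \<cdot>\<^bsub>K\<^esub> b = y)}"

text \<open>\<open>etriangle K A x B y C \<delta>\<close>: the sequence \<open>A \<rightarrow> B \<rightarrow> C\<close> given by \<open>x\<close>, \<open>y\<close>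
  realizes \<open>\<delta> \<in> \<E>(C, A)\<close>.\<close>

definition etriangle ::
  "('o, 'm, 'e, 'z) ext_struct_scheme \<Rightarrow> 'o \<Rightarrow> 'm \<Rightarrow> 'o \<Rightarrow> 'm \<Rightarrow> 'o \<Rightarrow> 'e \<Rightarrow> bool" where
  "etriangle K A x B y C \<delta> \<longleftrightarrow>
     \<delta> \<in> Ext K C A \<and> x \<in> Hom K A B \<and> y \<in> Hom K B C \<and> (x, y) \<in> Rlz K \<delta>"

text \<open>The axiom names follow Nakaoka and Palu.  In \<open>Rlz_direct_sum\<close> the extension is
  \<open>\<delta> \<oplus> \<delta>'\<close>, i.e. the element of \<open>\<E>(C \<oplus> C', A \<oplus> A')\<close> with components \<open>(\<delta>, 0, 0, \<delta>')\<close>.\<close>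

locale extriangulated_category = additive_category K
  for K :: "('o, 'm, 'e, 'z) ext_struct_scheme" (structure) +
  assumes Econ_Obj: "\<delta> \<in> Exts K \<Longrightarrow> Econ K \<delta> \<in> Obj K"
    and Ecov_Obj: "\<delta> \<in> Exts K \<Longrightarrow> Ecov K \<delta> \<in> Obj K"
    \<comment> \<open>(ET1): \<open>\<E>\<close> is an additive bifunctor to abelian groups\<close>
    and Ext_comm_group: "\<lbrakk>C \<in> Obj K; A \<in> Obj K\<rbrakk> \<Longrightarrow> comm_group (Ext_group K C A)"
    and Push_Ext: "\<lbrakk>\<delta> \<in> Ext K C A; a \<in> Hom K A A'\<rbrakk> \<Longrightarrow> Push K a \<delta> \<in> Ext K C A'"
    and Pull_Ext: "\<lbrakk>\<delta> \<in> Ext K C A; c \<in> Hom K C' C\<rbrakk> \<Longrightarrow> Pull K c \<delta> \<in> Ext K C' A"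
    and Push_EAdd: "\<lbrakk>\<delta> \<in> Ext K C A; \<delta>' \<in> Ext K C A; a \<in> Hom K A A'\<rbrakk>
          \<Longrightarrow> Push K a (EAdd K \<delta> \<delta>') = EAdd K (Push K a \<delta>) (Push K a \<delta>')"
    and Pull_EAdd: "\<lbrakk>\<delta> \<in> Ext K C A; \<delta>' \<in> Ext K C A; c \<in> Hom K C' C\<rbrakk>
          \<Longrightarrow> Pull K c (EAdd K \<delta> \<delta>') = EAdd K (Pull K c \<delta>) (Pull K c \<delta>')"
    and Push_Idm: "\<delta> \<in> Ext K C A \<Longrightarrow> Push K (Idm K A) \<delta> = \<delta>"
    and Pull_Idm: "\<delta> \<in> Ext K C A \<Longrightarrow> Pull K (Idm K C) \<delta> = \<delta>"
    and Push_Cmp: "\<lbrakk>\<delta> \<in> Ext K C A; a \<in> Hom K A A'; a' \<in> Hom K A' A''\<rbrakk>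
          \<Longrightarrow> Push K (a' \<cdot> a) \<delta> = Push K a' (Push K a \<delta>)"
    and Pull_Cmp: "\<lbrakk>\<delta> \<in> Ext K C A; c \<in> Hom K C' C; c' \<in> Hom K C'' C'\<rbrakk>
          \<Longrightarrow> Pull K (c \<cdot> c') \<delta> = Pull K c' (Pull K c \<delta>)"
    and Push_Pull: "\<lbrakk>\<delta> \<in> Ext K C A; a \<in> Hom K A A'; c \<in> Hom K C' C\<rbrakk>
          \<Longrightarrow> Push K a (Pull K c \<delta>) = Pull K c (Push K a \<delta>)"
    and Push_Add: "\<lbrakk>\<delta> \<in> Ext K C A; a \<in> Hom K A A'; a' \<in> Hom K A A'\<rbrakk>
          \<Longrightarrow> Push K (a \<boxplus> a') \<delta> = EAdd K (Push K a \<delta>) (Push K a' \<delta>)"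
    and Pull_Add: "\<lbrakk>\<delta> \<in> Ext K C A; c \<in> Hom K C' C; c' \<in> Hom K C' C\<rbrakk>
          \<Longrightarrow> Pull K (c \<boxplus> c') \<delta> = EAdd K (Pull K c \<delta>) (Pull K c' \<delta>)"
    \<comment> \<open>(ET2): \<open>Rlz\<close> is an additive realization\<close>
    and Rlz_class: "\<delta> \<in> Ext K C A \<Longrightarrow> Rlz K \<delta> \<in> sequences K A C // seq_equiv K A C"
    and Rlz_morphism: "\<lbrakk>etriangle K A x B y C \<delta>; etriangle K A' x' B' y' C' \<delta>';
          a \<in> Hom K A A'; c \<in> Hom K C C'; Push K a \<delta> = Pull K c \<delta>'\<rbrakk>
          \<Longrightarrow> \<exists>b \<in> Hom K B B'. b \<cdot> x = x' \<cdot> a \<and> y' \<cdot> b = c \<cdot> y"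
    and Rlz_zero: "biproduct K A C B i1 i2 p1 p2 \<Longrightarrow> etriangle K A i1 B p2 C (EZer K C A)"
    and Rlz_direct_sum: "\<lbrakk>etriangle K A x B y C \<delta>; etriangle K A' x' B' y' C' \<delta>';
          biproduct K A A' AA iA iA' pA pA'; biproduct K B B' BB iB iB' pB pB';
          biproduct K C C' CC iC iC' pC pC'\<rbrakk>
          \<Longrightarrow> etriangle K AA (iB \<cdot> x \<cdot> pA \<boxplus> iB' \<cdot> x' \<cdot> pA')
                BB (iC \<cdot> y \<cdot> pB \<boxplus> iC' \<cdot> y' \<cdot> pB') CC
                (EAdd K (Push K iA (Pull K pC \<delta>)) (Push K iA' (Pull K pC' \<delta>')))"
    and ET3: "\<lbrakk>etriangle K A x B y C \<delta>; etriangle K A' x' B' y' C' \<delta>';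
          a \<in> Hom K A A'; b \<in> Hom K B B'; b \<cdot> x = x' \<cdot> a\<rbrakk>
          \<Longrightarrow> \<exists>c \<in> Hom K C C'. c \<cdot> y = y' \<cdot> b \<and> Push K a \<delta> = Pull K c \<delta>'"
    and ET3op: "\<lbrakk>etriangle K A x B y C \<delta>; etriangle K A' x' B' y' C' \<delta>';
          b \<in> Hom K B B'; c \<in> Hom K C C'; c \<cdot> y = y' \<cdot> b\<rbrakk>
          \<Longrightarrow> \<exists>a \<in> Hom K A A'. b \<cdot> x = x' \<cdot> a \<and> Push K a \<delta> = Pull K c \<delta>'"
    and ET4: "\<lbrakk>etriangle K A f B f' D \<delta>; etriangle K B g C g' F \<delta>'\<rbrakk>
          \<Longrightarrow> \<exists>E h' d e \<delta>''.
                etriangle K A (g \<cdot> f) C h' E \<delta>'' \<and>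
                etriangle K D d E e F (Push K f' \<delta>') \<and>
                h' \<cdot> g = d \<cdot> f' \<and> e \<cdot> h' = g' \<and>
                Pull K d \<delta>'' = \<delta> \<and> Push K f \<delta>'' = Pull K e \<delta>'"
    and ET4op: "\<lbrakk>etriangle K D f' A f B \<delta>; etriangle K F g' B g C \<delta>'\<rbrakk>
          \<Longrightarrow> \<exists>E h' d e \<delta>''.
                etriangle K E h' A (g \<cdot> f) C \<delta>'' \<and>
                etriangle K D d E e F (Pull K g' \<delta>) \<and>
                h' \<cdot> d = f' \<and> f \<cdot> h' = g' \<cdot> e \<and>
                Push K e \<delta>'' = \<delta>' \<and> Push K d \<delta> = Pull K g \<delta>''"

definition is_etriangle :: "('o, 'm, 'e, 'z) ext_struct_scheme \<Rightarrow> 'o \<Rightarrow> 'o \<Rightarrow> 'o \<Rightarrow> bool" where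
  "is_etriangle K A B C \<longleftrightarrow> (\<exists>x y \<delta>. etriangle K A x B y C \<delta>)"

definition inflation :: "('o, 'm, 'e, 'z) ext_struct_scheme \<Rightarrow> 'm \<Rightarrow> bool" where
  "inflation K x \<longleftrightarrow> (\<exists>A B y C \<delta>. etriangle K A x B y C \<delta>)"

definition deflation :: "('o, 'm, 'e, 'z) ext_struct_scheme \<Rightarrow> 'm \<Rightarrow> bool" where
  "deflation K y \<longleftrightarrow> (\<exists>A x B C \<delta>. etriangle K A x B y C \<delta>)"

definition WIC :: "('o, 'm, 'e, 'z) ext_struct_scheme \<Rightarrow> bool" where
  "WIC K \<longleftrightarrow> (\<forall>A B C. \<forall>f \<in> Hom K A B. \<forall>g \<in> Hom K B C.
     (inflation K (g \<cdot>\<^bsub>K\<^esub> f) \<longrightarrow> inflation K f) \<and>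
     (deflation K (g \<cdot>\<^bsub>K\<^esub> f) \<longrightarrow> deflation K g))"

definition projective :: "('o, 'm, 'e, 'z) ext_struct_scheme \<Rightarrow> 'o \<Rightarrow> bool" where
  "projective K P \<longleftrightarrow> P \<in> Obj K \<and>
     (\<forall>A x B y C \<delta>. etriangle K A x B y C \<delta> \<longrightarrow>
        (\<forall>c \<in> Hom K P C. \<exists>b \<in> Hom K P B. y \<cdot>\<^bsub>K\<^esub> b = c))"

text \<open>Injective objects of a class \<open>\<Y>\<close>; injective objects of the whole category
  arise for \<open>\<Y> = Obj K\<close>.\<close>

definition injective_in :: "('o, 'm, 'e, 'z) ext_struct_scheme \<Rightarrow> 'o set \<Rightarrow> 'o \<Rightarrow> bool" where
  "injective_in K \<Y> I \<longleftrightarrow> I \<in> \<Y> \<and>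
     (\<forall>A x B y C \<delta>. A \<in> \<Y> \<and> B \<in> \<Y> \<and> C \<in> \<Y> \<and> etriangle K A x B y C \<delta> \<longrightarrow>
        (\<forall>a \<in> Hom K A I. \<exists>b \<in> Hom K B I. b \<cdot>\<^bsub>K\<^esub> x = a))"

definition enough_projectives :: "('o, 'm, 'e, 'z) ext_struct_scheme \<Rightarrow> bool" where
  "enough_projectives K \<longleftrightarrow>
     (\<forall>C \<in> Obj K. \<exists>A P. projective K P \<and> is_etriangle K A P C)"

definition enough_injectives :: "('o, 'm, 'e, 'z) ext_struct_scheme \<Rightarrow> bool" where
  "enough_injectives K \<longleftrightarrow>
     (\<forall>A \<in> Obj K. \<exists>I C. injective_in K (Obj K) I \<and> is_etriangle K A I C)"

section \<open>Higher extensions and orthogonality\<close>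

definition syzygy :: "('o, 'm, 'e, 'z) ext_struct_scheme \<Rightarrow> 'o \<Rightarrow> 'o" where
  "syzygy K X = (SOME A. \<exists>P. projective K P \<and> is_etriangle K A P X)"

text \<open>\<open>\<E>\<^sup>i(X, Y)\<close> is \<open>\<E>(\<Omega>\<^sup>i\<^sup>-\<^sup>1X, Y)\<close> for \<open>i \<ge> 1\<close>; the value at \<open>i = 0\<close> is meaningless.
  With enough projectives, different choices of syzygies give isomorphic groups.\<close>

definition higher_Ext_group ::
  "('o, 'm, 'e, 'z) ext_struct_scheme \<Rightarrow> nat \<Rightarrow> 'o \<Rightarrow> 'o \<Rightarrow> 'e monoid" where
  "higher_Ext_group K i X Y = Ext_group K ((syzygy K ^^ (i - 1)) X) Y"

definition higher_Ext_vanishes ::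
  "('o, 'm, 'e, 'z) ext_struct_scheme \<Rightarrow> nat \<Rightarrow> 'o \<Rightarrow> 'o \<Rightarrow> bool" where
  "higher_Ext_vanishes K i X Y \<longleftrightarrow>
     carrier (higher_Ext_group K i X Y) = {\<one>\<^bsub>higher_Ext_group K i X Y\<^esub>}"

definition right_perp :: "('o, 'm, 'e, 'z) ext_struct_scheme \<Rightarrow> 'o set \<Rightarrow> 'o set" where
  "right_perp K \<omega> = {Y \<in> Obj K. \<forall>i \<ge> 1. \<forall>X \<in> \<omega>. higher_Ext_vanishes K i X Y}"

definition left_perp :: "('o, 'm, 'e, 'z) ext_struct_scheme \<Rightarrow> 'o set \<Rightarrow> 'o set" where
  "left_perp K \<omega> = {Y \<in> Obj K. \<forall>i \<ge> 1. \<forall>X \<in> \<omega>. higher_Ext_vanishes K i Y X}"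

definition self_orthogonal :: "('o, 'm, 'e, 'z) ext_struct_scheme \<Rightarrow> 'o set \<Rightarrow> bool" where
  "self_orthogonal K \<omega> \<longleftrightarrow> \<omega> \<subseteq> right_perp K \<omega>"

section \<open>Resolutions, tilting pairs and relative notions\<close>

text \<open>The sequence \<open>W\<^sub>n \<rightarrow> \<dots> \<rightarrow> W\<^sub>0 \<rightarrow> A\<close> is spliced from \<open>M\<^sub>i\<^sub>+\<^sub>1 \<rightarrow> W\<^sub>i \<rightarrow> M\<^sub>i\<close> (\<open>i < n\<close>) with
  \<open>M\<^sub>0 = A\<close> and \<open>M\<^sub>n = W\<^sub>n\<close>; for \<open>n = 0\<close> this leaves \<open>A = W\<^sub>0\<close>.\<close>

definition hat :: "('o, 'm, 'e, 'z) ext_struct_scheme \<Rightarrow> 'o set \<Rightarrow> 'o set" where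
  "hat K \<omega> = {A \<in> Obj K. \<exists>(n::nat) W M. M 0 = A \<and> M n = W n \<and>
     (\<forall>i \<le> n. W i \<in> \<omega>) \<and> (\<forall>i < n. is_etriangle K (M (Suc i)) (W i) (M i))}"

definition check :: "('o, 'm, 'e, 'z) ext_struct_scheme \<Rightarrow> 'o set \<Rightarrow> 'o set" where
  "check K \<omega> = {A \<in> Obj K. \<exists>(n::nat) W M. M 0 = A \<and> M n = W n \<and>
     (\<forall>i \<le> n. W i \<in> \<omega>) \<and> (\<forall>i < n. is_etriangle K (M i) (W i) (M (Suc i)))}"

text \<open>The class \<open>\<^sub>\<omega>\<X>\<close> of the literature on tilting pairs.\<close>

definition res_class :: "('o, 'm, 'e, 'z) ext_struct_scheme \<Rightarrow> 'o set \<Rightarrow> 'o set" where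
  "res_class K \<omega> = {A \<in> Obj K. \<exists>(W :: nat \<Rightarrow> 'o) M. M 0 = A \<and>
     (\<forall>i. W i \<in> \<omega> \<and> M i \<in> right_perp K \<omega> \<and> is_etriangle K (M (Suc i)) (W i) (M i))}"

definition tilting_pair ::
  "('o, 'm, 'e, 'z) ext_struct_scheme \<Rightarrow> 'o set \<Rightarrow> 'o set \<Rightarrow> bool" where
  "tilting_pair K \<C> \<T> \<longleftrightarrow> subcategory K \<C> \<and> subcategory K \<T> \<and>
     self_orthogonal K \<C> \<and> self_orthogonal K \<T> \<and> \<T> \<subseteq> hat K \<C> \<and> \<C> \<subseteq> check K \<T>"

definition left_approximation ::
  "('o, 'm, 'z) cat_struct_scheme \<Rightarrow> 'o set \<Rightarrow> 'o \<Rightarrow> 'm \<Rightarrow> 'o \<Rightarrow> bool" where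
  "left_approximation K \<D> Y g D \<longleftrightarrow> D \<in> \<D> \<and> g \<in> Hom K Y D \<and>
     (\<forall>D' \<in> \<D>. \<forall>f \<in> Hom K Y D'. \<exists>h \<in> Hom K D D'. h \<cdot>\<^bsub>K\<^esub> g = f)"

definition strongly_covariantly_finite ::
  "('o, 'm, 'e, 'z) ext_struct_scheme \<Rightarrow> 'o set \<Rightarrow> 'o set \<Rightarrow> bool" where
  "strongly_covariantly_finite K \<Y> \<D> \<longleftrightarrow> \<D> \<subseteq> \<Y> \<and>
     (\<forall>Y \<in> \<Y>. \<exists>g D y V \<delta>. etriangle K Y g D y V \<delta> \<and> left_approximation K \<D> Y g D)"

definition relative_coresolving ::
  "('o, 'm, 'e, 'z) ext_struct_scheme \<Rightarrow> 'o set \<Rightarrow> 'o set \<Rightarrow> bool" where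
  "relative_coresolving K \<Y> \<D> \<longleftrightarrow> \<D> \<subseteq> \<Y> \<and>
     (\<forall>A \<in> \<Y>. \<forall>B \<in> \<Y>. \<forall>C \<in> \<Y>. is_etriangle K A B C \<and> A \<in> \<D> \<and> C \<in> \<D> \<longrightarrow> B \<in> \<D>) \<and>
     (\<forall>A \<in> \<Y>. \<forall>B \<in> \<Y>. \<forall>C \<in> \<Y>. is_etriangle K A B C \<and> A \<in> \<D> \<and> B \<in> \<D> \<longrightarrow> C \<in> \<D>) \<and>
     (\<forall>Y \<in> \<D>. \<forall>X. direct_summand K X Y \<longrightarrow> X \<in> \<D>) \<and>
     (\<forall>I. injective_in K \<Y> I \<longrightarrow> I \<in> \<D>)"

definition relative_injective_cogenerator ::
  "('o, 'm, 'e, 'z) ext_struct_scheme \<Rightarrow> 'o set \<Rightarrow> 'o set \<Rightarrow> bool" where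
  "relative_injective_cogenerator K \<Y> \<I> \<longleftrightarrow> subcategory K \<I> \<and>
     \<I> \<subseteq> \<Y> \<inter> right_perp K \<Y> \<and>
     (\<forall>Y \<in> \<Y>. \<exists>I \<in> \<I>. \<exists>Y' \<in> \<Y>. is_etriangle K Y I Y')"

inductive has_filtration ::
    "('o, 'm, 'e, 'z) ext_struct_scheme \<Rightarrow> 'o set \<Rightarrow> 'o \<Rightarrow> bool" for K \<S> where
  zero: "zero_object K Z \<Longrightarrow> has_filtration K \<S> Z"
| step: "\<lbrakk>has_filtration K \<S> M'; S \<in> \<S>; is_etriangle K M' M S\<rbrakk> \<Longrightarrow> has_filtration K \<S> M"

definition finitely_filtered ::
  "('o, 'm, 'e, 'z) ext_struct_scheme \<Rightarrow> 'o set \<Rightarrow> bool" where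
  "finitely_filtered K \<Y> \<longleftrightarrow>
     (\<exists>\<S>. finite \<S> \<and> \<S> \<subseteq> \<Y> \<and> (\<forall>M \<in> \<Y>. has_filtration K \<S> M))"

definition finite_tilting_subcategories ::
  "('o, 'm, 'e, 'z) ext_struct_scheme \<Rightarrow> 'o set \<Rightarrow> 'o set set" where
  "finite_tilting_subcategories K \<C> = {\<T>. tilting_pair K \<C> \<T> \<and> finite_subcategory K \<T>}"

definition coresolving_subcategories ::
  "('o, 'm, 'e, 'z) ext_struct_scheme \<Rightarrow> 'o set \<Rightarrow> 'o set set" where
  "coresolving_subcategories K \<C> = {\<D>. subcategory K \<D> \<and> \<D> \<subseteq> res_class K \<C> \<and>
     relative_coresolving K (res_class K \<C>) \<D> \<and>
     strongly_covariantly_finite K (res_class K \<C>) \<D> \<and>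
     check K \<D> = check K (res_class K \<C>)}"

end

theory Submission
  imports Defs
begin

text \<open>
Write \<open>\<X>\<close> for \<open>\<^sub>\<C>\<X>\<close>.  If \<open>\<T>\<close> is \<open>\<C>\<close>-tilting and \<open>\<T> = add T\<close>, a finite \<open>\<C>\<close>-resolution of \<open>T\<close>
bounds the degrees \<open>i\<close> with \<open>\<E>\<^sup>i(\<T>, \<X>) \<noteq> 0\<close>.  Induction on that bound embeds every \<open>A \<in> \<X>\<close> in an
\<open>\<E>\<close>-triangle \<open>A \<rightarrow> A' \<rightarrow> V\<close> with \<open>A' \<in> \<X> \<inter> \<T>\<^sup>\<bottom>\<close> and \<open>V\<close> in the coresolution closure of \<open>\<T>\<close>.  As \<open>V\<close> is left
orthogonal to \<open>\<T>\<^sup>\<bottom>\<close>, this gives \<open>\<^sub>\<T>\<X> = \<T>\<^sup>\<bottom> \<inter> \<X>\<close>, the approximations, and all properties of this class.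

Conversely, the Krull-Schmidt property and WIC allow one to shrink a left \<open>\<D>\<close>-approximation until
Wakamatsu's lemma applies, so every \<open>Y \<in> \<X>\<close> has an \<open>\<E>\<close>-triangle \<open>Y \<rightarrow> D \<rightarrow> V\<close> with \<open>D \<in> \<D>\<close> and
\<open>V \<in> \<^sup>\<bottom>\<D> \<inter> \<X>\<close>.  The finite filtrations bound the degrees of the extensions of all objects of \<open>\<X>\<close> by \<open>\<^sup>\<bottom>\<D>\<close>, so
iterating these triangles, and the \<open>\<C>\<close>-resolutions, splits after finitely many steps; hence \<open>\<T> = \<^sup>\<bottom>\<D> \<inter> \<D>\<close> is
tilting.  Splicing the approximations of the filtration factors shows that finitely many
objects of \<open>\<T>\<close> already generate it.
\<close>

section \<open>Additive categories and biproducts\<close>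

text \<open>The axioms give only weak exactness: maps between realizations exist but are not unique.
  The Hom-\<E> sequences, a five lemma and pullbacks are therefore derived first, and most later
  constructions are phrased with \<open>is_etriangle\<close>, without naming morphisms. Higher
  extensions are defined by syzygies of the first argument; cosyzygies are introduced to get
  exactness in that argument too. Termination is the obstacle that shapes both directions. Each
  construction passes to a syzygy or cosyzygy and thereby lowers the top degree of surviving
  extensions by one, so it stops only below a known bound. The first direction is developed from a
  bare bound \<open>N\<close>, not from finiteness of \<T>; the inverse direction can then apply it
  to its own \<T> and deduce finiteness from the result. Approximations have to be shrunk because
  the cone of an arbitrary one may contain a spare summand \<open>L\<close> of its target, and
  \<E>(L, \<D>) need not vanish.\<close>

context preadditive_category
begin

section \<open>Calculus of morphisms\<close>

lemma HomD:
  assumes "f \<in> Hom K A B"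
  shows "f \<in> Arr K" "Dom K f = A" "Cod K f = B" "A \<in> Obj K" "B \<in> Obj K"
  using assms Dom_Obj Cod_Obj by (auto simp: Hom_def)

lemma HomI: "\<lbrakk>f \<in> Arr K; Dom K f = A; Cod K f = B\<rbrakk> \<Longrightarrow> f \<in> Hom K A B"
  by (simp add: Hom_def)

lemma Cmp_simps:
  assumes "f \<in> Arr K" "g \<in> Arr K" "Cod K f = Dom K g"
  shows "g \<cdot> f \<in> Arr K" "Dom K (g \<cdot> f) = Dom K f" "Cod K (g \<cdot> f) = Cod K g"
  using Cmp_Hom[of f "Dom K f" "Dom K g" g "Cod K g"] assms by (auto simp: Hom_def)

lemma Cmp_assoc_simp:
  assumes "f \<in> Arr K" "g \<in> Arr K" "h \<in> Arr K" "Cod K f = Dom K g" "Cod K g = Dom K h"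
  shows "(h \<cdot> g) \<cdot> f = h \<cdot> (g \<cdot> f)"
  using Cmp_assoc[of f "Dom K f" "Dom K g" g "Dom K h" h "Cod K h"] assms by (auto simp: Hom_def)

lemma Idm_simps:
  assumes "A \<in> Obj K"
  shows "Idm K A \<in> Arr K" "Dom K (Idm K A) = A" "Cod K (Idm K A) = A"
  using Idm_Hom[OF assms] by (auto simp: Hom_def)

lemma Idm_Cmp_simps:
  assumes "f \<in> Arr K"
  shows "Cod K f = A \<Longrightarrow> Idm K A \<cdot> f = f" "Dom K f = A \<Longrightarrow> f \<cdot> Idm K A = f"
  using Idm_left[of f "Dom K f" A] Idm_right[of f A "Cod K f"] assms by (auto simp: Hom_def)

lemma Zer_simps:
  assumes "A \<in> Obj K" "B \<in> Obj K"
  shows "Zer K A B \<in> Arr K" "Dom K (Zer K A B) = A" "Cod K (Zer K A B) = B"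
  using comm_group.axioms(1)[OF Hom_comm_group[OF assms], THEN comm_monoid.axioms(1),
      THEN monoid.one_closed] by (auto simp: Hom_group_def Hom_def)

lemma Add_simps:
  assumes "f \<in> Arr K" "g \<in> Arr K" "Dom K f = Dom K g" "Cod K f = Cod K g"
  shows "f \<boxplus> g \<in> Arr K" "Dom K (f \<boxplus> g) = Dom K f" "Cod K (f \<boxplus> g) = Cod K f"
proof -
  interpret comm_group "Hom_group K (Dom K f) (Cod K f)"
    using assms Dom_Obj Cod_Obj by (intro Hom_comm_group) auto
  show "f \<boxplus> g \<in> Arr K" "Dom K (f \<boxplus> g) = Dom K f" "Cod K (f \<boxplus> g) = Cod K f"
    using m_closed[of f g] assms by (auto simp: Hom_group_def Hom_def)
qed

lemma Add_comm:
  assumes "f \<in> Arr K" "g \<in> Arr K" "Dom K f = Dom K g" "Cod K f = Cod K g"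
  shows "f \<boxplus> g = g \<boxplus> f"
proof -
  interpret comm_group "Hom_group K (Dom K f) (Cod K f)"
    using assms Dom_Obj Cod_Obj by (intro Hom_comm_group) auto
  show ?thesis using m_comm[of f g] assms by (auto simp: Hom_group_def Hom_def)
qed

lemma Add_assoc:
  assumes "f \<in> Arr K" "g \<in> Arr K" "h \<in> Arr K" "Dom K f = Dom K g" "Cod K f = Cod K g"
    "Dom K g = Dom K h" "Cod K g = Cod K h"
  shows "(f \<boxplus> g) \<boxplus> h = f \<boxplus> (g \<boxplus> h)"
proof -
  interpret comm_group "Hom_group K (Dom K f) (Cod K f)"
    using assms Dom_Obj Cod_Obj by (intro Hom_comm_group) auto
  show ?thesis using m_assoc[of f g h] assms by (auto simp: Hom_group_def Hom_def)
qed

lemma Add_left_comm: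
  assumes "f \<in> Arr K" "g \<in> Arr K" "h \<in> Arr K" "Dom K f = Dom K g" "Cod K f = Cod K g"
    "Dom K g = Dom K h" "Cod K g = Cod K h"
  shows "f \<boxplus> (g \<boxplus> h) = g \<boxplus> (f \<boxplus> h)"
  using Add_assoc[of f g h] Add_assoc[of g f h] Add_comm[of f g] assms by simp

lemma Add_Zer:
  assumes "f \<in> Arr K" "Dom K f = A" "Cod K f = B"
  shows "f \<boxplus> Zer K A B = f" "Zer K A B \<boxplus> f = f"
proof -
  interpret comm_group "Hom_group K A B"
    using assms Dom_Obj Cod_Obj by (intro Hom_comm_group) auto
  show "f \<boxplus> Zer K A B = f" "Zer K A B \<boxplus> f = f"
    using r_one[of f] l_one[of f] assms by (auto simp: Hom_group_def Hom_def)
qed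

lemma Add_cancel:
  assumes "f \<boxplus> g = f \<boxplus> g'" "f \<in> Hom K A B" "g \<in> Hom K A B" "g' \<in> Hom K A B"
  shows "g = g'"
proof -
  interpret comm_group "Hom_group K A B"
    using assms HomD by (intro Hom_comm_group) auto
  show ?thesis using Units_l_cancel[of f g g'] Units_eq assms by (auto simp: Hom_group_def)
qed

lemma Add_cancel_Zer:
  assumes "f \<boxplus> g = f" "f \<in> Hom K A B" "g \<in> Hom K A B"
  shows "g = Zer K A B"
  by (rule Add_cancel[of f]) (use assms HomD[OF assms(2)] in \<open>auto simp: Add_Zer Hom_def Zer_simps\<close>)

text \<open>Stands in for the difference of \<open>g\<close> and \<open>f\<close>. It is applied
  with \<open>g\<close> an identity, to pass from an endomorphism to its complement.\<close>

lemma ex_Add_complement: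
  assumes "f \<in> Hom K A B" "g \<in> Hom K A B"
  obtains g' where "g' \<in> Hom K A B" "f \<boxplus> g' = g"
proof -
  interpret comm_group "Hom_group K A B"
    using assms HomD by (intro Hom_comm_group) auto
  let ?n = "inv\<^bsub>Hom_group K A B\<^esub> f"
  have c: "f \<in> carrier (Hom_group K A B)" "g \<in> carrier (Hom_group K A B)"
    using assms by (auto simp: Hom_group_def)
  then have "?n \<otimes>\<^bsub>Hom_group K A B\<^esub> g \<in> carrier (Hom_group K A B)"
      "f \<otimes>\<^bsub>Hom_group K A B\<^esub> (?n \<otimes>\<^bsub>Hom_group K A B\<^esub> g) = g"
    by (simp_all add: m_assoc[symmetric])
  then show ?thesis using that[of "?n \<boxplus> g"] by (simp add: Hom_group_def)
qed

lemma Cmp_Add_simps: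
  assumes "f \<in> Arr K" "g \<in> Arr K" "h \<in> Arr K"
  shows "Dom K g = Dom K h \<Longrightarrow> Cod K g = Cod K h \<Longrightarrow> Cod K f = Dom K h
      \<Longrightarrow> (g \<boxplus> h) \<cdot> f = (g \<cdot> f) \<boxplus> (h \<cdot> f)"
    "Dom K g = Dom K h \<Longrightarrow> Cod K g = Cod K h \<Longrightarrow> Dom K f = Cod K h
      \<Longrightarrow> f \<cdot> (g \<boxplus> h) = (f \<cdot> g) \<boxplus> (f \<cdot> h)"
  using Cmp_Add_left[of f "Dom K f" "Cod K f" g "Cod K g" h]
    Cmp_Add_right[of g "Dom K g" "Cod K g" h f "Cod K f"] assms
  by (auto simp: Hom_def)

lemma Cmp_Zer_right:
  assumes "g \<in> Arr K" "Dom K g = B" "A \<in> Obj K"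
  shows "g \<cdot> Zer K A B = Zer K A (Cod K g)"
proof -
  have o: "B \<in> Obj K" "Cod K g \<in> Obj K" using assms Dom_Obj Cod_Obj by auto
  have "g \<cdot> (Zer K A B \<boxplus> Zer K A B) = g \<cdot> Zer K A B"
    using assms o by (simp add: Add_Zer Zer_simps)
  then show ?thesis
    using assms o by (intro Add_cancel_Zer[of "g \<cdot> Zer K A B"])
      (auto simp: Cmp_Add_simps Zer_simps Hom_def Cmp_simps)
qed

lemma Cmp_Zer_left:
  assumes "g \<in> Arr K" "Cod K g = B" "C \<in> Obj K"
  shows "Zer K B C \<cdot> g = Zer K (Dom K g) C"
proof -
  have o: "B \<in> Obj K" "Dom K g \<in> Obj K" using assms Dom_Obj Cod_Obj by auto
  have "(Zer K B C \<boxplus> Zer K B C) \<cdot> g = Zer K B C \<cdot> g"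
    using assms o by (simp add: Add_Zer Zer_simps)
  then show ?thesis
    using assms o by (intro Add_cancel_Zer[of "Zer K B C \<cdot> g"])
      (auto simp: Cmp_Add_simps Zer_simps Hom_def Cmp_simps)
qed

text \<open>Typing becomes a matter of domains and codomains, and composites are bracketed to the
  right. Cancellation rules must therefore carry an arbitrary further factor \<open>f\<close>, which
  explains the facts named \<open>r\<close> in later proofs.\<close>

lemmas hom_simps = Hom_def Cmp_simps Cmp_assoc_simp Idm_simps Idm_Cmp_simps Zer_simps Add_simps
  Add_Zer Cmp_Add_simps Cmp_Zer_left Cmp_Zer_right Dom_Obj Cod_Obj

section \<open>Biproducts, zero objects, isomorphisms\<close>

lemma biproductD:
  assumes "biproduct K A1 A2 B i1 i2 p1 p2"
  shows "i1 \<in> Hom K A1 B" "i2 \<in> Hom K A2 B" "p1 \<in> Hom K B A1" "p2 \<in> Hom K B A2"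
    "p1 \<cdot> i1 = Idm K A1" "p2 \<cdot> i2 = Idm K A2" "p1 \<cdot> i2 = Zer K A2 A1" "p2 \<cdot> i1 = Zer K A1 A2"
    "(i1 \<cdot> p1) \<boxplus> (i2 \<cdot> p2) = Idm K B" "A1 \<in> Obj K" "A2 \<in> Obj K" "B \<in> Obj K"
  using assms HomD by (auto simp: biproduct_def)

lemma biproduct_swap: "biproduct K A1 A2 B i1 i2 p1 p2 \<Longrightarrow> biproduct K A2 A1 B i2 i1 p2 p1"
  unfolding biproduct_def by (auto simp: hom_simps Add_comm[of "i2 \<cdot> p2"])

lemma is_biproduct_swap: "is_biproduct K A1 A2 B \<Longrightarrow> is_biproduct K A2 A1 B"
  unfolding is_biproduct_def using biproduct_swap by blast

lemma is_biproduct_Obj: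
  assumes "is_biproduct K A1 A2 B" shows "A1 \<in> Obj K" "A2 \<in> Obj K" "B \<in> Obj K"
  using assms biproductD(10-12)[of A1 A2 B] unfolding is_biproduct_def by auto

lemma zero_object_unique:
  assumes "zero_object K Z"
  shows "f \<in> Hom K A Z \<Longrightarrow> f = Zer K A Z" "f \<in> Hom K Z A \<Longrightarrow> f = Zer K Z A"
proof -
  have Z: "Z \<in> Obj K" using assms by (simp add: zero_object_def)
  show "f = Zer K A Z" if "f \<in> Hom K A Z"
    using assms that HomD[OF that] Z unfolding zero_object_def
    by (metis HomI Zer_simps)
  show "f = Zer K Z A" if "f \<in> Hom K Z A"
    using assms that HomD[OF that] Z unfolding zero_object_def
    by (metis HomI Zer_simps)
qed

lemma biproduct_zero:
  assumes "zero_object K Z" "A \<in> Obj K"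
  shows "biproduct K A Z A (Idm K A) (Zer K Z A) (Idm K A) (Zer K A Z)"
proof -
  have Z: "Z \<in> Obj K" using assms by (simp add: zero_object_def)
  have "Idm K Z = Zer K Z Z" using zero_object_unique[OF assms(1), of "Idm K Z" Z] Z Idm_Hom by auto
  then show ?thesis using assms Z by (auto simp: biproduct_def hom_simps)
qed

lemma is_biproduct_zero:
  assumes "zero_object K Z" "A \<in> Obj K" shows "is_biproduct K A Z A" "is_biproduct K Z A A"
  using biproduct_zero[OF assms] biproduct_swap unfolding is_biproduct_def by blast+

text \<open>The maps are explicit because the inclusion of \<open>Y1\<close> must stay
  \<open>j \<cdot> i1\<close>: when a summand is split off inside \<open>B'\<close> in
  \<open>local_summand_or_right_inverse\<close>, its inclusion into \<open>B\<close> has to be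
  recognised.\<close>

lemma biproduct_assoc:
  assumes "biproduct K X Y B i j \<pi> p" "biproduct K Y1 Y2 Y i1 i2 p1 p2" "biproduct K X Y2 C a b c d"
  shows "biproduct K Y1 C B (j \<cdot> i1) (i \<cdot> c \<boxplus> j \<cdot> i2 \<cdot> d) (p1 \<cdot> p) (a \<cdot> \<pi> \<boxplus> b \<cdot> p2 \<cdot> p)"
proof -
  note 1 = biproductD[OF assms(1)] and 2 = biproductD[OF assms(2)] and 3 = biproductD[OF assms(3)]
  note hs = 1(1-4)[unfolded Hom_def mem_Collect_eq] 2(1-4)[unfolded Hom_def mem_Collect_eq]
    3(1-4)[unfolded Hom_def mem_Collect_eq]
  note os = 1(10-12) 2(10-12) 3(10-12)
  have r: "\<And>f. f \<in> Arr K \<Longrightarrow> Cod K f = X \<Longrightarrow> \<pi> \<cdot> i \<cdot> f = f"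
      "\<And>f. f \<in> Arr K \<Longrightarrow> Cod K f = Y \<Longrightarrow> p \<cdot> j \<cdot> f = f"
      "\<And>f. f \<in> Arr K \<Longrightarrow> Cod K f = Y \<Longrightarrow> \<pi> \<cdot> j \<cdot> f = Zer K (Dom K f) X"
      "\<And>f. f \<in> Arr K \<Longrightarrow> Cod K f = X \<Longrightarrow> p \<cdot> i \<cdot> f = Zer K (Dom K f) Y"
      "\<And>f. f \<in> Arr K \<Longrightarrow> Cod K f = Y1 \<Longrightarrow> p1 \<cdot> i1 \<cdot> f = f"
      "\<And>f. f \<in> Arr K \<Longrightarrow> Cod K f = Y2 \<Longrightarrow> p2 \<cdot> i2 \<cdot> f = f"
      "\<And>f. f \<in> Arr K \<Longrightarrow> Cod K f = Y2 \<Longrightarrow> p1 \<cdot> i2 \<cdot> f = Zer K (Dom K f) Y1"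
      "\<And>f. f \<in> Arr K \<Longrightarrow> Cod K f = Y1 \<Longrightarrow> p2 \<cdot> i1 \<cdot> f = Zer K (Dom K f) Y2"
      "\<And>f. f \<in> Arr K \<Longrightarrow> Cod K f = X \<Longrightarrow> c \<cdot> a \<cdot> f = f"
      "\<And>f. f \<in> Arr K \<Longrightarrow> Cod K f = Y2 \<Longrightarrow> d \<cdot> b \<cdot> f = f"
      "\<And>f. f \<in> Arr K \<Longrightarrow> Cod K f = Y2 \<Longrightarrow> c \<cdot> b \<cdot> f = Zer K (Dom K f) X"
      "\<And>f. f \<in> Arr K \<Longrightarrow> Cod K f = X \<Longrightarrow> d \<cdot> a \<cdot> f = Zer K (Dom K f) Y2"
    using 1(5-8) 2(5-8) 3(5-8) hs os by (simp_all add: hom_simps flip: Cmp_assoc_simp)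
  have B: "i1 \<cdot> p1 \<cdot> p \<boxplus> i2 \<cdot> p2 \<cdot> p = p"
    using arg_cong[OF 2(9), of "\<lambda>f. f \<cdot> p"] hs os by (simp add: hom_simps)
  have C: "a \<cdot> c \<boxplus> b \<cdot> d = Idm K C" by (rule 3(9))
  have "j \<cdot> i1 \<cdot> p1 \<cdot> p \<boxplus> (i \<cdot> \<pi> \<boxplus> j \<cdot> i2 \<cdot> p2 \<cdot> p) = i \<cdot> \<pi> \<boxplus> j \<cdot> (i1 \<cdot> p1 \<cdot> p \<boxplus> i2 \<cdot> p2 \<cdot> p)"
    using hs os by (simp add: hom_simps Add_left_comm[of "i \<cdot> \<pi>"])
  also have "\<dots> = Idm K B" using 1(9) B by simp
  finally have D: "j \<cdot> i1 \<cdot> p1 \<cdot> p \<boxplus> (i \<cdot> \<pi> \<boxplus> j \<cdot> i2 \<cdot> p2 \<cdot> p) = Idm K B" .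
  show ?thesis
    unfolding biproduct_def
    using 1(5-8) 2(5-8) 3(5-9) hs os B C D r by (simp add: hom_simps)
qed

lemma isomorphismI:
  assumes "f \<in> Hom K A B" "g \<in> Hom K B A" "g \<cdot> f = Idm K A" "f \<cdot> g = Idm K B"
  shows "isomorphism K f"
  using assms by (auto simp: isomorphism_def Hom_def)

lemma isomorphismE:
  assumes "isomorphism K f" "f \<in> Hom K A B"
  obtains g where "g \<in> Hom K B A" "g \<cdot> f = Idm K A" "f \<cdot> g = Idm K B"
  using assms by (auto simp: isomorphism_def Hom_def)

lemma isomorphism_of_one_sided:
  assumes "b \<in> Hom K A B" "s \<in> Hom K B A" "r \<in> Hom K B A" "b \<cdot> s = Idm K B" "r \<cdot> b = Idm K A"
  shows "isomorphism K b"
proof (rule isomorphismI[OF assms(1,2) _ assms(4)])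
  have "r = r \<cdot> (b \<cdot> s)" using assms(1,2,3) HomD[OF assms(1)] by (simp add: assms(4) hom_simps)
  also have "\<dots> = s" using assms(1,2,3) HomD[OF assms(1)]
    by (simp add: assms(5) hom_simps flip: Cmp_assoc_simp)
  finally show "s \<cdot> b = Idm K A" using assms(5) by simp
qed

end

section \<open>Exact sequences of an extriangulated category\<close>

context extriangulated_category
begin

section \<open>Zero extensions and realizations\<close>

lemma ExtD:
  assumes "\<delta> \<in> Ext K C A" shows "C \<in> Obj K" "A \<in> Obj K"
  using assms Econ_Obj Ecov_Obj by (auto simp: Ext_def)

lemma EZer_Ext: "\<lbrakk>C \<in> Obj K; A \<in> Obj K\<rbrakk> \<Longrightarrow> EZer K C A \<in> Ext K C A"
  using comm_group.axioms(1)[OF Ext_comm_group, THEN comm_monoid.axioms(1), THEN monoid.one_closed, of C A]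
  by (simp add: Ext_group_def)

lemma EAdd_Ext: "\<lbrakk>\<delta> \<in> Ext K C A; \<epsilon> \<in> Ext K C A\<rbrakk> \<Longrightarrow> EAdd K \<delta> \<epsilon> \<in> Ext K C A"
  using comm_group.axioms(1)[OF Ext_comm_group, THEN comm_monoid.axioms(1), THEN monoid.m_closed, of C A \<delta> \<epsilon>] ExtD[of \<delta>]
  by (simp add: Ext_group_def)

lemma EAdd_EZer:
  assumes "\<delta> \<in> Ext K C A" shows "EAdd K \<delta> (EZer K C A) = \<delta>" "EAdd K (EZer K C A) \<delta> = \<delta>"
proof -
  interpret comm_group "Ext_group K C A" using assms ExtD by (intro Ext_comm_group) auto
  show "EAdd K \<delta> (EZer K C A) = \<delta>" "EAdd K (EZer K C A) \<delta> = \<delta>"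
    using assms l_one[of \<delta>] r_one[of \<delta>] by (auto simp: Ext_group_def)
qed

lemma EAdd_cancel_EZer:
  assumes "EAdd K \<delta> \<epsilon> = \<delta>" "\<delta> \<in> Ext K C A" "\<epsilon> \<in> Ext K C A" shows "\<epsilon> = EZer K C A"
proof -
  interpret comm_group "Ext_group K C A" using assms ExtD by (intro Ext_comm_group) auto
  show ?thesis
    using assms Units_l_cancel[of \<delta> \<epsilon> "EZer K C A"] Units_eq one_closed r_one[of \<delta>]
    by (auto simp: Ext_group_def)
qed

lemma Push_EZer:
  assumes "a \<in> Hom K A A'" "C \<in> Obj K" shows "Push K a (EZer K C A) = EZer K C A'"
proof -
  have z: "EZer K C A \<in> Ext K C A" using assms HomD[OF assms(1)] by (intro EZer_Ext)
  have "Push K a (EZer K C A) = EAdd K (Push K a (EZer K C A)) (Push K a (EZer K C A))"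
    using Push_EAdd[OF z z assms(1)] EAdd_EZer[OF z] by simp
  then show ?thesis using EAdd_cancel_EZer Push_Ext[OF z assms(1)] by metis
qed

lemma Pull_EZer:
  assumes "c \<in> Hom K C' C" "A \<in> Obj K" shows "Pull K c (EZer K C A) = EZer K C' A"
proof -
  have z: "EZer K C A \<in> Ext K C A" using assms HomD[OF assms(1)] by (intro EZer_Ext)
  have "Pull K c (EZer K C A) = EAdd K (Pull K c (EZer K C A)) (Pull K c (EZer K C A))"
    using Pull_EAdd[OF z z assms(1)] EAdd_EZer[OF z] by simp
  then show ?thesis using EAdd_cancel_EZer Pull_Ext[OF z assms(1)] by metis
qed

lemma Push_Zer:
  assumes "\<delta> \<in> Ext K C A" "A' \<in> Obj K" shows "Push K (Zer K A A') \<delta> = EZer K C A'"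
proof -
  have z: "Zer K A A' \<in> Hom K A A'" using assms ExtD[OF assms(1)] by (simp add: hom_simps)
  have "Push K (Zer K A A') \<delta> = EAdd K (Push K (Zer K A A') \<delta>) (Push K (Zer K A A') \<delta>)"
    using Push_Add[OF assms(1) z z] z by (simp add: Add_Zer Hom_def)
  then show ?thesis using EAdd_cancel_EZer Push_Ext[OF assms(1) z] by metis
qed

lemma Pull_Zer:
  assumes "\<delta> \<in> Ext K C A" "C' \<in> Obj K" shows "Pull K (Zer K C' C) \<delta> = EZer K C' A"
proof -
  have z: "Zer K C' C \<in> Hom K C' C" using assms ExtD[OF assms(1)] by (simp add: hom_simps)
  have "Pull K (Zer K C' C) \<delta> = EAdd K (Pull K (Zer K C' C) \<delta>) (Pull K (Zer K C' C) \<delta>)"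
    using Pull_Add[OF assms(1) z z] z by (simp add: Add_Zer Hom_def)
  then show ?thesis using EAdd_cancel_EZer Pull_Ext[OF assms(1) z] by metis
qed

lemma etriangleD:
  assumes "etriangle K A x B y C \<delta>"
  shows "\<delta> \<in> Ext K C A" "x \<in> Hom K A B" "y \<in> Hom K B C" "A \<in> Obj K" "B \<in> Obj K" "C \<in> Obj K"
  using assms HomD by (auto simp: etriangle_def)

lemma ex_etriangle:
  assumes "\<delta> \<in> Ext K C A" obtains x B y where "etriangle K A x B y C \<delta>"
proof -
  obtain s where s: "s \<in> sequences K A C" "Rlz K \<delta> = seq_equiv K A C `` {s}"
    using Rlz_class[OF assms] by (auto elim: quotientE)
  obtain x y where xy: "s = (x, y)" by force
  then obtain B where B: "x \<in> Hom K A B" "y \<in> Hom K B C" using s by (auto simp: sequences_def)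
  have I: "Idm K B \<in> Hom K B B" using HomD[OF B(1)] Idm_Hom by simp
  have "Idm K B \<cdot> x = x" "y \<cdot> Idm K B = y" "isomorphism K (Idm K B)"
    using I B Idm_left Idm_right isomorphismI[of "Idm K B" B B "Idm K B"] by auto
  then have "(s, s) \<in> seq_equiv K A C"
    using s(1) I HomD[OF B(1)] by (auto simp: seq_equiv_def xy)
  then show ?thesis using that[of x B y] assms B s xy by (auto simp: etriangle_def)
qed

text \<open>Both sequences are reached from one representative of the class; one comparison
  isomorphism is composed with the inverse of the other.\<close>

lemma Rlz_unique:
  assumes "etriangle K A x B y C \<delta>" "etriangle K A x' B' y' C \<delta>"
  obtains b b' where "b \<in> Hom K B B'" "b' \<in> Hom K B' B" "b' \<cdot> b = Idm K B" "b \<cdot> b' = Idm K B'"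
    "b \<cdot> x = x'" "y' \<cdot> b = y"
proof -
  note h1 = etriangleD[OF assms(1)] and h2 = etriangleD[OF assms(2)]
  obtain s where s: "s \<in> sequences K A C" "Rlz K \<delta> = seq_equiv K A C `` {s}"
    using Rlz_class[OF h1(1)] by (auto elim: quotientE)
  obtain u v where uv: "s = (u, v)" by force
  then obtain S where S: "u \<in> Hom K A S" "v \<in> Hom K S C" using s by (auto simp: sequences_def)
  have "((u, v), (x, y)) \<in> seq_equiv K A C" "((u, v), (x', y')) \<in> seq_equiv K A C"
    using assms s uv by (auto simp: etriangle_def)
  then obtain b b' where b: "b \<in> Hom K S B" "isomorphism K b" "b \<cdot> u = x" "y \<cdot> b = v"
      and b': "b' \<in> Hom K S B'" "isomorphism K b'" "b' \<cdot> u = x'" "y' \<cdot> b' = v"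
    using S h1(2,3) h2(2,3) by (auto simp: seq_equiv_def Hom_def)
  obtain c where c: "c \<in> Hom K B S" "c \<cdot> b = Idm K S" "b \<cdot> c = Idm K B"
    using isomorphismE[OF b(2,1)] .
  obtain c' where c': "c' \<in> Hom K B' S" "c' \<cdot> b' = Idm K S" "b' \<cdot> c' = Idm K B'"
    using isomorphismE[OF b'(2,1)] .
  note hs = b(1) b'(1) c(1) c'(1) S h1(2-) h2(2-)
  have r: "\<And>f. f \<in> Arr K \<Longrightarrow> Cod K f = S \<Longrightarrow> c \<cdot> b \<cdot> f = f"
      "\<And>f. f \<in> Arr K \<Longrightarrow> Cod K f = B \<Longrightarrow> b \<cdot> c \<cdot> f = f"
      "\<And>f. f \<in> Arr K \<Longrightarrow> Cod K f = S \<Longrightarrow> c' \<cdot> b' \<cdot> f = f"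
      "\<And>f. f \<in> Arr K \<Longrightarrow> Cod K f = B' \<Longrightarrow> b' \<cdot> c' \<cdot> f = f"
    using c(2,3) c'(2,3) hs by (simp_all add: hom_simps flip: Cmp_assoc_simp)
  show ?thesis
  proof (rule that[of "b' \<cdot> c" "b \<cdot> c'"])
    show "b' \<cdot> c \<in> Hom K B B'" "b \<cdot> c' \<in> Hom K B' B"
      "(b \<cdot> c') \<cdot> (b' \<cdot> c) = Idm K B" "(b' \<cdot> c) \<cdot> (b \<cdot> c') = Idm K B'"
      using hs r c c' by (simp_all add: hom_simps)
    show "(b' \<cdot> c) \<cdot> x = x'" unfolding b(3)[symmetric] b'(3)[symmetric] using hs r by (simp add: hom_simps)
    have "y' \<cdot> (b' \<cdot> c) = (y' \<cdot> b') \<cdot> c" using hs by (simp add: hom_simps)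
    also have "\<dots> = (y \<cdot> b) \<cdot> c" using b b' by simp
    also have "\<dots> = y" using hs r c by (simp add: hom_simps)
    finally show "y' \<cdot> (b' \<cdot> c) = y" .
  qed
qed

lemma Rlz_transport:
  assumes "etriangle K A x B y C \<delta>" "b \<in> Hom K B B'" "b' \<in> Hom K B' B"
    "b' \<cdot> b = Idm K B" "b \<cdot> b' = Idm K B'"
  shows "etriangle K A (b \<cdot> x) B' (y \<cdot> b') C \<delta>"
proof -
  note h1 = etriangleD[OF assms(1)]
  obtain s where s: "s \<in> sequences K A C" "Rlz K \<delta> = seq_equiv K A C `` {s}"
    using Rlz_class[OF h1(1)] by (auto elim: quotientE)
  obtain u v where uv: "s = (u, v)" by force
  then obtain S where S: "u \<in> Hom K A S" "v \<in> Hom K S C" using s by (auto simp: sequences_def)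
  have "((u, v), (x, y)) \<in> seq_equiv K A C"
    using assms(1) s uv by (auto simp: etriangle_def)
  then obtain d where d: "d \<in> Hom K S B" "isomorphism K d" "d \<cdot> u = x" "y \<cdot> d = v"
    using S h1(2,3) by (auto simp: seq_equiv_def Hom_def)
  obtain e where e: "e \<in> Hom K B S" "e \<cdot> d = Idm K S" "d \<cdot> e = Idm K B"
    using isomorphismE[OF d(2,1)] .
  note hs = d(1) e(1) S h1(2-) assms(2,3)
  have r: "\<And>f. f \<in> Arr K \<Longrightarrow> Cod K f = S \<Longrightarrow> e \<cdot> d \<cdot> f = f"
      "\<And>f. f \<in> Arr K \<Longrightarrow> Cod K f = B \<Longrightarrow> d \<cdot> e \<cdot> f = f"
      "\<And>f. f \<in> Arr K \<Longrightarrow> Cod K f = B \<Longrightarrow> b' \<cdot> b \<cdot> f = f"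
      "\<And>f. f \<in> Arr K \<Longrightarrow> Cod K f = B' \<Longrightarrow> b \<cdot> b' \<cdot> f = f"
    using e(2,3) assms(4,5) hs by (simp_all add: hom_simps flip: Cmp_assoc_simp)
  have "isomorphism K (b \<cdot> d)"
    by (rule isomorphismI[of _ S B' "e \<cdot> b'"]) (use hs r e assms(5) in \<open>simp_all add: hom_simps\<close>)
  moreover have "b \<cdot> d \<in> Hom K S B'" "(b \<cdot> d) \<cdot> u = b \<cdot> x" "(y \<cdot> b') \<cdot> (b \<cdot> d) = v"
    unfolding d(3,4)[symmetric] using hs r by (simp_all add: hom_simps)
  moreover have bx: "b \<cdot> x \<in> Hom K A B'" "y \<cdot> b' \<in> Hom K B' C" using hs by (simp_all add: hom_simps)
  moreover have "(u, v) \<in> sequences K A C" "(b \<cdot> x, y \<cdot> b') \<in> sequences K A C"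
    using s(1) uv bx by (auto simp: sequences_def)
  ultimately have "((u, v), (b \<cdot> x, y \<cdot> b')) \<in> seq_equiv K A C"
    using S by (auto simp: seq_equiv_def Hom_def)
  then show ?thesis using s uv bx h1(1) by (auto simp: etriangle_def)
qed

section \<open>Exactness of Hom and \<E> along an \<E>-triangle\<close>

lemma etriangle_id_left:
  assumes "zero_object K Z" "A \<in> Obj K"
  shows "etriangle K A (Idm K A) A (Zer K A Z) Z (EZer K Z A)"
  using Rlz_zero[OF biproduct_zero[OF assms]] .

lemma etriangle_id_right:
  assumes "zero_object K Z" "A \<in> Obj K"
  shows "etriangle K Z (Zer K Z A) A (Idm K A) A (EZer K A Z)"
  using Rlz_zero[OF biproduct_swap[OF biproduct_zero[OF assms]]] .

text \<open>Compare with the split triangle \<open>A = A \<rightarrow> 0\<close>: by ET3 the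
  composite factors through a zero object. The same device, or its dual, proves the next two
  lemmas.\<close>

lemma etriangle_comp_zero:
  assumes "etriangle K A x B y C \<delta>" shows "y \<cdot> x = Zer K A C"
proof -
  note h = etriangleD[OF assms]
  obtain Z where Z: "zero_object K Z" using ex_zero_object by blast
  then have Zo: "Z \<in> Obj K" by (simp add: zero_object_def)
  obtain c where c: "c \<in> Hom K Z C" "c \<cdot> Zer K A Z = y \<cdot> x"
    using ET3[OF etriangle_id_left[OF Z h(4)] assms, of "Idm K A" x] h by (auto simp: hom_simps)
  then show ?thesis using Zo h by (simp add: hom_simps)
qed

lemma Push_inflation:
  assumes "etriangle K A x B y C \<delta>" shows "Push K x \<delta> = EZer K C B"
proof -
  note h = etriangleD[OF assms]
  obtain Z where Z: "zero_object K Z" using ex_zero_object by blast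
  then have Zo: "Z \<in> Obj K" by (simp add: zero_object_def)
  obtain c where "c \<in> Hom K C Z" "Push K x \<delta> = Pull K c (EZer K Z B)"
    using ET3[OF assms etriangle_id_left[OF Z h(5)], of x "Idm K B"] h by (auto simp: hom_simps)
  then show ?thesis using Pull_EZer h by simp
qed

lemma Pull_deflation:
  assumes "etriangle K A x B y C \<delta>" shows "Pull K y \<delta> = EZer K B A"
proof -
  note h = etriangleD[OF assms]
  obtain Z where Z: "zero_object K Z" using ex_zero_object by blast
  then have Zo: "Z \<in> Obj K" by (simp add: zero_object_def)
  obtain a where "a \<in> Hom K Z A" "Push K a (EZer K B Z) = Pull K y \<delta>"
    using ET3op[OF etriangle_id_right[OF Z h(5)] assms, of "Idm K B" y] h by (auto simp: hom_simps)
  then show ?thesis using Push_EZer h by simp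
qed

text \<open>The zero extension is realized by the biproduct of \<open>Y\<close> and
  \<open>C\<close>, so \<open>a\<close> induces a map from \<open>B\<close> into that biproduct; its
  first component extends \<open>a\<close>.\<close>

lemma extend_along_inflation:
  assumes "etriangle K A x B y C \<delta>" "a \<in> Hom K A Y" "Push K a \<delta> = EZer K C Y"
  obtains b where "b \<in> Hom K B Y" "b \<cdot> x = a"
proof -
  note h = etriangleD[OF assms(1)] HomD[OF assms(2)]
  obtain S i1 i2 p1 p2 where b: "biproduct K Y C S i1 i2 p1 p2"
    using ex_biproduct[of Y C] h by (auto simp: is_biproduct_def)
  note bD = biproductD[OF b]
  have I: "Idm K C \<in> Hom K C C" using h by (simp add: hom_simps)
  have "Push K a \<delta> = Pull K (Idm K C) (EZer K C Y)" using assms(3) Pull_EZer[OF I, of Y] h by simp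
  then obtain f where f: "f \<in> Hom K B S" "f \<cdot> x = i1 \<cdot> a"
    using Rlz_morphism[OF assms(1) Rlz_zero[OF b] assms(2) I] by blast
  have "(p1 \<cdot> f) \<cdot> x = p1 \<cdot> (i1 \<cdot> a)" using f bD(3) h(2) by (simp add: hom_simps flip: f(2))
  also have "\<dots> = a" using bD(1-4,10-12) bD(5) assms(2) by (simp add: hom_simps flip: Cmp_assoc_simp)
  finally show ?thesis using that[of "p1 \<cdot> f"] f bD(3) by (simp add: hom_simps)
qed

lemma lift_along_deflation:
  assumes "etriangle K A x B y C \<delta>" "c \<in> Hom K W C" "Pull K c \<delta> = EZer K W A"
  obtains b where "b \<in> Hom K W B" "y \<cdot> b = c"
proof -
  note h = etriangleD[OF assms(1)] HomD[OF assms(2)]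
  obtain S i1 i2 p1 p2 where b: "biproduct K A W S i1 i2 p1 p2"
    using ex_biproduct[of A W] h by (auto simp: is_biproduct_def)
  note bD = biproductD[OF b]
  have I: "Idm K A \<in> Hom K A A" using h by (simp add: hom_simps)
  have "Push K (Idm K A) (EZer K W A) = Pull K c \<delta>" using assms(3) Push_EZer[OF I, of W] h by simp
  then obtain f where f: "f \<in> Hom K S B" "y \<cdot> f = c \<cdot> p2"
    using Rlz_morphism[OF Rlz_zero[OF b] assms(1) I assms(2)] by blast
  have "y \<cdot> (f \<cdot> i2) = (c \<cdot> p2) \<cdot> i2" using f bD(2) h(3) by (simp add: hom_simps flip: f(2))
  also have "\<dots> = c" using bD(1-4,10-12) bD(6) assms(2) by (simp add: hom_simps)
  finally show ?thesis using that[of "f \<cdot> i2"] f bD(2) by (simp add: hom_simps)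
qed

lemma lift_through_inflation:
  assumes "etriangle K A x B y C \<delta>" "b \<in> Hom K W B" "y \<cdot> b = Zer K W C"
  obtains a where "a \<in> Hom K W A" "x \<cdot> a = b"
proof -
  note h = etriangleD[OF assms(1)] HomD[OF assms(2)]
  obtain Z where Z: "zero_object K Z" using ex_zero_object by blast
  then have Zo: "Z \<in> Obj K" by (simp add: zero_object_def)
  have "Zer K Z C \<cdot> Zer K W Z = y \<cdot> b" using assms h Zo by (simp add: hom_simps)
  then obtain a where "a \<in> Hom K W A" "b \<cdot> Idm K W = x \<cdot> a"
    using ET3op[OF etriangle_id_left[OF Z, of W] assms(1,2), of "Zer K Z C"] h Zo by (auto simp: hom_simps)
  then show ?thesis using that[of a] assms(2) by (simp add: hom_simps)
qed

text \<open>Exactness at \<E>(C, Y): once \<epsilon> dies on \<open>B\<close>, the deflation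
  \<open>y\<close> lifts to the middle term of \<epsilon>, and ET3op restricts this lift to the
  cocones.\<close>

lemma Push_connecting:
  assumes "etriangle K A x B y C \<delta>" "\<epsilon> \<in> Ext K C Y" "Pull K y \<epsilon> = EZer K B Y"
  obtains a where "a \<in> Hom K A Y" "Push K a \<delta> = \<epsilon>"
proof -
  note h = etriangleD[OF assms(1)] ExtD[OF assms(2)]
  obtain u E v where E: "etriangle K Y u E v C \<epsilon>" using ex_etriangle[OF assms(2)] .
  obtain b where b: "b \<in> Hom K B E" "v \<cdot> b = y" using lift_along_deflation[OF E h(3) assms(3)] .
  obtain a where "a \<in> Hom K A Y" "Push K a \<delta> = Pull K (Idm K C) \<epsilon>"
    using ET3op[OF assms(1) E b(1), of "Idm K C"] b h by (auto simp: hom_simps)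
  then show ?thesis using that[of a] Pull_Idm[OF assms(2)] by simp
qed

lemma Pull_connecting:
  assumes "etriangle K A x B y C \<delta>" "\<epsilon> \<in> Ext K W A" "Push K x \<epsilon> = EZer K W B"
  obtains c where "c \<in> Hom K W C" "Pull K c \<delta> = \<epsilon>"
proof -
  note h = etriangleD[OF assms(1)] ExtD[OF assms(2)]
  obtain u E v where E: "etriangle K A u E v W \<epsilon>" using ex_etriangle[OF assms(2)] .
  obtain b where b: "b \<in> Hom K E B" "b \<cdot> u = x" using extend_along_inflation[OF E h(2) assms(3)] .
  obtain c where "c \<in> Hom K W C" "Push K (Idm K A) \<epsilon> = Pull K c \<delta>"
    using ET3[OF E assms(1) _ b(1), of "Idm K A"] b h by (auto simp: hom_simps)
  then show ?thesis using that[of c] Push_Idm[OF assms(2)] by simp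
qed

lemma retraction_of_zero:
  assumes "etriangle K A x B y C (EZer K C A)"
  obtains r where "r \<in> Hom K B A" "r \<cdot> x = Idm K A"
proof -
  note h = etriangleD[OF assms(1)]
  have I: "Idm K A \<in> Hom K A A" using h by (simp add: hom_simps)
  show ?thesis using extend_along_inflation[OF assms I] that Push_EZer[OF I] h by metis
qed

lemma section_of_zero:
  assumes "etriangle K A x B y C (EZer K C A)"
  obtains s where "s \<in> Hom K C B" "y \<cdot> s = Idm K C"
proof -
  note h = etriangleD[OF assms(1)]
  have I: "Idm K C \<in> Hom K C C" using h by (simp add: hom_simps)
  show ?thesis using lift_along_deflation[OF assms I] that Pull_EZer[OF I] h by metis
qed

text \<open>ET4op turns \<epsilon> and the given triangle into an extension of \<open>C\<close> by
  \<open>M\<close>, where \<open>M\<close> realizes the restriction of \<epsilon> to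
  \<open>A\<close>. That restriction splits, and pushing along the retraction of \<open>M\<close>
  onto \<open>Y\<close> gives the preimage.\<close>

lemma Pull_exact:
  assumes "etriangle K A x B y C \<delta>" "\<epsilon> \<in> Ext K B Y" "Pull K x \<epsilon> = EZer K A Y"
  obtains \<epsilon>' where "\<epsilon>' \<in> Ext K C Y" "Pull K y \<epsilon>' = \<epsilon>"
proof -
  note h = etriangleD[OF assms(1)] ExtD[OF assms(2)]
  obtain u E v where E: "etriangle K Y u E v B \<epsilon>" using ex_etriangle[OF assms(2)] .
  obtain M h' d e \<delta>'' where 1: "etriangle K M h' E (y \<cdot> v) C \<delta>''"
      "etriangle K Y d M e A (Pull K x \<epsilon>)" "Push K e \<delta>'' = \<delta>" "Push K d \<epsilon> = Pull K y \<delta>''"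
    using ET4op[OF E assms(1)] by blast
  note h1 = etriangleD[OF 1(1)] and h2 = etriangleD[OF 1(2)]
  obtain r where r: "r \<in> Hom K M Y" "r \<cdot> d = Idm K Y"
    using retraction_of_zero 1(2) assms(3) by metis
  have "\<epsilon> = Push K r (Push K d \<epsilon>)"
    using Push_Cmp[OF assms(2) h2(2) r(1)] r(2) Push_Idm[OF assms(2)] by simp
  also have "\<dots> = Pull K y (Push K r \<delta>'')" unfolding 1(4) by (rule Push_Pull[OF h1(1) r(1) h(3)])
  finally show ?thesis using that[of "Push K r \<delta>''"] Push_Ext[OF h1(1) r(1)] by simp
qed

text \<open>Dual to \<open>Pull_exact\<close>, with ET4 and a section in place of ET4op and a
  retraction.\<close>

lemma Push_exact:
  assumes "etriangle K A x B y C \<delta>" "\<epsilon> \<in> Ext K W B" "Push K y \<epsilon> = EZer K W C"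
  obtains \<epsilon>' where "\<epsilon>' \<in> Ext K W A" "Push K x \<epsilon>' = \<epsilon>"
proof -
  note h = etriangleD[OF assms(1)] ExtD[OF assms(2)]
  obtain u E v where E: "etriangle K B u E v W \<epsilon>" using ex_etriangle[OF assms(2)] .
  obtain M h' d e \<delta>'' where 1: "etriangle K A (u \<cdot> x) E h' M \<delta>''"
      "etriangle K C d M e W (Push K y \<epsilon>)" "Push K x \<delta>'' = Pull K e \<epsilon>"
    using ET4[OF assms(1) E] by blast
  note h1 = etriangleD[OF 1(1)] and h2 = etriangleD[OF 1(2)]
  obtain s where s: "s \<in> Hom K W M" "e \<cdot> s = Idm K W"
    using section_of_zero 1(2) assms(3) by metis
  have "\<epsilon> = Pull K s (Pull K e \<epsilon>)"
    using Pull_Cmp[OF assms(2) h2(3) s(1)] s(2) Pull_Idm[OF assms(2)] by simp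
  also have "\<dots> = Push K x (Pull K s \<delta>'')" unfolding 1(3)[symmetric]
    by (rule Push_Pull[OF h1(1) h(2) s(1), symmetric])
  finally show ?thesis using that[of "Pull K s \<delta>''"] Pull_Ext[OF h1(1) s(1)] by simp
qed

lemma etriangle_split:
  assumes "etriangle K A x B y C (EZer K C A)"
  obtains j q where "biproduct K A C B x j q y"
proof -
  note h = etriangleD[OF assms]
  obtain S i1 i2 p1 p2 where b: "biproduct K A C S i1 i2 p1 p2"
    using ex_biproduct[of A C] h by (auto simp: is_biproduct_def)
  note bD = biproductD[OF b]
  obtain b b' where t: "b \<in> Hom K S B" "b' \<in> Hom K B S" "b' \<cdot> b = Idm K S" "b \<cdot> b' = Idm K B"
    "b \<cdot> i1 = x" "y \<cdot> b = p2" using Rlz_unique[OF Rlz_zero[OF b] assms] .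
  have r: "\<And>f. f \<in> Arr K \<Longrightarrow> Cod K f = S \<Longrightarrow> b' \<cdot> b \<cdot> f = f"
      "\<And>f. f \<in> Arr K \<Longrightarrow> Cod K f = S \<Longrightarrow> y \<cdot> b \<cdot> f = p2 \<cdot> f"
    using t h bD(1-4) by (simp_all add: hom_simps flip: Cmp_assoc_simp)
  have "b \<cdot> i1 \<cdot> p1 \<cdot> b' \<boxplus> b \<cdot> i2 \<cdot> p2 \<cdot> b' = b \<cdot> (i1 \<cdot> p1 \<boxplus> i2 \<cdot> p2) \<cdot> b'"
    using bD(1-4,10-12) t(1,2) by (simp add: hom_simps)
  also have "\<dots> = Idm K B" unfolding bD(9) using t by (simp add: hom_simps)
  finally have "b \<cdot> i1 \<cdot> p1 \<cdot> b' \<boxplus> b \<cdot> i2 \<cdot> p2 \<cdot> b' = Idm K B" .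
  moreover have "p2 \<cdot> b' = y"
    using t(1,2,4) h by (simp add: hom_simps flip: t(6))
  ultimately have "biproduct K A C B x (b \<cdot> i2) (p1 \<cdot> b') y"
    unfolding t(5)[symmetric] biproduct_def using bD t(1-4) h r by (simp add: hom_simps)
  then show ?thesis using that by blast
qed

text \<open>The complement \<open>n\<close> of \<theta> satisfies \<open>n \<cdot> x = 0\<close> and
  \<open>y \<cdot> n = 0\<close>. The second equation factors \<open>n\<close> through
  \<open>x\<close>, so the first gives \<open>n \<cdot> n = 0\<close>, and \<open>1 + n\<close>
  inverts \<theta>.\<close>

lemma five_endo:
  assumes "etriangle K A x B y C \<delta>" "\<theta> \<in> Hom K B B" "\<theta> \<cdot> x = x" "y \<cdot> \<theta> = y"
  obtains \<phi> where "\<phi> \<in> Hom K B B" "\<phi> \<cdot> \<theta> = Idm K B" "\<theta> \<cdot> \<phi> = Idm K B"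
proof -
  note h = etriangleD[OF assms(1)]
  have I: "Idm K B \<in> Hom K B B" using h by (simp add: hom_simps)
  obtain n where n: "n \<in> Hom K B B" "\<theta> \<boxplus> n = Idm K B" using ex_Add_complement[OF assms(2) I] .
  have "x \<boxplus> n \<cdot> x = (\<theta> \<boxplus> n) \<cdot> x" using assms(2,3) n(1) h by (simp add: hom_simps)
  also have "\<dots> = x" using n h by (simp add: hom_simps)
  finally have nx: "n \<cdot> x = Zer K A B"
    using Add_cancel_Zer[of x "n \<cdot> x" A B] n h by (simp add: hom_simps)
  have "y \<boxplus> y \<cdot> n = y \<cdot> (\<theta> \<boxplus> n)" using assms(2,4) n(1) h by (simp add: hom_simps)
  also have "\<dots> = y" using n h by (simp add: hom_simps)
  finally have yn: "y \<cdot> n = Zer K B C"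
    using Add_cancel_Zer[of y "y \<cdot> n" B C] n h by (simp add: hom_simps)
  obtain s where s: "s \<in> Hom K B A" "x \<cdot> s = n" using lift_through_inflation[OF assms(1) n(1) yn] .
  have "n \<cdot> n = (n \<cdot> x) \<cdot> s" using n s h by (simp add: hom_simps)
  then have nn: "n \<cdot> n = Zer K B B" using nx s h by (simp add: hom_simps)
  have a: "n \<cdot> \<theta> = n"
    using arg_cong[OF n(2), of "\<lambda>f. n \<cdot> f"] nn n(1) assms(2) h by (simp add: hom_simps)
  have b: "\<theta> \<cdot> n = n"
    using arg_cong[OF n(2), of "\<lambda>f. f \<cdot> n"] nn n(1) assms(2) h by (simp add: hom_simps)
  show ?thesis
    using n a b assms(2) h by (intro that[of "Idm K B \<boxplus> n"]) (simp_all add: hom_simps)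
qed

text \<open>The lifts \<open>b\<close> and \<open>d\<close> of the two given pairs need not be
  mutually inverse. Their composites fix the outer morphisms, hence are invertible by
  \<open>five_endo\<close>, which yields one-sided inverses of \<open>b\<close> on both
  sides.\<close>

lemma five_iso:
  assumes "etriangle K A x B y C \<delta>" "etriangle K A' x' B' y' C' \<delta>'"
    "a \<in> Hom K A A'" "a' \<in> Hom K A' A" "a' \<cdot> a = Idm K A" "a \<cdot> a' = Idm K A'"
    "c \<in> Hom K C C'" "c' \<in> Hom K C' C" "c' \<cdot> c = Idm K C" "c \<cdot> c' = Idm K C'"
    "Push K a \<delta> = Pull K c \<delta>'"
  obtains b b' where "b \<in> Hom K B B'" "b' \<in> Hom K B' B" "b' \<cdot> b = Idm K B" "b \<cdot> b' = Idm K B'"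
    "b \<cdot> x = x' \<cdot> a" "y' \<cdot> b = c \<cdot> y"
proof -
  note h = etriangleD[OF assms(1)] and h' = etriangleD[OF assms(2)]
  have e1: "Pull K c' (Push K a \<delta>) = \<delta>'"
    using Pull_Cmp[OF h'(1) assms(7,8)] Pull_Idm[OF h'(1)] assms(10,11) by simp
  have "Push K a' \<delta>' = Pull K c' (Push K a' (Push K a \<delta>))"
    unfolding e1[symmetric] using Push_Pull[OF Push_Ext[OF h(1) assms(3)] assms(4,8)] .
  also have "Push K a' (Push K a \<delta>) = \<delta>"
    using Push_Cmp[OF h(1) assms(3,4)] Push_Idm[OF h(1)] assms(5) by simp
  finally have e2: "Push K a' \<delta>' = Pull K c' \<delta>" .
  obtain b where b: "b \<in> Hom K B B'" "b \<cdot> x = x' \<cdot> a" "y' \<cdot> b = c \<cdot> y"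
    using Rlz_morphism[OF assms(1,2,3,7,11)] by blast
  obtain d where d: "d \<in> Hom K B' B" "d \<cdot> x' = x \<cdot> a'" "y \<cdot> d = c' \<cdot> y'"
    using Rlz_morphism[OF assms(2,1,4,8) e2] by blast
  note hs = h(2-6) h'(2-6) b(1) d(1) assms(3,4,7,8)
  have r: "\<And>f. f \<in> Arr K \<Longrightarrow> Cod K f = C \<Longrightarrow> c' \<cdot> c \<cdot> f = f"
      "\<And>f. f \<in> Arr K \<Longrightarrow> Cod K f = C' \<Longrightarrow> c \<cdot> c' \<cdot> f = f"
      "\<And>f. f \<in> Arr K \<Longrightarrow> Cod K f = A' \<Longrightarrow> d \<cdot> x' \<cdot> f = x \<cdot> a' \<cdot> f"
      "\<And>f. f \<in> Arr K \<Longrightarrow> Cod K f = A \<Longrightarrow> b \<cdot> x \<cdot> f = x' \<cdot> a \<cdot> f"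
      "\<And>f. f \<in> Arr K \<Longrightarrow> Cod K f = B' \<Longrightarrow> y \<cdot> d \<cdot> f = c' \<cdot> y' \<cdot> f"
      "\<And>f. f \<in> Arr K \<Longrightarrow> Cod K f = B \<Longrightarrow> y' \<cdot> b \<cdot> f = c \<cdot> y \<cdot> f"
    using assms(9,10) d(2,3) b(2,3) hs by (simp_all add: hom_simps flip: Cmp_assoc_simp)
  have "(d \<cdot> b) \<cdot> x = x" "y \<cdot> (d \<cdot> b) = y" "(b \<cdot> d) \<cdot> x' = x'" "y' \<cdot> (b \<cdot> d) = y'"
    using hs r assms(5,6) b(2,3) d(2,3) by (simp_all add: hom_simps)
  then obtain \<phi> \<psi> where p: "\<phi> \<in> Hom K B B" "\<phi> \<cdot> (d \<cdot> b) = Idm K B" "\<psi> \<in> Hom K B' B'" "(b \<cdot> d) \<cdot> \<psi> = Idm K B'"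
    using five_endo[OF assms(1), of "d \<cdot> b"] five_endo[OF assms(2), of "b \<cdot> d"] hs
    by (metis Cmp_Hom)
  have "isomorphism K b"
    by (rule isomorphism_of_one_sided[of b B B' "d \<cdot> \<psi>" "\<phi> \<cdot> d"])
      (use p hs in \<open>simp_all add: hom_simps\<close>)
  then show ?thesis using isomorphismE[OF _ b(1)] that b by metis
qed

lemma etriangle_iso_cone:
  assumes "etriangle K A x B y C \<delta>" "c \<in> Hom K C' C" "c' \<in> Hom K C C'" "c' \<cdot> c = Idm K C'" "c \<cdot> c' = Idm K C"
  shows "is_etriangle K A B C'"
proof -
  note h = etriangleD[OF assms(1)]
  obtain u E v where E: "etriangle K A u E v C' (Pull K c \<delta>)" using ex_etriangle[OF Pull_Ext[OF h(1) assms(2)]] .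
  have I: "Idm K A \<in> Hom K A A" "Idm K A \<cdot> Idm K A = Idm K A" using h by (simp_all add: hom_simps)
  obtain b b' where b: "b \<in> Hom K E B" "b' \<in> Hom K B E" "b' \<cdot> b = Idm K E" "b \<cdot> b' = Idm K B"
    using five_iso[OF E assms(1) I(1) I(1) I(2) I(2) assms(2-5)] Push_Idm[OF etriangleD(1)[OF E]] by metis
  show ?thesis using Rlz_transport[OF E b] by (auto simp: is_etriangle_def)
qed

lemma etriangle_iso_cocone:
  assumes "etriangle K A x B y C \<delta>" "a \<in> Hom K A A'" "a' \<in> Hom K A' A" "a' \<cdot> a = Idm K A" "a \<cdot> a' = Idm K A'"
  shows "is_etriangle K A' B C"
proof -
  note h = etriangleD[OF assms(1)]
  obtain u E v where E: "etriangle K A' u E v C (Push K a \<delta>)" using ex_etriangle[OF Push_Ext[OF h(1) assms(2)]] .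
  have I: "Idm K C \<in> Hom K C C" "Idm K C \<cdot> Idm K C = Idm K C" using h by (simp_all add: hom_simps)
  obtain b b' where b: "b \<in> Hom K B E" "b' \<in> Hom K E B" "b' \<cdot> b = Idm K B" "b \<cdot> b' = Idm K E"
    using five_iso[OF assms(1) E assms(2-5) I(1) I(1) I(2) I(2)] Pull_Idm[OF etriangleD(1)[OF E]] by metis
  show ?thesis using Rlz_transport[OF E b(2,1,4,3)] by (auto simp: is_etriangle_def)
qed

end

section \<open>Pullbacks, pushouts and vanishing of higher extensions\<close>

context extriangulated_category
begin

lemma is_etriangle_Obj:
  assumes "is_etriangle K A B C" shows "A \<in> Obj K" "B \<in> Obj K" "C \<in> Obj K"
  using assms etriangleD by (auto simp: is_etriangle_def)

lemma is_etriangle_zero: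
  assumes "zero_object K Z" "A \<in> Obj K" shows "is_etriangle K A A Z" "is_etriangle K Z A A"
  using etriangle_id_left[OF assms] etriangle_id_right[OF assms] by (auto simp: is_etriangle_def)

lemma is_etriangle_biproduct:
  assumes "is_biproduct K A C B" shows "is_etriangle K A B C" "is_etriangle K C B A"
  using assms Rlz_zero biproduct_swap unfolding is_biproduct_def is_etriangle_def by blast+

lemma is_etriangle_sum:
  assumes "is_etriangle K A B C" "is_etriangle K A' B' C'"
    "is_biproduct K A A' AA" "is_biproduct K B B' BB" "is_biproduct K C C' CC"
  shows "is_etriangle K AA BB CC"
proof -
  obtain x y \<delta> where 1: "etriangle K A x B y C \<delta>" using assms(1) by (auto simp: is_etriangle_def)
  obtain x' y' \<delta>' where 2: "etriangle K A' x' B' y' C' \<delta>'" using assms(2) by (auto simp: is_etriangle_def)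
  show ?thesis
    using Rlz_direct_sum[OF 1 2] assms(3-5) unfolding is_etriangle_def is_biproduct_def by metis
qed

lemma is_etriangle_ET4:
  assumes "is_etriangle K A B D" "is_etriangle K B C F"
  obtains E where "is_etriangle K A C E" "is_etriangle K D E F"
  using assms ET4 unfolding is_etriangle_def by metis

lemma is_etriangle_ET4op:
  assumes "is_etriangle K D A B" "is_etriangle K F B C"
  obtains E where "is_etriangle K E A C" "is_etriangle K D E F"
  using assms ET4op unfolding is_etriangle_def by metis

text \<open>The sum is the extension of \<open>C\<close> by \<open>A1 \<oplus> A2\<close> with
  components \<delta>1 and \<delta>2. Its middle term serves as the pullback of the two deflations
  onto \<open>C\<close>.\<close>

lemma Push_biproduct:
  assumes "biproduct K A1 A2 S i1 i2 p1 p2" "\<delta>1 \<in> Ext K C A1" "\<delta>2 \<in> Ext K C A2"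
  shows "Push K p1 (EAdd K (Push K i1 \<delta>1) (Push K i2 \<delta>2)) = \<delta>1"
    "Push K p2 (EAdd K (Push K i1 \<delta>1) (Push K i2 \<delta>2)) = \<delta>2"
proof -
  note b = biproductD[OF assms(1)] ExtD[OF assms(2)]
  note m = Push_Ext[OF assms(2) b(1)] Push_Ext[OF assms(3) b(2)]
  show "Push K p1 (EAdd K (Push K i1 \<delta>1) (Push K i2 \<delta>2)) = \<delta>1"
    using Push_EAdd[OF m b(3)] Push_Cmp[OF assms(2) b(1,3)] Push_Cmp[OF assms(3) b(2,3)] b
      Push_Idm[OF assms(2)] Push_Zer[OF assms(3)] EAdd_EZer[OF assms(2)] by simp
  show "Push K p2 (EAdd K (Push K i1 \<delta>1) (Push K i2 \<delta>2)) = \<delta>2"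
    using Push_EAdd[OF m b(4)] Push_Cmp[OF assms(2) b(1,4)] Push_Cmp[OF assms(3) b(2,4)] b
      Push_Idm[OF assms(3)] Push_Zer[OF assms(2)] EAdd_EZer[OF assms(3)] by simp
qed

lemma Pull_biproduct:
  assumes "biproduct K C1 C2 S i1 i2 p1 p2" "\<delta>1 \<in> Ext K C1 A" "\<delta>2 \<in> Ext K C2 A"
  shows "Pull K i1 (EAdd K (Pull K p1 \<delta>1) (Pull K p2 \<delta>2)) = \<delta>1"
    "Pull K i2 (EAdd K (Pull K p1 \<delta>1) (Pull K p2 \<delta>2)) = \<delta>2"
proof -
  note b = biproductD[OF assms(1)] ExtD[OF assms(2)]
  note m = Pull_Ext[OF assms(2) b(3)] Pull_Ext[OF assms(3) b(4)]
  show "Pull K i1 (EAdd K (Pull K p1 \<delta>1) (Pull K p2 \<delta>2)) = \<delta>1"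
    using Pull_EAdd[OF m b(1)] Pull_Cmp[OF assms(2) b(3,1)] Pull_Cmp[OF assms(3) b(4,1)] b
      Pull_Idm[OF assms(2)] Pull_Zer[OF assms(3)] EAdd_EZer[OF assms(2)] by simp
  show "Pull K i2 (EAdd K (Pull K p1 \<delta>1) (Pull K p2 \<delta>2)) = \<delta>2"
    using Pull_EAdd[OF m b(2)] Pull_Cmp[OF assms(2) b(3,2)] Pull_Cmp[OF assms(3) b(4,2)] b
      Pull_Idm[OF assms(3)] Pull_Zer[OF assms(2)] EAdd_EZer[OF assms(3)] by simp
qed

text \<open>ET4 for \<open>A1 \<rightarrow> S \<rightarrow> M\<close> shows that the cone of the
  composite is an extension of \<open>C\<close> by \<open>A2\<close> of class
  \<open>Push K p2 \<mu>\<close>; uniqueness of realizations identifies it with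
  \<open>B2\<close>.\<close>

lemma pullback_step:
  assumes "biproduct K A1 A2 S i1 i2 p1 p2" "etriangle K S m M n C \<mu>"
    "etriangle K A2 x2 B2 y2 C (Push K p2 \<mu>)"
  shows "is_etriangle K A1 M B2"
proof -
  obtain E h' d e \<delta>'' where 1: "etriangle K A1 (m \<cdot> i1) M h' E \<delta>''"
      "etriangle K A2 d E e C (Push K p2 \<mu>)"
    using ET4[OF Rlz_zero[OF assms(1)] assms(2)] by blast
  obtain b b' where "b \<in> Hom K E B2" "b' \<in> Hom K B2 E" "b' \<cdot> b = Idm K E" "b \<cdot> b' = Idm K B2"
    using Rlz_unique[OF 1(2) assms(3)] .
  then show ?thesis using etriangle_iso_cone[OF 1(1)] by blast
qed

lemma is_etriangle_pullback:
  assumes "is_etriangle K A1 B1 C" "is_etriangle K A2 B2 C"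
  obtains M where "is_etriangle K A1 M B2" "is_etriangle K A2 M B1"
proof -
  obtain x1 y1 \<delta>1 where 1: "etriangle K A1 x1 B1 y1 C \<delta>1" using assms(1) by (auto simp: is_etriangle_def)
  obtain x2 y2 \<delta>2 where 2: "etriangle K A2 x2 B2 y2 C \<delta>2" using assms(2) by (auto simp: is_etriangle_def)
  note d = etriangleD[OF 1] etriangleD[OF 2]
  obtain S i1 i2 p1 p2 where b: "biproduct K A1 A2 S i1 i2 p1 p2"
    using ex_biproduct[of A1 A2] d by (auto simp: is_biproduct_def)
  let ?\<mu> = "EAdd K (Push K i1 \<delta>1) (Push K i2 \<delta>2)"
  note bD = biproductD[OF b]
  have "?\<mu> \<in> Ext K C S" using d bD by (intro EAdd_Ext Push_Ext)
  then obtain m M n where M: "etriangle K S m M n C ?\<mu>" using ex_etriangle by blast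
  note P = Push_biproduct[OF b d(1) d(7)]
  show ?thesis
    using that pullback_step[OF b M] pullback_step[OF biproduct_swap[OF b] M] 1 2 P by metis
qed

lemma pushout_step:
  assumes "biproduct K C1 C2 S i1 i2 p1 p2" "etriangle K A m M n S \<mu>"
    "etriangle K A x1 B1 y1 C1 (Pull K i1 \<mu>)"
  shows "is_etriangle K B1 M C2"
proof -
  obtain E h' d e \<delta>'' where 1: "etriangle K E h' M (p2 \<cdot> n) C2 \<delta>''"
      "etriangle K A d E e C1 (Pull K i1 \<mu>)"
    using ET4op[OF assms(2) Rlz_zero[OF assms(1)]] by blast
  obtain b b' where "b \<in> Hom K E B1" "b' \<in> Hom K B1 E" "b' \<cdot> b = Idm K E" "b \<cdot> b' = Idm K B1"
    using Rlz_unique[OF 1(2) assms(3)] .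
  then show ?thesis using etriangle_iso_cocone[OF 1(1)] by blast
qed

lemma is_etriangle_pushout:
  assumes "is_etriangle K A B1 C1" "is_etriangle K A B2 C2"
  obtains M where "is_etriangle K B1 M C2" "is_etriangle K B2 M C1"
proof -
  obtain x1 y1 \<delta>1 where 1: "etriangle K A x1 B1 y1 C1 \<delta>1" using assms(1) by (auto simp: is_etriangle_def)
  obtain x2 y2 \<delta>2 where 2: "etriangle K A x2 B2 y2 C2 \<delta>2" using assms(2) by (auto simp: is_etriangle_def)
  note d = etriangleD[OF 1] etriangleD[OF 2]
  obtain S i1 i2 p1 p2 where b: "biproduct K C1 C2 S i1 i2 p1 p2"
    using ex_biproduct[of C1 C2] d by (auto simp: is_biproduct_def)
  let ?\<mu> = "EAdd K (Pull K p1 \<delta>1) (Pull K p2 \<delta>2)"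
  note bD = biproductD[OF b]
  have "?\<mu> \<in> Ext K S A" using d bD by (intro EAdd_Ext Pull_Ext)
  then obtain m M n where M: "etriangle K A m M n S ?\<mu>" using ex_etriangle by blast
  note P = Pull_biproduct[OF b d(1) d(7)]
  show ?thesis
    using that pushout_step[OF b M] pushout_step[OF biproduct_swap[OF b] M] 1 2 P by metis
qed

text \<open>WIC makes \<open>r\<close> a deflation, since the identity \<open>r \<cdot> s\<close> is
  one. Its class vanishes along \<open>r\<close> and is recovered by pulling back along
  \<open>s\<close>, so it is zero and the triangle splits.\<close>

lemma retract_direct_summand:
  assumes "WIC K" "s \<in> Hom K X Y" "r \<in> Hom K Y X" "r \<cdot> s = Idm K X"
  shows "direct_summand K X Y"
proof -
  obtain Z where Z: "zero_object K Z" using ex_zero_object by blast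
  note h = HomD[OF assms(2)]
  have "deflation K (r \<cdot> s)"
    unfolding assms(4) deflation_def using etriangle_id_right[OF Z h(4)] by blast
  then have "deflation K r" using assms(1-3) unfolding WIC_def by blast
  then obtain N x \<delta> where N: "etriangle K N x Y r X \<delta>"
    using HomD[OF assms(3)] unfolding deflation_def by (metis etriangleD(3) HomD(2,3))
  note hN = etriangleD[OF N]
  have "\<delta> = Pull K s (Pull K r \<delta>)"
    using Pull_Cmp[OF hN(1) assms(3,2)] Pull_Idm[OF hN(1)] assms(4) by simp
  also have "\<dots> = EZer K X N" unfolding Pull_deflation[OF N] using Pull_EZer[OF assms(2)] hN by simp
  finally show ?thesis
    using N etriangle_split[of N x Y r X] biproduct_swap
    unfolding direct_summand_def is_biproduct_def by metis
qed

text \<open>An inclusion rather than an equality: no membership of the zero extension has to be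
  proved.\<close>

definition triv :: "'o \<Rightarrow> 'o \<Rightarrow> bool" where
  "triv X Y \<longleftrightarrow> Ext K X Y \<subseteq> {EZer K X Y}"

text \<open>Degrees are shifted by one: \<open>vanish n X Y\<close> means \<open>\<E>\<^sup>n\<^sup>+\<^sup>1(X, Y) = 0\<close>.\<close>

definition vanish :: "nat \<Rightarrow> 'o \<Rightarrow> 'o \<Rightarrow> bool" where
  "vanish n X Y \<longleftrightarrow> triv ((syzygy K ^^ n) X) Y"

lemma trivD: "\<lbrakk>triv X Y; \<delta> \<in> Ext K X Y\<rbrakk> \<Longrightarrow> \<delta> = EZer K X Y"
  by (auto simp: triv_def)

lemma vanish_0: "vanish 0 X Y = triv X Y"
  by (simp add: vanish_def)

lemma triv_split:
  assumes "is_etriangle K A B C" "triv C A" shows "is_biproduct K A C B"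
  using assms trivD etriangleD(1) etriangle_split unfolding is_etriangle_def is_biproduct_def by metis

lemma triv_extend:
  assumes "etriangle K A x B y C \<delta>" "triv C Y" "f \<in> Hom K A Y"
  obtains g where "g \<in> Hom K B Y" "g \<cdot> x = f"
  using extend_along_inflation[OF assms(1,3)] trivD[OF assms(2) Push_Ext[OF etriangleD(1)[OF assms(1)] assms(3)]] .

lemma triv_zero:
  assumes "zero_object K Z" shows "triv X Z" "triv Z X"
proof -
  have "Z \<in> Obj K" "Idm K Z = Zer K Z Z"
    using assms zero_object_unique(1)[OF assms, of "Idm K Z" Z] Idm_Hom by (auto simp: zero_object_def)
  then show "triv X Z" "triv Z X" unfolding triv_def
    using Push_Idm Pull_Idm Push_Zer Pull_Zer by (metis insertI1 subsetI)+
qed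

lemma triv_right_mid:
  assumes "is_etriangle K A B C" "triv X A" "triv X C" shows "triv X B"
  unfolding triv_def
proof
  fix \<epsilon> assume e: "\<epsilon> \<in> Ext K X B"
  obtain x y \<delta> where t: "etriangle K A x B y C \<delta>" using assms(1) by (auto simp: is_etriangle_def)
  note d = etriangleD[OF t]
  obtain \<epsilon>' where "\<epsilon>' \<in> Ext K X A" "Push K x \<epsilon>' = \<epsilon>"
    using Push_exact[OF t e trivD[OF assms(3) Push_Ext[OF e d(3)]]] .
  then show "\<epsilon> \<in> {EZer K X B}" using trivD[OF assms(2)] Push_EZer[OF d(2)] ExtD[OF e] by auto
qed

lemma triv_left_mid:
  assumes "is_etriangle K A B C" "triv A Y" "triv C Y" shows "triv B Y"
  unfolding triv_def
proof
  fix \<epsilon> assume e: "\<epsilon> \<in> Ext K B Y"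
  obtain x y \<delta> where t: "etriangle K A x B y C \<delta>" using assms(1) by (auto simp: is_etriangle_def)
  note d = etriangleD[OF t]
  obtain \<epsilon>' where "\<epsilon>' \<in> Ext K C Y" "Pull K y \<epsilon>' = \<epsilon>"
    using Pull_exact[OF t e trivD[OF assms(2) Pull_Ext[OF e d(2)]]] .
  then show "\<epsilon> \<in> {EZer K B Y}" using trivD[OF assms(3)] Pull_EZer[OF d(3)] ExtD[OF e] by auto
qed

lemma projective_triv:
  assumes "projective K P" shows "triv P Y"
  unfolding triv_def
proof
  fix \<epsilon> assume e: "\<epsilon> \<in> Ext K P Y"
  obtain x E y where t: "etriangle K Y x E y P \<epsilon>" using ex_etriangle[OF e] .
  note d = etriangleD[OF t]
  obtain s where s: "s \<in> Hom K P E" "y \<cdot> s = Idm K P"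
    using assms t d Idm_Hom unfolding projective_def by blast
  have "\<epsilon> = Pull K s (Pull K y \<epsilon>)" using Pull_Cmp[OF e d(3) s(1)] s(2) Pull_Idm[OF e] by simp
  then show "\<epsilon> \<in> {EZer K P Y}" unfolding Pull_deflation[OF t] using Pull_EZer[OF s(1)] d by simp
qed

lemma injective_in_split:
  assumes "injective_in K \<Y> I" "etriangle K I x B y C \<delta>" "B \<in> \<Y>" "C \<in> \<Y>"
  shows "is_biproduct K I C B"
proof -
  note d = etriangleD[OF assms(2)]
  obtain r where r: "r \<in> Hom K B I" "r \<cdot> x = Idm K I"
    using assms d Idm_Hom unfolding injective_in_def by blast
  have "\<delta> = Push K r (Push K x \<delta>)" using Push_Cmp[OF d(1,2) r(1)] r(2) Push_Idm[OF d(1)] by simp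
  also have "\<dots> = EZer K C I" unfolding Push_inflation[OF assms(2)] using Push_EZer[OF r(1)] d by simp
  finally show ?thesis using assms(2) etriangle_split unfolding is_biproduct_def by metis
qed

lemma injective_triv:
  assumes "injective_in K (Obj K) I" shows "triv X I"
  unfolding triv_def
proof
  fix \<epsilon> assume e: "\<epsilon> \<in> Ext K X I"
  obtain x E y where t: "etriangle K I x E y X \<epsilon>" using ex_etriangle[OF e] .
  note d = etriangleD[OF t]
  obtain r where r: "r \<in> Hom K E I" "r \<cdot> x = Idm K I"
    using assms t d Idm_Hom unfolding injective_in_def by blast
  have "\<epsilon> = Push K r (Push K x \<epsilon>)" using Push_Cmp[OF d(1,2) r(1)] r(2) Push_Idm[OF d(1)] by simp
  then show "\<epsilon> \<in> {EZer K X I}" unfolding Push_inflation[OF t] using Push_EZer[OF r(1)] d by simp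
qed

lemma triv_summand:
  assumes "is_biproduct K A C B"
  shows "triv X B \<Longrightarrow> triv X A" "triv B X \<Longrightarrow> triv A X"
proof -
  obtain i1 i2 p1 p2 where b: "biproduct K A C B i1 i2 p1 p2" using assms by (auto simp: is_biproduct_def)
  note bD = biproductD[OF b]
  show "triv X A" if "triv X B"
    unfolding triv_def
  proof
    fix \<epsilon> assume e: "\<epsilon> \<in> Ext K X A"
    have "\<epsilon> = Push K p1 (Push K i1 \<epsilon>)" using Push_Cmp[OF e bD(1,3)] bD(5) Push_Idm[OF e] by simp
    also have "Push K i1 \<epsilon> = EZer K X B" using trivD[OF that Push_Ext[OF e bD(1)]] .
    finally show "\<epsilon> \<in> {EZer K X A}" using Push_EZer[OF bD(3)] ExtD[OF e] by simp
  qed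
  show "triv A X" if "triv B X"
    unfolding triv_def
  proof
    fix \<epsilon> assume e: "\<epsilon> \<in> Ext K A X"
    have "\<epsilon> = Pull K i1 (Pull K p1 \<epsilon>)" using Pull_Cmp[OF e bD(3,1)] bD(5) Pull_Idm[OF e] by simp
    also have "Pull K p1 \<epsilon> = EZer K B X" using trivD[OF that Pull_Ext[OF e bD(3)]] .
    finally show "\<epsilon> \<in> {EZer K A X}" using Pull_EZer[OF bD(1)] ExtD[OF e] by simp
  qed
qed

end

text \<open>Shifts degrees in the second argument, while \<open>syzygy\<close> shifts them in the
  first. Comparing the two shifts transfers exactness from one argument to the other.\<close>

definition cosyzygy :: "('o, 'm, 'e, 'z) ext_struct_scheme \<Rightarrow> 'o \<Rightarrow> 'o" where
  "cosyzygy K Y = (SOME C. \<exists>I. injective_in K (Obj K) I \<and> is_etriangle K Y I C)"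

locale enough_extriangulated_category = extriangulated_category K
  for K :: "('o, 'm, 'e, 'z) ext_struct_scheme" (structure) +
  assumes enough_proj: "enough_projectives K"
    and enough_inj: "enough_injectives K"
begin

section \<open>Dimension shifting in both arguments\<close>

lemma syzygy_etriangle:
  assumes "X \<in> Obj K"
  obtains u P v \<sigma> where "projective K P" "etriangle K (syzygy K X) u P v X \<sigma>"
proof -
  have "\<exists>P. projective K P \<and> is_etriangle K (syzygy K X) P X"
    using enough_proj assms unfolding syzygy_def enough_projectives_def by (metis (mono_tags, lifting) someI_ex)
  then show ?thesis using that by (auto simp: is_etriangle_def)
qed

lemma cosyzygy_etriangle:
  assumes "Y \<in> Obj K"
  obtains u I v \<sigma> where "injective_in K (Obj K) I" "etriangle K Y u I v (cosyzygy K Y) \<sigma>"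
proof -
  have "\<exists>I. injective_in K (Obj K) I \<and> is_etriangle K Y I (cosyzygy K Y)"
    using enough_inj assms unfolding cosyzygy_def enough_injectives_def by (metis (mono_tags, lifting) someI_ex)
  then show ?thesis using that by (auto simp: is_etriangle_def)
qed

lemma syzygy_Obj: "X \<in> Obj K \<Longrightarrow> syzygy K X \<in> Obj K"
  using syzygy_etriangle etriangleD(4) by metis

lemma cosyzygy_Obj: "X \<in> Obj K \<Longrightarrow> cosyzygy K X \<in> Obj K"
  using cosyzygy_etriangle etriangleD(6) by metis

lemma syzygy_pow_Obj: "X \<in> Obj K \<Longrightarrow> (syzygy K ^^ n) X \<in> Obj K"
  by (induction n) (auto simp: syzygy_Obj)

lemma cosyzygy_pow_Obj: "X \<in> Obj K \<Longrightarrow> (cosyzygy K ^^ n) X \<in> Obj K"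
  by (induction n) (auto simp: cosyzygy_Obj)

text \<open>A class in \<E>(X, C) comes from a map \<open>syzygy K X \<rightarrow> C\<close>. This
  map lifts to \<open>B\<close> because \<E>(syzygy X, A) vanishes, so the class comes from \<E>(X,
  B).\<close>

lemma triv_right_cone:
  assumes "is_etriangle K A B C" "X \<in> Obj K" "triv X B" "triv (syzygy K X) A" shows "triv X C"
  unfolding triv_def
proof
  fix \<epsilon> assume e: "\<epsilon> \<in> Ext K X C"
  obtain x y \<delta> where t: "etriangle K A x B y C \<delta>" using assms(1) by (auto simp: is_etriangle_def)
  obtain u P v \<sigma> where P: "projective K P" "etriangle K (syzygy K X) u P v X \<sigma>"
    using syzygy_etriangle[OF assms(2)] .
  note d = etriangleD[OF t] and dP = etriangleD[OF P(2)]
  obtain f where f: "f \<in> Hom K (syzygy K X) C" "Push K f \<sigma> = \<epsilon>"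
    using Push_connecting[OF P(2) e trivD[OF projective_triv[OF P(1)] Pull_Ext[OF e dP(3)]]] .
  obtain g where g: "g \<in> Hom K (syzygy K X) B" "y \<cdot> g = f"
    using lift_along_deflation[OF t f(1) trivD[OF assms(4) Pull_Ext[OF d(1) f(1)]]] .
  have "\<epsilon> = Push K y (Push K g \<sigma>)" using Push_Cmp[OF dP(1) g(1) d(3)] f g by simp
  then show "\<epsilon> \<in> {EZer K X C}"
    using trivD[OF assms(3) Push_Ext[OF dP(1) g(1)]] Push_EZer[OF d(3)] assms(2) by simp
qed

text \<open>A class on the syzygy comes from a map into \<open>C\<close>, which extends over the
  projective \<open>P\<close> because \<E>(X, C) vanishes; hence the class is restricted from
  \<open>P\<close>.\<close>

lemma triv_right_cocone:
  assumes "is_etriangle K A B C" "X \<in> Obj K" "triv X C" "triv (syzygy K X) B" shows "triv (syzygy K X) A"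
  unfolding triv_def
proof
  fix \<epsilon> assume e: "\<epsilon> \<in> Ext K (syzygy K X) A"
  obtain x y \<delta> where t: "etriangle K A x B y C \<delta>" using assms(1) by (auto simp: is_etriangle_def)
  obtain u P v \<sigma> where P: "projective K P" "etriangle K (syzygy K X) u P v X \<sigma>"
    using syzygy_etriangle[OF assms(2)] .
  note d = etriangleD[OF t] and dP = etriangleD[OF P(2)]
  obtain g where g: "g \<in> Hom K (syzygy K X) C" "Pull K g \<delta> = \<epsilon>"
    using Pull_connecting[OF t e trivD[OF assms(4) Push_Ext[OF e d(2)]]] .
  obtain h where h: "h \<in> Hom K P C" "h \<cdot> u = g"
    using extend_along_inflation[OF P(2) g(1) trivD[OF assms(3) Push_Ext[OF dP(1) g(1)]]] .
  have "\<epsilon> = Pull K u (Pull K h \<delta>)" using Pull_Cmp[OF d(1) h(1) dP(2)] g h by simp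
  then show "\<epsilon> \<in> {EZer K (syzygy K X) A}"
    using trivD[OF projective_triv[OF P(1)] Pull_Ext[OF d(1) h(1)]] Pull_EZer[OF dP(2)] d by simp
qed

lemma triv_left_cocone:
  assumes "is_etriangle K A B C" "Y \<in> Obj K" "triv B Y" "triv C (cosyzygy K Y)" shows "triv A Y"
  unfolding triv_def
proof
  fix \<epsilon> assume e: "\<epsilon> \<in> Ext K A Y"
  obtain x y \<delta> where t: "etriangle K A x B y C \<delta>" using assms(1) by (auto simp: is_etriangle_def)
  obtain u I v \<sigma> where I: "injective_in K (Obj K) I" "etriangle K Y u I v (cosyzygy K Y) \<sigma>"
    using cosyzygy_etriangle[OF assms(2)] .
  note d = etriangleD[OF t] and dI = etriangleD[OF I(2)]
  obtain f where f: "f \<in> Hom K A (cosyzygy K Y)" "Pull K f \<sigma> = \<epsilon>"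
    using Pull_connecting[OF I(2) e trivD[OF injective_triv[OF I(1)] Push_Ext[OF e dI(2)]]] .
  obtain g where g: "g \<in> Hom K B (cosyzygy K Y)" "g \<cdot> x = f"
    using extend_along_inflation[OF t f(1) trivD[OF assms(4) Push_Ext[OF d(1) f(1)]]] .
  have "\<epsilon> = Pull K x (Pull K g \<sigma>)" using Pull_Cmp[OF dI(1) g(1) d(2)] f g by simp
  then show "\<epsilon> \<in> {EZer K A Y}"
    using trivD[OF assms(3) Pull_Ext[OF dI(1) g(1)]] Pull_EZer[OF d(2)] assms(2) by simp
qed

lemma triv_left_cone:
  assumes "is_etriangle K A B C" "Y \<in> Obj K" "triv A Y" "triv B (cosyzygy K Y)" shows "triv C (cosyzygy K Y)"
  unfolding triv_def
proof
  fix \<epsilon> assume e: "\<epsilon> \<in> Ext K C (cosyzygy K Y)"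
  obtain x y \<delta> where t: "etriangle K A x B y C \<delta>" using assms(1) by (auto simp: is_etriangle_def)
  obtain u I v \<sigma> where I: "injective_in K (Obj K) I" "etriangle K Y u I v (cosyzygy K Y) \<sigma>"
    using cosyzygy_etriangle[OF assms(2)] .
  note d = etriangleD[OF t] and dI = etriangleD[OF I(2)]
  obtain g where g: "g \<in> Hom K A (cosyzygy K Y)" "Push K g \<delta> = \<epsilon>"
    using Push_connecting[OF t e trivD[OF assms(4) Pull_Ext[OF e d(3)]]] .
  obtain h where h: "h \<in> Hom K A I" "v \<cdot> h = g"
    using lift_along_deflation[OF I(2) g(1) trivD[OF assms(3) Pull_Ext[OF dI(1) g(1)]]] .
  have "\<epsilon> = Push K v (Push K h \<delta>)" using Push_Cmp[OF d(1) h(1) dI(3)] g h by simp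
  then show "\<epsilon> \<in> {EZer K C (cosyzygy K Y)}"
    using trivD[OF injective_triv[OF I(1)] Push_Ext[OF d(1) h(1)]] Push_EZer[OF dI(3)] d by simp
qed

text \<open>The two preceding lemmas for the second argument, applied to
  \<open>Y \<rightarrow> I \<rightarrow> cosyzygy K Y\<close> with \<open>I\<close>
  injective.\<close>

lemma triv_shift:
  assumes "X \<in> Obj K" "Y \<in> Obj K" shows "triv (syzygy K X) Y \<longleftrightarrow> triv X (cosyzygy K Y)"
proof -
  obtain u I v \<sigma> where "injective_in K (Obj K) I" "etriangle K Y u I v (cosyzygy K Y) \<sigma>"
    using cosyzygy_etriangle[OF assms(2)] .
  then show ?thesis
    using triv_right_cone triv_right_cocone injective_triv assms(1) unfolding is_etriangle_def by blast
qed

lemma vanish_cosyzygy: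
  assumes "X \<in> Obj K" "Y \<in> Obj K" shows "vanish n X Y \<longleftrightarrow> triv X ((cosyzygy K ^^ n) Y)"
  using assms
proof (induction n arbitrary: Y)
  case (Suc n)
  have "vanish (Suc n) X Y \<longleftrightarrow> vanish n X (cosyzygy K Y)"
    using triv_shift[of "(syzygy K ^^ n) X" Y] Suc.prems syzygy_pow_Obj by (simp add: vanish_def)
  then show ?case using Suc cosyzygy_Obj by (simp add: funpow_swap1)
qed (simp add: vanish_0)

lemma vanish_right_mid:
  "\<lbrakk>is_etriangle K A B C; vanish n X A; vanish n X C\<rbrakk> \<Longrightarrow> vanish n X B"
  unfolding vanish_def by (rule triv_right_mid)

lemma vanish_right_cone:
  "\<lbrakk>is_etriangle K A B C; X \<in> Obj K; vanish n X B; vanish (Suc n) X A\<rbrakk> \<Longrightarrow> vanish n X C"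
  unfolding vanish_def by (auto intro: triv_right_cone syzygy_pow_Obj)

lemma vanish_right_cocone:
  "\<lbrakk>is_etriangle K A B C; X \<in> Obj K; vanish n X C; vanish (Suc n) X B\<rbrakk> \<Longrightarrow> vanish (Suc n) X A"
  unfolding vanish_def by (auto intro: triv_right_cocone syzygy_pow_Obj)

lemma vanish_left_mid:
  "\<lbrakk>is_etriangle K A B C; Y \<in> Obj K; vanish n A Y; vanish n C Y\<rbrakk> \<Longrightarrow> vanish n B Y"
  using triv_left_mid is_etriangle_Obj by (simp add: vanish_cosyzygy)

lemma vanish_left_cocone:
  "\<lbrakk>is_etriangle K A B C; Y \<in> Obj K; vanish n B Y; vanish (Suc n) C Y\<rbrakk> \<Longrightarrow> vanish n A Y"
  using triv_left_cocone[of A B C "(cosyzygy K ^^ n) Y"] is_etriangle_Obj[of A B C] cosyzygy_pow_Obj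
  by (simp add: vanish_cosyzygy)

lemma vanish_left_cone:
  "\<lbrakk>is_etriangle K A B C; Y \<in> Obj K; vanish n A Y; vanish (Suc n) B Y\<rbrakk> \<Longrightarrow> vanish (Suc n) C Y"
  using triv_left_cone[of A B C "(cosyzygy K ^^ n) Y"] is_etriangle_Obj[of A B C] cosyzygy_pow_Obj
  by (simp add: vanish_cosyzygy)

lemma vanish_summand:
  assumes "is_biproduct K A C B"
  shows "vanish n X B \<Longrightarrow> vanish n X A" "\<lbrakk>X \<in> Obj K; vanish n B X\<rbrakk> \<Longrightarrow> vanish n A X"
  using triv_summand[OF assms] is_biproduct_Obj[OF assms] by (auto simp: vanish_cosyzygy, simp add: vanish_def)

lemma vanish_zero:
  assumes "zero_object K Z" shows "vanish n X Z" "X \<in> Obj K \<Longrightarrow> vanish n Z X"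
  using triv_zero[OF assms] assms by (auto simp: vanish_def[of n X] vanish_cosyzygy zero_object_def)

text \<open>Degree \<open>i\<close> is defined with \<open>i - 1\<close> syzygies, hence the shift
  between \<open>Suc n\<close> and \<open>n\<close>.\<close>

lemma higher_Ext_vanishes_iff:
  assumes "X \<in> Obj K" "Y \<in> Obj K"
  shows "higher_Ext_vanishes K (Suc n) X Y \<longleftrightarrow> vanish n X Y"
  using EZer_Ext[OF syzygy_pow_Obj[OF assms(1)] assms(2), of n]
  by (auto simp: higher_Ext_vanishes_def higher_Ext_group_def Ext_group_def vanish_def triv_def)

lemma all_ge_1_iff: "(\<forall>i \<ge> (1::nat). P i) \<longleftrightarrow> (\<forall>n. P (Suc n))"
  by (metis One_nat_def Suc_le_D Suc_le_mono le0)

lemma right_perp_iff: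
  assumes "\<omega> \<subseteq> Obj K"
  shows "Y \<in> right_perp K \<omega> \<longleftrightarrow> Y \<in> Obj K \<and> (\<forall>n. \<forall>X \<in> \<omega>. vanish n X Y)"
  unfolding right_perp_def mem_Collect_eq all_ge_1_iff using assms higher_Ext_vanishes_iff by blast

lemma left_perp_iff:
  assumes "\<omega> \<subseteq> Obj K"
  shows "X \<in> left_perp K \<omega> \<longleftrightarrow> X \<in> Obj K \<and> (\<forall>n. \<forall>Y \<in> \<omega>. vanish n X Y)"
  unfolding left_perp_def mem_Collect_eq all_ge_1_iff using assms higher_Ext_vanishes_iff by blast

end

section \<open>Resolution classes of self-orthogonal subcategories\<close>

context extriangulated_category
begin

section \<open>Finite resolutions and coresolutions\<close>

lemma check_base: "\<lbrakk>\<omega> \<subseteq> Obj K; A \<in> \<omega>\<rbrakk> \<Longrightarrow> A \<in> check K \<omega>"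
  unfolding check_def by (auto intro!: exI[of _ "0::nat"] exI[of _ "\<lambda>_. A"])

lemma check_step:
  assumes "is_etriangle K A W B" "W \<in> \<omega>" "B \<in> check K \<omega>" shows "A \<in> check K \<omega>"
proof -
  obtain n V M where m: "M (0::nat) = B" "M n = V n" "\<forall>i \<le> n. V i \<in> \<omega>"
      "\<forall>i < n. is_etriangle K (M i) (V i) (M (Suc i))"
    using assms(3) by (auto simp: check_def)
  let ?V = "case_nat W V" and ?M = "case_nat A M"
  have "?M 0 = A" "?M (Suc n) = ?V (Suc n)" using m(2) by auto
  moreover have "\<forall>i \<le> Suc n. ?V i \<in> \<omega>" using m(3) assms(2) by (auto split: nat.split)
  moreover have "\<forall>i < Suc n. is_etriangle K (?M i) (?V i) (?M (Suc i))"
    using m(1,4) assms(1) by (auto split: nat.split)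
  ultimately show ?thesis unfolding check_def using is_etriangle_Obj(1)[OF assms(1)] by blast
qed

lemma check_induct [consumes 1, case_names base step]:
  assumes "A \<in> check K \<omega>"
    and "\<And>A. A \<in> \<omega> \<Longrightarrow> P A"
    and "\<And>A W B. \<lbrakk>is_etriangle K A W B; W \<in> \<omega>; B \<in> check K \<omega>; P B\<rbrakk> \<Longrightarrow> P A"
  shows "P A"
proof -
  have "P (M 0)" if "M 0 \<in> Obj K" "M n = V n" "\<forall>i \<le> n. V i \<in> \<omega>"
      "\<forall>i < n. is_etriangle K (M i) (V i) (M (Suc i))" for M V and n :: nat
    using that
  proof (induction n arbitrary: M V)
    case (Suc n)
    have t: "is_etriangle K (M 0) (V 0) (M (Suc 0))" using Suc.prems by blast
    have o: "M (Suc 0) \<in> Obj K" using is_etriangle_Obj[OF t] by blast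
    have l: "\<forall>i \<le> n. V (Suc i) \<in> \<omega>" "\<forall>i < n. is_etriangle K (M (Suc i)) (V (Suc i)) (M (Suc (Suc i)))"
      using Suc.prems by auto
    have "P (M (Suc 0))" using Suc.IH[of "\<lambda>i. M (Suc i)" "\<lambda>i. V (Suc i)"] o l Suc.prems(2) by simp
    moreover have "M (Suc 0) \<in> check K \<omega>"
      unfolding check_def using o l Suc.prems(2)
      by (intro CollectI conjI exI[of _ n] exI[of _ "\<lambda>i. V (Suc i)"] exI[of _ "\<lambda>i. M (Suc i)"]) simp_all
    ultimately show ?case using assms(3) t Suc.prems(3) by blast
  qed (use assms(2) in auto)
  then show ?thesis using assms(1) unfolding check_def by blast
qed

lemma check_cases:
  assumes "A \<in> check K \<omega>"
  obtains "A \<in> \<omega>" | W B where "is_etriangle K A W B" "W \<in> \<omega>" "B \<in> check K \<omega>"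
proof -
  from assms have "A \<in> \<omega> \<or> (\<exists>W B. is_etriangle K A W B \<and> W \<in> \<omega> \<and> B \<in> check K \<omega>)"
    by (induction rule: check_induct) blast+
  then show ?thesis using that by blast
qed

lemma check_mono:
  assumes "\<omega> \<subseteq> \<omega>'" "\<omega>' \<subseteq> Obj K" shows "check K \<omega> \<subseteq> check K \<omega>'"
proof
  fix A assume "A \<in> check K \<omega>"
  then show "A \<in> check K \<omega>'"
    using assms check_base check_step by (induction rule: check_induct) blast+
qed

lemma hat_base: "\<lbrakk>\<omega> \<subseteq> Obj K; A \<in> \<omega>\<rbrakk> \<Longrightarrow> A \<in> hat K \<omega>"
  unfolding hat_def by (auto intro!: exI[of _ "0::nat"] exI[of _ "\<lambda>_. A"])

lemma hat_step:
  assumes "is_etriangle K B W A" "W \<in> \<omega>" "B \<in> hat K \<omega>" shows "A \<in> hat K \<omega>"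
proof -
  obtain n V M where m: "M (0::nat) = B" "M n = V n" "\<forall>i \<le> n. V i \<in> \<omega>"
      "\<forall>i < n. is_etriangle K (M (Suc i)) (V i) (M i)"
    using assms(3) by (auto simp: hat_def)
  let ?V = "case_nat W V" and ?M = "case_nat A M"
  have "?M 0 = A" "?M (Suc n) = ?V (Suc n)" using m(2) by auto
  moreover have "\<forall>i \<le> Suc n. ?V i \<in> \<omega>" using m(3) assms(2) by (auto split: nat.split)
  moreover have "\<forall>i < Suc n. is_etriangle K (?M (Suc i)) (?V i) (?M i)"
    using m(1,4) assms(1) by (auto split: nat.split)
  ultimately show ?thesis unfolding hat_def using is_etriangle_Obj(3)[OF assms(1)] by blast
qed

lemma hat_induct [consumes 1, case_names base step]:
  assumes "A \<in> hat K \<omega>"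
    and "\<And>A. A \<in> \<omega> \<Longrightarrow> P A"
    and "\<And>A W B. \<lbrakk>is_etriangle K B W A; W \<in> \<omega>; P B\<rbrakk> \<Longrightarrow> P A"
  shows "P A"
proof -
  have "P (M 0)" if "M n = V n" "\<forall>i \<le> n. V i \<in> \<omega>"
      "\<forall>i < n. is_etriangle K (M (Suc i)) (V i) (M i)" for M V and n :: nat
    using that
  proof (induction n arbitrary: M V)
    case (Suc n)
    have "P (M (Suc 0))" using Suc.IH[of "\<lambda>i. M (Suc i)" "\<lambda>i. V (Suc i)"] Suc.prems by simp
    then show ?case using assms(3) Suc.prems by blast
  qed (use assms(2) in auto)
  then show ?thesis using assms(1) unfolding hat_def by blast
qed

lemma subcategoryD:
  assumes "subcategory K \<D>"
  shows "\<D> \<subseteq> Obj K" "\<exists>Z \<in> \<D>. zero_object K Z"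
    "\<lbrakk>X \<in> \<D>; Y \<in> \<D>; is_biproduct K X Y B\<rbrakk> \<Longrightarrow> B \<in> \<D>"
    "\<lbrakk>B \<in> \<D>; is_biproduct K X Y B\<rbrakk> \<Longrightarrow> X \<in> \<D>"
    "\<lbrakk>B \<in> \<D>; is_biproduct K X Y B\<rbrakk> \<Longrightarrow> Y \<in> \<D>"
  using assms is_biproduct_swap[of X Y B] unfolding subcategory_def direct_summand_def by blast+

lemma subcategory_zero:
  assumes "subcategory K \<D>" "zero_object K Z" shows "Z \<in> \<D>"
proof -
  obtain Z' where Z': "Z' \<in> \<D>" "zero_object K Z'" using subcategoryD(2)[OF assms(1)] by blast
  then have "Z' \<in> Obj K" by (simp add: zero_object_def)
  then show ?thesis using subcategoryD(5)[OF assms(1) Z'(1) is_biproduct_zero(1)[OF assms(2)]] by blast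
qed

text \<open>An isomorphism is a biproduct with zero complement. Through this,
  \<open>subcategoryI\<close> obtains closure under isomorphisms from closure under
  summands.\<close>

lemma direct_summand_iso:
  assumes "isomorphic K X Y" shows "direct_summand K Y X"
proof -
  obtain f where f: "f \<in> Hom K X Y" "isomorphism K f" using assms unfolding isomorphic_def by blast
  obtain g where g: "g \<in> Hom K Y X" "g \<cdot> f = Idm K X" "f \<cdot> g = Idm K Y" using isomorphismE[OF f(2,1)] .
  obtain Z where Z: "zero_object K Z" using ex_zero_object by blast
  have "Z \<in> Obj K" "Idm K Z = Zer K Z Z" "X \<in> Obj K" "Y \<in> Obj K"
    using Z zero_object_unique(1)[OF Z, of "Idm K Z" Z] Idm_Hom HomD[OF f(1)] by (auto simp: zero_object_def)
  then have "biproduct K Y Z X g (Zer K Z X) f (Zer K X Z)"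
    unfolding biproduct_def using f g by (auto simp: hom_simps)
  then show ?thesis unfolding direct_summand_def is_biproduct_def by blast
qed

lemma subcategoryI:
  assumes "\<D> \<subseteq> Obj K" "\<And>Z. zero_object K Z \<Longrightarrow> Z \<in> \<D>"
    "\<And>X Y B. \<lbrakk>X \<in> \<D>; Y \<in> \<D>; is_biproduct K X Y B\<rbrakk> \<Longrightarrow> B \<in> \<D>"
    "\<And>X Y B. \<lbrakk>B \<in> \<D>; is_biproduct K X Y B\<rbrakk> \<Longrightarrow> X \<in> \<D>"
  shows "subcategory K \<D>"
proof -
  have "Y \<in> \<D>" if "X \<in> \<D>" "isomorphic K X Y" for X Y
    using direct_summand_iso[OF that(2)] assms(4)[OF that(1)] unfolding direct_summand_def by blast
  then show ?thesis
    unfolding subcategory_def direct_summand_def using assms ex_zero_object by blast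
qed

text \<open>Objects of \<omega> start with \<open>A \<rightarrow> A \<rightarrow> 0\<close>, so that
  later constructions need no separate case of length zero.\<close>

lemma check_unfold:
  assumes "subcategory K \<omega>" "A \<in> check K \<omega>"
  obtains W B where "W \<in> \<omega>" "B \<in> check K \<omega>" "is_etriangle K A W B"
proof -
  obtain Z where Z: "Z \<in> \<omega>" "zero_object K Z" using subcategoryD(2)[OF assms(1)] by blast
  from assms(2) show ?thesis
  proof (cases rule: check_cases)
    case 1
    then show ?thesis
      using that is_etriangle_zero(1)[OF Z(2)] check_base[OF subcategoryD(1)[OF assms(1)]] Z(1)
        subcategoryD(1)[OF assms(1)] by blast
  qed (use that in blast)
qed

text \<open>Pull \<open>B \<rightarrow> C\<close> back along \<open>WC \<rightarrow> C\<close>. The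
  resulting extension of \<open>WC\<close> by \<open>A\<close> splits, so the pullback is covered by
  \<open>WA \<oplus> WC\<close>, and ET4op composes this cover with the deflation onto
  \<open>B\<close>.\<close>

lemma horseshoe_res:
  assumes "is_etriangle K A B C" "is_etriangle K KA WA A" "is_etriangle K KC WC C" "triv WC A"
    "is_biproduct K WA WC W"
  obtains F where "is_etriangle K KA F KC" "is_etriangle K F W B"
proof -
  obtain M where M: "is_etriangle K A M WC" "is_etriangle K KC M B"
    using is_etriangle_pullback[OF assms(1,3)] .
  obtain Z where Z: "zero_object K Z" using ex_zero_object by blast
  have "is_etriangle K KA W M"
    by (rule is_etriangle_sum[OF assms(2) is_etriangle_zero(2)[OF Z]])
      (use assms Z is_biproduct_zero triv_split[OF M(1)] is_etriangle_Obj in auto)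
  then show ?thesis using is_etriangle_ET4op[OF _ M(2)] that by blast
qed

lemma horseshoe_check:
  assumes "is_etriangle K A B C" "is_etriangle K A WA A'" "is_etriangle K C WC C'" "triv C WA"
    "is_biproduct K WA WC W"
  obtains F where "is_etriangle K A' F C'" "is_etriangle K B W F"
proof -
  obtain M where M: "is_etriangle K B M A'" "is_etriangle K WA M C"
    using is_etriangle_pushout[OF assms(1,2)] .
  obtain Z where Z: "zero_object K Z" using ex_zero_object by blast
  have "is_etriangle K M W C'"
    by (rule is_etriangle_sum[OF is_etriangle_zero(1)[OF Z] assms(3)])
      (use assms Z is_biproduct_zero triv_split[OF M(2)] is_etriangle_Obj in auto)
  then show ?thesis using is_etriangle_ET4[OF M(1)] that by blast
qed

text \<open>Two classes occur because the lemma is also applied with \<omega> the class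
  \<open>res_class K \<T>\<close>, which need not be self-orthogonal, and \<omega>' the class \<T>.
  The horseshoe treats both coresolutions in parallel; where one has ended, a split extension
  absorbs the rest.\<close>

lemma check_extension:
  assumes sub: "\<omega> \<subseteq> Obj K" "\<omega>' \<subseteq> \<omega>"
    and bip: "\<And>X Y B. \<lbrakk>X \<in> \<omega>; Y \<in> \<omega>; is_biproduct K X Y B\<rbrakk> \<Longrightarrow> B \<in> \<omega>"
    and orth: "\<And>V W. \<lbrakk>V \<in> check K \<omega>'; W \<in> \<omega>\<rbrakk> \<Longrightarrow> triv V W"
    and "A \<in> check K \<omega>" "C \<in> check K \<omega>'" "is_etriangle K A B C"
  shows "B \<in> check K \<omega>"
  using assms(5-)
proof (induction arbitrary: B C rule: check_induct)
  case (base A)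
  have s: "is_biproduct K A C B" using triv_split[OF base(3)] orth base by blast
  from base(2) show ?case
  proof (cases rule: check_cases)
    case 1
    then show ?thesis using bip[OF _ _ s] sub base(1) check_base by blast
  next
    case (2 W C')
    obtain W' where W': "is_biproduct K A W W'"
      using ex_biproduct[of A W] 2(2) base(1) sub by blast
    obtain Z where Z: "zero_object K Z" using ex_zero_object by blast
    have "is_etriangle K B W' C'"
      by (rule is_etriangle_sum[OF is_etriangle_zero(1)[OF Z] 2(1) s W'])
        (use is_biproduct_zero(2)[OF Z] is_etriangle_Obj(3)[OF 2(1)] is_biproduct_Obj(1)[OF s] in auto)
    moreover have "C' \<in> check K \<omega>" using 2(3) check_mono[OF sub(2,1)] by blast
    ultimately show ?thesis using check_step bip[OF _ _ W'] sub base(1) 2(2) by blast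
  qed
next
  case (step A W A')
  have orthC: "triv C W" using orth step.prems(1) step.hyps(2) by blast
  from step.prems(1) show ?case
  proof (cases rule: check_cases)
    case 1
    obtain M where M: "is_etriangle K B M A'" "is_etriangle K W M C"
      using is_etriangle_pushout[OF step.prems(2) step.hyps(1)] .
    then have "M \<in> \<omega>" using bip[OF _ _ triv_split[OF M(2) orthC]] step.hyps(2) 1 sub by blast
    then show ?thesis using check_step[OF M(1)] step.hyps(3) by blast
  next
    case (2 V C')
    obtain W' where W': "is_biproduct K W V W'"
      using ex_biproduct[of W V] 2(2) step.hyps(2) sub by blast
    obtain F where F: "is_etriangle K A' F C'" "is_etriangle K B W' F"
      using horseshoe_check[OF step.prems(2) step.hyps(1) 2(1) orthC W'] .
    have "F \<in> check K \<omega>" using step.IH[OF 2(3) F(1)] .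
    then show ?thesis using check_step[OF F(2)] bip[OF _ _ W'] step.hyps(2) 2(2) sub by blast
  qed
qed

end

context enough_extriangulated_category
begin

section \<open>Right orthogonal classes and infinite resolutions\<close>

lemma right_perpD:
  assumes "Y \<in> right_perp K \<omega>" "\<omega> \<subseteq> Obj K"
  shows "Y \<in> Obj K" "X \<in> \<omega> \<Longrightarrow> vanish n X Y"
  using assms right_perp_iff by auto

lemma right_perp_mid:
  "\<lbrakk>\<omega> \<subseteq> Obj K; is_etriangle K A B C; A \<in> right_perp K \<omega>; C \<in> right_perp K \<omega>\<rbrakk> \<Longrightarrow> B \<in> right_perp K \<omega>"
  using vanish_right_mid is_etriangle_Obj unfolding right_perp_iff by blast

lemma right_perp_cone:
  "\<lbrakk>\<omega> \<subseteq> Obj K; is_etriangle K A B C; A \<in> right_perp K \<omega>; B \<in> right_perp K \<omega>\<rbrakk> \<Longrightarrow> C \<in> right_perp K \<omega>"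
  using vanish_right_cone is_etriangle_Obj unfolding right_perp_iff by blast

lemma right_perp_summand:
  "\<lbrakk>\<omega> \<subseteq> Obj K; is_biproduct K A C B; B \<in> right_perp K \<omega>\<rbrakk> \<Longrightarrow> A \<in> right_perp K \<omega>"
  using vanish_summand(1) is_biproduct_Obj unfolding right_perp_iff by blast

text \<open>\<open>res_class\<close> is the greatest class closed under the step in the premise:
  choose a step for every object and iterate. Membership is thus proved by finding an invariant
  \<open>P\<close> that passes to cocones.\<close>

lemma res_coinduct:
  assumes "P A" "\<And>A. P A \<Longrightarrow> A \<in> right_perp K \<omega> \<and> (\<exists>W B. W \<in> \<omega> \<and> P B \<and> is_etriangle K B W A)"
  shows "A \<in> res_class K \<omega>"
proof -
  obtain w k where wk: "\<And>A. P A \<Longrightarrow> w A \<in> \<omega> \<and> P (k A) \<and> is_etriangle K (k A) (w A) A"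
    using assms(2) by metis
  have P: "P ((k ^^ i) A)" for i by (induction i) (use assms(1) wk in auto)
  then have "\<forall>i. w ((k ^^ i) A) \<in> \<omega> \<and> (k ^^ i) A \<in> right_perp K \<omega> \<and>
      is_etriangle K ((k ^^ Suc i) A) (w ((k ^^ i) A)) ((k ^^ i) A)"
    using assms(2) wk by auto
  moreover have "A \<in> Obj K" using assms by (auto simp: right_perp_def)
  ultimately show ?thesis
    unfolding res_class_def
    by (intro CollectI conjI exI[of _ "\<lambda>i. w ((k ^^ i) A)"] exI[of _ "\<lambda>i. (k ^^ i) A"]) auto
qed

lemma res_unfold:
  assumes "A \<in> res_class K \<omega>"
  obtains W B where "W \<in> \<omega>" "B \<in> res_class K \<omega>" "is_etriangle K B W A"
proof -
  obtain W M where m: "M (0::nat) = A" "\<And>i. W i \<in> \<omega> \<and> M i \<in> right_perp K \<omega> \<and> is_etriangle K (M (Suc i)) (W i) (M i)"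
    using assms by (auto simp: res_class_def)
  have "M (Suc 0) \<in> res_class K \<omega>"
    unfolding res_class_def using m is_etriangle_Obj[of "M (Suc 0)"]
    by (intro CollectI conjI exI[of _ "\<lambda>i. W (Suc i)"] exI[of _ "\<lambda>i. M (Suc i)"]) auto
  then show ?thesis using that[of "W 0" "M (Suc 0)"] m by metis
qed

lemma res_right_perp: "A \<in> res_class K \<omega> \<Longrightarrow> A \<in> right_perp K \<omega>"
  by (auto simp: res_class_def)

lemma res_Obj: "res_class K \<omega> \<subseteq> Obj K"
  by (auto simp: res_class_def)

lemma res_step:
  assumes "A \<in> right_perp K \<omega>" "W \<in> \<omega>" "B \<in> res_class K \<omega>" "is_etriangle K B W A"
  shows "A \<in> res_class K \<omega>"
proof (rule res_coinduct[of "\<lambda>X. X = A \<or> X \<in> res_class K \<omega>"])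
  fix X assume "X = A \<or> X \<in> res_class K \<omega>"
  then show "X \<in> right_perp K \<omega> \<and> (\<exists>W B. W \<in> \<omega> \<and> (B = A \<or> B \<in> res_class K \<omega>) \<and> is_etriangle K B W X)"
    using assms res_unfold res_right_perp by metis
qed simp

end

locale self_orthogonal_subcategory = enough_extriangulated_category K
  for K :: "('o, 'm, 'e, 'z) ext_struct_scheme" (structure) +
  fixes \<omega> :: "'o set"
  assumes sub: "subcategory K \<omega>" and so: "self_orthogonal K \<omega>"
begin

lemma \<omega>_Obj: "\<omega> \<subseteq> Obj K" using subcategoryD(1)[OF sub] .

lemma res_vanish: "\<lbrakk>W \<in> \<omega>; A \<in> res_class K \<omega>\<rbrakk> \<Longrightarrow> vanish n W A"
  using right_perpD(2)[OF res_right_perp \<omega>_Obj] .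

lemma res_triv: "\<lbrakk>W \<in> \<omega>; A \<in> res_class K \<omega>\<rbrakk> \<Longrightarrow> triv W A"
  using res_vanish[of W A 0] vanish_0 by simp

lemma \<omega>_res: "\<omega> \<subseteq> res_class K \<omega>"
proof
  fix A assume "A \<in> \<omega>"
  then show "A \<in> res_class K \<omega>"
  proof (rule res_coinduct[of "\<lambda>X. X \<in> \<omega>"])
    fix X assume X: "X \<in> \<omega>"
    then show "X \<in> right_perp K \<omega> \<and> (\<exists>W B. W \<in> \<omega> \<and> B \<in> \<omega> \<and> is_etriangle K B W X)"
      using so subcategoryD(2)[OF sub] is_etriangle_zero(2) \<omega>_Obj unfolding self_orthogonal_def by blast
  qed
qed

text \<open>Being an extension of two members is the invariant; the horseshoe reproduces it for the
  cocone, as \<E>(WC, A) vanishes.\<close>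

lemma res_extension:
  assumes "A \<in> res_class K \<omega>" "C \<in> res_class K \<omega>" "is_etriangle K A B C"
  shows "B \<in> res_class K \<omega>"
proof (rule res_coinduct[of "\<lambda>B. \<exists>A \<in> res_class K \<omega>. \<exists>C \<in> res_class K \<omega>. is_etriangle K A B C"])
  show "\<exists>A \<in> res_class K \<omega>. \<exists>C \<in> res_class K \<omega>. is_etriangle K A B C" using assms by blast
  fix B assume "\<exists>A \<in> res_class K \<omega>. \<exists>C \<in> res_class K \<omega>. is_etriangle K A B C"
  then obtain A C where t: "A \<in> res_class K \<omega>" "C \<in> res_class K \<omega>" "is_etriangle K A B C" by blast
  obtain WA KA where a: "WA \<in> \<omega>" "KA \<in> res_class K \<omega>" "is_etriangle K KA WA A" using res_unfold[OF t(1)] .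
  obtain WC KC where c: "WC \<in> \<omega>" "KC \<in> res_class K \<omega>" "is_etriangle K KC WC C" using res_unfold[OF t(2)] .
  obtain W where W: "is_biproduct K WA WC W" using ex_biproduct[of WA WC] a c \<omega>_Obj by blast
  obtain F where "is_etriangle K KA F KC" "is_etriangle K F W B"
    using horseshoe_res[OF t(3) a(3) c(3) res_triv[OF c(1) t(1)] W] .
  then show "B \<in> right_perp K \<omega> \<and> (\<exists>W F. W \<in> \<omega> \<and>
      (\<exists>A \<in> res_class K \<omega>. \<exists>C \<in> res_class K \<omega>. is_etriangle K A F C) \<and> is_etriangle K F W B)"
    using right_perp_mid[OF \<omega>_Obj t(3)] t res_right_perp subcategoryD(3)[OF sub a(1) c(1) W] a c by blast
qed

text \<open>Compose a cover of \<open>B\<close> with the deflation onto \<open>C\<close>: the cocone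
  is an extension of \<open>A\<close> by \<open>B'\<close>, hence in the class, and a single step
  suffices.\<close>

lemma res_cone:
  assumes "A \<in> res_class K \<omega>" "B \<in> res_class K \<omega>" "is_etriangle K A B C"
  shows "C \<in> res_class K \<omega>"
proof -
  obtain W B' where b: "W \<in> \<omega>" "B' \<in> res_class K \<omega>" "is_etriangle K B' W B" using res_unfold[OF assms(2)] .
  obtain E where E: "is_etriangle K E W C" "is_etriangle K B' E A"
    using is_etriangle_ET4op[OF b(3) assms(3)] .
  show ?thesis
    using res_step[OF right_perp_cone[OF \<omega>_Obj assms(3)] b(1) _ E(1)] res_extension[OF b(2) assms(1) E(2)]
      assms res_right_perp by blast
qed

lemma res_biproduct:
  assumes "A \<in> res_class K \<omega>" "C \<in> res_class K \<omega>" "is_biproduct K A C B"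
  shows "B \<in> res_class K \<omega>"
  using res_extension assms is_etriangle_biproduct by blast

text \<open>If \<open>B = A \<oplus> A'\<close> and \<open>W \<rightarrow> B\<close> has cocone \<open>L\<close>, then the cocones of \<open>W \<rightarrow> A\<close> and \<open>W \<rightarrow> A'\<close>
  sum up to an extension of \<open>B\<close> by \<open>L \<oplus> L\<close>; so being a summand of an object of the class is inherited by cocones.\<close>

lemma res_summand:
  assumes "B \<in> res_class K \<omega>" "is_biproduct K A A' B"
  shows "A \<in> res_class K \<omega>"
proof (rule res_coinduct[of "\<lambda>A. \<exists>A' B. is_biproduct K A A' B \<and> B \<in> res_class K \<omega>"])
  show "\<exists>A' B. is_biproduct K A A' B \<and> B \<in> res_class K \<omega>" using assms by blast
  fix A assume "\<exists>A' B. is_biproduct K A A' B \<and> B \<in> res_class K \<omega>"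
  then obtain A' B where B: "is_biproduct K A A' B" "B \<in> res_class K \<omega>" by blast
  obtain W L where b: "W \<in> \<omega>" "L \<in> res_class K \<omega>" "is_etriangle K L W B" using res_unfold[OF B(2)] .
  obtain M where M: "is_etriangle K M W A" "is_etriangle K L M A'"
    using is_etriangle_ET4op[OF b(3) is_etriangle_biproduct(2)[OF B(1)]] .
  obtain M' where M': "is_etriangle K M' W A'" "is_etriangle K L M' A"
    using is_etriangle_ET4op[OF b(3) is_etriangle_biproduct(1)[OF B(1)]] .
  obtain N where N: "is_biproduct K M M' N"
    using ex_biproduct[OF is_etriangle_Obj(1)[OF M(1)] is_etriangle_Obj(1)[OF M'(1)]] by blast
  obtain LL where LL: "is_biproduct K L L LL"
    using ex_biproduct[of L L] is_etriangle_Obj(1)[OF M(2)] by blast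
  have "is_etriangle K LL N B"
    using is_etriangle_sum[OF M(2) M'(2) LL N is_biproduct_swap[OF B(1)]] .
  then have "N \<in> res_class K \<omega>" using res_extension[OF res_biproduct[OF b(2,2) LL] B(2)] by simp
  with N have "\<exists>A' B. is_biproduct K M A' B \<and> B \<in> res_class K \<omega>" by blast
  with M(1) b(1) right_perp_summand[OF \<omega>_Obj B(1) res_right_perp[OF B(2)]] show "A \<in> right_perp K \<omega> \<and> (\<exists>W F. W \<in> \<omega> \<and>
      (\<exists>A' B. is_biproduct K F A' B \<and> B \<in> res_class K \<omega>) \<and> is_etriangle K F W A)"
    by iprover
qed

lemma res_subcategory: "subcategory K (res_class K \<omega>)"
proof (rule subcategoryI)
  show "Z \<in> res_class K \<omega>" if "zero_object K Z" for Z
    using subcategory_zero[OF sub that] \<omega>_res by blast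
qed (fact res_Obj res_biproduct res_summand)+

text \<open>Recovers \<omega> from its class, which makes the correspondence injective. A member
  that is left orthogonal to the class splits off its own cover.\<close>

lemma left_perp_res: "left_perp K (res_class K \<omega>) \<inter> res_class K \<omega> = \<omega>"
proof
  show "\<omega> \<subseteq> left_perp K (res_class K \<omega>) \<inter> res_class K \<omega>"
  proof
    fix A assume A: "A \<in> \<omega>"
    then have "A \<in> left_perp K (res_class K \<omega>)"
      using res_vanish[OF A] \<omega>_Obj by (auto simp: left_perp_iff[OF res_Obj])
    then show "A \<in> left_perp K (res_class K \<omega>) \<inter> res_class K \<omega>" using \<omega>_res A by auto
  qed
  show "left_perp K (res_class K \<omega>) \<inter> res_class K \<omega> \<subseteq> \<omega>"
  proof
    fix A assume A: "A \<in> left_perp K (res_class K \<omega>) \<inter> res_class K \<omega>"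
    then obtain W B where b: "W \<in> \<omega>" "B \<in> res_class K \<omega>" "is_etriangle K B W A" using res_unfold by blast
    have "triv A B" using A b(2) by (auto simp: left_perp_iff[OF res_Obj] simp flip: vanish_0)
    then show "A \<in> \<omega>" using triv_split[OF b(3)] subcategoryD(5)[OF sub b(1)] by blast
  qed
qed

lemma check_vanish:
  assumes "V \<in> check K \<omega>" "Y \<in> right_perp K \<omega>" shows "vanish n V Y"
  using assms(1)
proof (induction arbitrary: n rule: check_induct)
  case (base A)
  then show ?case using right_perpD(2)[OF assms(2) \<omega>_Obj] by blast
next
  case (step A W B)
  then show ?case using vanish_left_cocone[OF step(1)] right_perpD[OF assms(2) \<omega>_Obj] by blast
qed

lemma check_triv: "\<lbrakk>V \<in> check K \<omega>; Y \<in> right_perp K \<omega>\<rbrakk> \<Longrightarrow> triv V Y"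
  using check_vanish[of V Y 0] vanish_0 by simp

lemma check_ext_closed:
  assumes "A \<in> check K \<omega>" "C \<in> check K \<omega>" "is_etriangle K A B C" shows "B \<in> check K \<omega>"
  by (rule check_extension[OF \<omega>_Obj subset_refl subcategoryD(3)[OF sub] _ assms])
    (use check_triv so in \<open>auto simp: self_orthogonal_def\<close>)

lemma hat_res:
  assumes "A \<in> hat K \<omega>" shows "A \<in> res_class K \<omega>"
  using assms
proof (induction rule: hat_induct)
  case (base A) then show ?case using \<omega>_res by blast
next
  case (step A W B) then show ?case using res_cone \<omega>_res by blast
qed

end

section \<open>From tilting subcategories to coresolving subcategories\<close>

text \<open>Only a bound uniform over \<T> and \<open>res_class K \<C>\<close> is assumed. For the
  \<T> built from a coresolving \<D>, such a bound is available before \<T> is known to be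
  finite.\<close>

locale bounded_tilting_pair = enough_extriangulated_category K
  for K :: "('o, 'm, 'e, 'z) ext_struct_scheme" (structure) +
  fixes \<C> \<T> :: "'o set" and N :: nat
  assumes tp: "tilting_pair K \<C> \<T>"
    and bound: "\<lbrakk>T \<in> \<T>; Y \<in> res_class K \<C>; N \<le> n\<rbrakk> \<Longrightarrow> vanish n T Y"

sublocale bounded_tilting_pair \<subseteq> C: self_orthogonal_subcategory K \<C>
  using tp by unfold_locales (auto simp: tilting_pair_def)

sublocale bounded_tilting_pair \<subseteq> T: self_orthogonal_subcategory K \<T>
  using tp by unfold_locales (auto simp: tilting_pair_def)

context bounded_tilting_pair
begin

abbreviation "\<X> \<equiv> res_class K \<C>"

lemma \<C>_check: "\<C> \<subseteq> check K \<T>" and \<T>_hat: "\<T> \<subseteq> hat K \<C>"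
  using tp by (auto simp: tilting_pair_def)

lemma right_perp_\<C>:
  assumes "Y \<in> right_perp K \<T>" shows "Y \<in> right_perp K \<C>"
  using T.check_vanish[OF _ assms] \<C>_check right_perpD(1)[OF assms T.\<omega>_Obj]
  by (auto simp: right_perp_iff[OF C.\<omega>_Obj])

lemma \<T>_\<X>: "\<T> \<subseteq> \<X>"
  using C.hat_res \<T>_hat by blast

lemma \<T>_check: "\<T> \<subseteq> check K \<T>"
  using check_base T.\<omega>_Obj by blast

lemma \<T>_perp: "\<T> \<subseteq> right_perp K \<T>"
  using T.so by (simp add: self_orthogonal_def)

text \<open>The new object \<open>A'\<close> is the cone of an inflation from \<open>A1'\<close>
  into some \<open>T1\<close> in \<T>. As \<T> has no extensions with \<open>T1\<close>, degree
  \<open>n\<close> of \<open>A'\<close> is controlled by degree \<open>Suc n\<close> of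
  \<open>A1'\<close>, so the bound drops by one. The pushouts serve to map \<open>A\<close> into
  this cone.\<close>

lemma \<X>_coresolution_step:
  assumes "j \<le> N" "A \<in> \<X>"
  obtains A' V where "is_etriangle K A A' V" "A' \<in> \<X>" "V \<in> check K \<T>"
    "\<And>T n. \<lbrakk>T \<in> \<T>; N - j \<le> n\<rbrakk> \<Longrightarrow> vanish n T A'"
proof -
  have "\<exists>A' V. is_etriangle K A A' V \<and> A' \<in> \<X> \<and> V \<in> check K \<T> \<and> (\<forall>T \<in> \<T>. \<forall>n \<ge> N - j. vanish n T A')"
    using assms
  proof (induction j arbitrary: A)
    case 0
    obtain Z where Z: "Z \<in> \<T>" "zero_object K Z" using subcategoryD(2)[OF T.sub] by blast
    have "is_etriangle K A A Z" using is_etriangle_zero(1)[OF Z(2)] 0 res_Obj by blast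
    then show ?case using Z \<T>_check 0 bound by (intro exI[of _ A] exI[of _ Z]) auto
  next
    case (Suc j)
    obtain C0 A1 where A1: "C0 \<in> \<C>" "A1 \<in> \<X>" "is_etriangle K A1 C0 A" using res_unfold[OF Suc.prems(2)] .
    obtain A1' V1 where V1: "is_etriangle K A1 A1' V1" "A1' \<in> \<X>" "V1 \<in> check K \<T>"
        "\<forall>T \<in> \<T>. \<forall>n \<ge> N - j. vanish n T A1'"
      using Suc.IH[OF _ A1(2)] Suc.prems(1) by auto
    obtain T0 V0 where V0: "T0 \<in> \<T>" "V0 \<in> check K \<T>" "is_etriangle K C0 T0 V0"
      using check_unfold[OF T.sub] A1(1) \<C>_check by blast
    obtain B where B: "is_etriangle K C0 B V1" "is_etriangle K A1' B A"
      using is_etriangle_pushout[OF A1(3) V1(1)] .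
    obtain E where E: "is_etriangle K B E V0" "is_etriangle K T0 E V1"
      using is_etriangle_pushout[OF B(1) V0(3)] .
    have "E \<in> check K \<T>" using T.check_ext_closed[OF _ V1(3) E(2)] V0(1) \<T>_check by blast
    then obtain T1 V2 where V2: "T1 \<in> \<T>" "V2 \<in> check K \<T>" "is_etriangle K E T1 V2"
      using check_unfold[OF T.sub] by blast
    \<comment> \<open>The inflations
      \<open>A1' \<rightarrow> B \<rightarrow> E \<rightarrow> T1\<close> are composed one at a
      time. The cones give \<open>A \<rightarrow> F \<rightarrow> A'\<close>, whose composite has a
      cone \<open>G\<close> built from \<open>V0\<close> and \<open>V2\<close>.\<close>
    obtain F where F: "is_etriangle K A1' E F" "is_etriangle K A F V0"
      using is_etriangle_ET4[OF B(2) E(1)] .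
    obtain A' where A': "is_etriangle K A1' T1 A'" "is_etriangle K F A' V2"
      using is_etriangle_ET4[OF F(1) V2(3)] .
    obtain G where G: "is_etriangle K A A' G" "is_etriangle K V0 G V2"
      using is_etriangle_ET4[OF F(2) A'(2)] .
    have "A' \<in> \<X>" using C.res_cone[OF V1(2) _ A'(1)] V2(1) \<T>_\<X> by blast
    moreover have "G \<in> check K \<T>" using T.check_ext_closed[OF V0(2) V2(2) G(2)] .
    moreover have "vanish n T A'" if "T \<in> \<T>" "N - Suc j \<le> n" for T n
    proof (rule vanish_right_cone[OF A'(1)])
      show "T \<in> Obj K" "vanish n T T1"
        using that(1) V2(1) T.\<omega>_Obj right_perpD(2)[of T1 \<T> T n] \<T>_perp by blast+
      show "vanish (Suc n) T A1'" using V1(4) that by auto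
    qed
    ultimately show ?case using G(1) by blast
  qed
  then show ?thesis using that by blast
qed

lemma \<X>_coresolution:
  assumes "A \<in> \<X>"
  obtains A' V where "is_etriangle K A A' V" "A' \<in> \<X> \<inter> right_perp K \<T>" "V \<in> check K \<T>"
proof -
  obtain A' V where a: "is_etriangle K A A' V" "A' \<in> \<X>" "V \<in> check K \<T>"
      "\<And>T n. \<lbrakk>T \<in> \<T>; N - N \<le> n\<rbrakk> \<Longrightarrow> vanish n T A'"
    using \<X>_coresolution_step[OF le_refl assms] by blast
  then have "A' \<in> right_perp K \<T>" using res_Obj by (auto simp: right_perp_iff[OF T.\<omega>_Obj])
  then show ?thesis using that a by blast
qed

text \<open>A \<C>-cover of an object of \<open>res_class K \<T>\<close> may have a cocone outside
  that class. The invariant \<open>?P\<close> therefore admits an extra part from \<X> at the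
  bottom.\<close>

lemma res_\<T>_subset: "res_class K \<T> \<subseteq> \<X>"
proof
  fix A assume A: "A \<in> res_class K \<T>"
  obtain Z where Z: "Z \<in> \<X>" "zero_object K Z" using subcategoryD(2)[OF C.res_subcategory] by blast
  let ?P = "\<lambda>A. \<exists>A' A''. A' \<in> \<X> \<and> A'' \<in> res_class K \<T> \<and> is_etriangle K A' A A''"
  show "A \<in> \<X>"
  proof (rule res_coinduct[of ?P])
    show "?P A" using A Z is_etriangle_zero(2)[OF Z(2)] res_Obj by blast
    fix A assume "?P A"
    then obtain A' A'' where a: "A' \<in> \<X>" "A'' \<in> res_class K \<T>" "is_etriangle K A' A A''" by blast
    obtain W' K' where W': "W' \<in> \<C>" "K' \<in> \<X>" "is_etriangle K K' W' A'" using res_unfold[OF a(1)] .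
    obtain T0 K1 where T0: "T0 \<in> \<T>" "K1 \<in> res_class K \<T>" "is_etriangle K K1 T0 A''" using res_unfold[OF a(2)] .
    obtain C0 K0 where C0: "C0 \<in> \<C>" "K0 \<in> \<X>" "is_etriangle K K0 C0 T0" using res_unfold T0(1) \<T>_\<X> by blast
    obtain L where L: "is_etriangle K L C0 A''" "is_etriangle K K0 L K1"
      using is_etriangle_ET4op[OF C0(3) T0(3)] .
    obtain W where W: "is_biproduct K W' C0 W" using ex_biproduct[of W' C0] W'(1) C0(1) C.\<omega>_Obj by blast
    obtain F where F: "is_etriangle K K' F L" "is_etriangle K F W A"
      using horseshoe_res[OF a(3) W'(3) L(1) C.res_triv[OF C0(1) a(1)] W] .
    \<comment> \<open>\<open>F\<close> is built from \<open>K'\<close>, \<open>K0\<close> and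
      \<open>K1\<close>; regrouping puts the two pieces from \<X> together and restores
      \<open>?P\<close>.\<close>
    obtain E where E: "is_etriangle K E F K1" "is_etriangle K K' E K0"
      using is_etriangle_ET4op[OF F(1) L(2)] .
    have "?P F" using C.res_extension[OF W'(2) C0(2) E(2)] T0(2) E(1) by blast
    moreover have "W \<in> \<C>" using subcategoryD(3)[OF C.sub W'(1) C0(1) W] .
    moreover have "A \<in> right_perp K \<C>"
      using right_perp_mid[OF C.\<omega>_Obj a(3)] res_right_perp[OF a(1)] right_perp_\<C>[OF res_right_perp[OF a(2)]] .
    ultimately show "A \<in> right_perp K \<C> \<and> (\<exists>W F. W \<in> \<C> \<and> ?P F \<and> is_etriangle K F W A)" using F(2) by blast
  qed
qed

text \<open>Embedding \<open>E\<close> further into some \<open>T0\<close> keeps the cone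
  \<open>G\<close> of \<open>B \<rightarrow> T0\<close> in \<open>check K \<T>\<close>. Such objects
  have no extensions by \<open>B\<close>, so \<open>B\<close> splits off \<open>T0\<close>.\<close>

lemma summand_of_check:
  assumes "B \<in> right_perp K \<T>" "V \<in> check K \<T>" "E \<in> check K \<T>" "is_etriangle K B E V"
  shows "B \<in> \<T>"
proof -
  obtain T0 V0 where V0: "T0 \<in> \<T>" "V0 \<in> check K \<T>" "is_etriangle K E T0 V0"
    using check_unfold[OF T.sub assms(3)] .
  obtain G where G: "is_etriangle K B T0 G" "is_etriangle K V G V0"
    using is_etriangle_ET4[OF assms(4) V0(3)] .
  have "G \<in> check K \<T>" using T.check_ext_closed[OF assms(2) V0(2) G(2)] .
  then have "is_biproduct K B G T0" using triv_split[OF G(1)] T.check_triv assms(1) by blast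
  then show ?thesis using subcategoryD(4)[OF T.sub V0(1)] by blast
qed

text \<open>Enlarge the cocone of a \<C>-cover of \<open>A\<close> to an object \<open>K'\<close> of
  the class. The pushout \<open>B\<close> is an extension of \<open>A\<close> by \<open>K'\<close>,
  hence in the perpendicular class; coresolving \<open>C0\<close> embeds \<open>B\<close> so that
  \<open>summand_of_check\<close> applies.\<close>

lemma perp_unfold:
  assumes "A \<in> \<X> \<inter> right_perp K \<T>"
  obtains B K' where "B \<in> \<T>" "K' \<in> \<X> \<inter> right_perp K \<T>" "is_etriangle K K' B A"
proof -
  obtain C0 A1 where A1: "C0 \<in> \<C>" "A1 \<in> \<X>" "is_etriangle K A1 C0 A" using res_unfold assms by blast
  obtain K' V where V: "is_etriangle K A1 K' V" "K' \<in> \<X> \<inter> right_perp K \<T>" "V \<in> check K \<T>"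
    using \<X>_coresolution[OF A1(2)] .
  obtain B where B: "is_etriangle K C0 B V" "is_etriangle K K' B A" using is_etriangle_pushout[OF A1(3) V(1)] .
  obtain T0 V0 where V0: "T0 \<in> \<T>" "V0 \<in> check K \<T>" "is_etriangle K C0 T0 V0"
    using check_unfold[OF T.sub] A1(1) \<C>_check by blast
  obtain E where E: "is_etriangle K B E V0" "is_etriangle K T0 E V" using is_etriangle_pushout[OF B(1) V0(3)] .
  have "E \<in> check K \<T>" using T.check_ext_closed[OF _ V(3) E(2)] V0(1) \<T>_check by blast
  moreover have "B \<in> right_perp K \<T>" using right_perp_mid[OF T.\<omega>_Obj B(2)] V(2) assms by blast
  ultimately have "B \<in> \<T>" using summand_of_check V0(2) E(1) by blast
  then show ?thesis using that V(2) B(2) by blast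
qed

lemma res_\<T>_eq: "res_class K \<T> = right_perp K \<T> \<inter> \<X>"
proof
  show "res_class K \<T> \<subseteq> right_perp K \<T> \<inter> \<X>" using res_\<T>_subset res_right_perp by blast
  show "right_perp K \<T> \<inter> \<X> \<subseteq> res_class K \<T>"
  proof
    fix A assume A: "A \<in> right_perp K \<T> \<inter> \<X>"
    show "A \<in> res_class K \<T>"
    proof (rule res_coinduct[of "\<lambda>A. A \<in> \<X> \<inter> right_perp K \<T>"])
      fix A assume "A \<in> \<X> \<inter> right_perp K \<T>"
      then show "A \<in> right_perp K \<T> \<and> (\<exists>W B. W \<in> \<T> \<and> B \<in> \<X> \<inter> right_perp K \<T> \<and> is_etriangle K B W A)"
        using perp_unfold by blast
    qed (use A in blast)
  qed
qed

lemma res_\<T>_coresolution: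
  assumes "A \<in> \<X>"
  obtains A' V where "is_etriangle K A A' V" "A' \<in> res_class K \<T>" "V \<in> check K \<T>"
  using \<X>_coresolution[OF assms] res_\<T>_eq by blast

lemma res_\<T>_relative_coresolving: "relative_coresolving K \<X> (res_class K \<T>)"
proof -
  have "I \<in> res_class K \<T>" if I: "injective_in K \<X> I" for I
  proof -
    have IX: "I \<in> \<X>" using I by (simp add: injective_in_def)
    obtain A' V where V: "is_etriangle K I A' V" "A' \<in> res_class K \<T>" using res_\<T>_coresolution[OF IX] .
    have A': "A' \<in> \<X>" using V(2) res_\<T>_subset by blast
    then have "is_biproduct K I V A'"
      using injective_in_split[OF I _ A' C.res_cone[OF IX A' V(1)]] V(1) by (auto simp: is_etriangle_def)
    then show ?thesis using T.res_summand V(2) by blast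
  qed
  then show ?thesis
    unfolding relative_coresolving_def direct_summand_def
    using res_\<T>_subset T.res_extension T.res_cone T.res_summand by blast
qed

lemma res_\<T>_covariantly_finite: "strongly_covariantly_finite K \<X> (res_class K \<T>)"
proof -
  have "\<exists>g D y V \<delta>. etriangle K Y g D y V \<delta> \<and> left_approximation K (res_class K \<T>) Y g D" if Y: "Y \<in> \<X>" for Y
  proof -
    obtain D V where V: "is_etriangle K Y D V" "D \<in> res_class K \<T>" "V \<in> check K \<T>"
      using res_\<T>_coresolution[OF Y] .
    then obtain g y \<delta> where t: "etriangle K Y g D y V \<delta>" by (auto simp: is_etriangle_def)
    have "\<exists>h \<in> Hom K D D'. h \<cdot> g = f" if "D' \<in> res_class K \<T>" "f \<in> Hom K Y D'" for D' f
      using triv_extend[OF t T.check_triv[OF V(3) res_right_perp[OF that(1)]] that(2)] by blast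
    then have "left_approximation K (res_class K \<T>) Y g D"
      using V(2) etriangleD(2)[OF t] unfolding left_approximation_def by blast
    then show ?thesis using t by blast
  qed
  then show ?thesis unfolding strongly_covariantly_finite_def using res_\<T>_subset by blast
qed

text \<open>Replace the first term \<open>Y\<close> of a coresolution by its approximation
  \<open>D\<close>. The remainder becomes an extension of \<open>V\<close> in
  \<open>check K \<T>\<close> by the old remainder, which the two-class form of
  \<open>check_extension\<close> covers.\<close>

lemma check_res_\<T>: "check K (res_class K \<T>) = check K \<X>"
proof
  show "check K (res_class K \<T>) \<subseteq> check K \<X>" using check_mono[OF res_\<T>_subset res_Obj] .
  have T: "\<T> \<subseteq> res_class K \<T>" "check K \<T> \<subseteq> check K (res_class K \<T>)"
    using T.\<omega>_res check_mono[OF _ res_Obj] by blast+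
  show "check K \<X> \<subseteq> check K (res_class K \<T>)"
  proof
    fix A assume "A \<in> check K \<X>"
    then show "A \<in> check K (res_class K \<T>)"
    proof (induction rule: check_induct)
      case (base A)
      then obtain A' V where "is_etriangle K A A' V" "A' \<in> res_class K \<T>" "V \<in> check K \<T>"
        using res_\<T>_coresolution by blast
      then show ?case using check_step T(2) by blast
    next
      case (step A Y A1)
      obtain D V where V: "is_etriangle K Y D V" "D \<in> res_class K \<T>" "V \<in> check K \<T>"
        using res_\<T>_coresolution[OF step(2)] .
      obtain F where F: "is_etriangle K A D F" "is_etriangle K A1 F V"
        using is_etriangle_ET4[OF step(1) V(1)] .
      have "F \<in> check K (res_class K \<T>)"
        by (rule check_extension[OF res_Obj T(1) T.res_biproduct T.check_triv[OF _ res_right_perp] step(4) V(3) F(2)])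
      then show ?case using check_step[OF F(1) V(2)] by blast
    qed
  qed
qed

lemma res_\<T>_coresolving: "res_class K \<T> \<in> coresolving_subcategories K \<C>"
  unfolding coresolving_subcategories_def
  using T.res_subcategory res_\<T>_subset res_\<T>_relative_coresolving res_\<T>_covariantly_finite check_res_\<T> by blast

end

section \<open>Approximations with orthogonal cones\<close>

context preadditive_category
begin

text \<open>Easier to compose than \<open>direct_summand\<close>; under WIC both notions
  agree.\<close>

definition retract :: "'o \<Rightarrow> 'o \<Rightarrow> bool" where
  "retract X Y \<longleftrightarrow> (\<exists>s \<in> Hom K X Y. \<exists>r \<in> Hom K Y X. r \<cdot> s = Idm K X)"

lemma direct_summand_retract: "direct_summand K X Y \<Longrightarrow> retract X Y"
  unfolding direct_summand_def is_biproduct_def retract_def biproduct_def by blast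

lemma retract_trans:
  assumes "retract X Y" "retract Y Z" shows "retract X Z"
proof -
  obtain s r where 1: "s \<in> Hom K X Y" "r \<in> Hom K Y X" "r \<cdot> s = Idm K X" using assms(1) by (auto simp: retract_def)
  obtain t q where 2: "t \<in> Hom K Y Z" "q \<in> Hom K Z Y" "q \<cdot> t = Idm K Y" using assms(2) by (auto simp: retract_def)
  have "(r \<cdot> q) \<cdot> (t \<cdot> s) = r \<cdot> (q \<cdot> t) \<cdot> s" using 1(1,2) 2(1,2) by (simp add: hom_simps)
  also have "\<dots> = Idm K X" using 1 2(3) by (simp add: hom_simps)
  finally show ?thesis unfolding retract_def using 1 2 Cmp_Hom by metis
qed

lemma retract_biproduct:
  assumes "retract X Y" "retract X' Y'" "is_biproduct K X X' S" "is_biproduct K Y Y' B"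
  shows "retract S B"
proof -
  obtain s r where 1: "s \<in> Hom K X Y" "r \<in> Hom K Y X" "r \<cdot> s = Idm K X" using assms(1) by (auto simp: retract_def)
  obtain t q where 2: "t \<in> Hom K X' Y'" "q \<in> Hom K Y' X'" "q \<cdot> t = Idm K X'" using assms(2) by (auto simp: retract_def)
  obtain i1 i2 p1 p2 where b: "biproduct K X X' S i1 i2 p1 p2" using assms(3) by (auto simp: is_biproduct_def)
  obtain j1 j2 q1 q2 where c: "biproduct K Y Y' B j1 j2 q1 q2" using assms(4) by (auto simp: is_biproduct_def)
  note bD = biproductD[OF b] and cD = biproductD[OF c]
  have r: "\<And>f. f \<in> Arr K \<Longrightarrow> Cod K f = Y \<Longrightarrow> q1 \<cdot> j1 \<cdot> f = f"
      "\<And>f. f \<in> Arr K \<Longrightarrow> Cod K f = Y' \<Longrightarrow> q2 \<cdot> j2 \<cdot> f = f"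
      "\<And>f. f \<in> Arr K \<Longrightarrow> Cod K f = Y' \<Longrightarrow> q1 \<cdot> j2 \<cdot> f = Zer K (Dom K f) Y"
      "\<And>f. f \<in> Arr K \<Longrightarrow> Cod K f = Y \<Longrightarrow> q2 \<cdot> j1 \<cdot> f = Zer K (Dom K f) Y'"
      "\<And>f. f \<in> Arr K \<Longrightarrow> Cod K f = X \<Longrightarrow> r \<cdot> s \<cdot> f = f"
      "\<And>f. f \<in> Arr K \<Longrightarrow> Cod K f = X' \<Longrightarrow> q \<cdot> t \<cdot> f = f"
    using 1 2 cD bD by (simp_all add: hom_simps flip: Cmp_assoc_simp)
  let ?s = "j1 \<cdot> s \<cdot> p1 \<boxplus> j2 \<cdot> t \<cdot> p2" and ?r = "i1 \<cdot> r \<cdot> q1 \<boxplus> i2 \<cdot> q \<cdot> q2"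
  have "?s \<in> Hom K S B" "?r \<in> Hom K B S" "?r \<cdot> ?s = Idm K S"
    using 1(1,2) 2(1,2) bD cD r by (simp_all add: hom_simps)
  then show ?thesis unfolding retract_def by blast
qed

end

context additive_category
begin

section \<open>Finite sums of objects with local endomorphism rings\<close>

lemma finite_direct_sum_Obj: "finite_direct_sum K Xs B \<Longrightarrow> B \<in> Obj K \<and> set Xs \<subseteq> Obj K"
  by (induction rule: finite_direct_sum.induct) (auto simp: zero_object_def dest: is_biproduct_Obj)

lemma ex_finite_direct_sum: "set Xs \<subseteq> Obj K \<Longrightarrow> \<exists>B. finite_direct_sum K Xs B"
proof (induction Xs)
  case Nil then show ?case using ex_zero_object finite_direct_sum.Nil by metis
next
  case (Cons X Xs)
  then obtain B' where B': "finite_direct_sum K Xs B'" by auto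
  then obtain B where "is_biproduct K X B' B" using ex_biproduct[of X B'] Cons.prems finite_direct_sum_Obj by auto
  then show ?case using finite_direct_sum.Cons[OF B'] by blast
qed

lemma finite_direct_sum_append:
  assumes "finite_direct_sum K Xs B1" "finite_direct_sum K Ys B2"
  obtains B where "finite_direct_sum K (Xs @ Ys) B" "is_biproduct K B1 B2 B"
proof -
  have "\<exists>B. finite_direct_sum K (Xs @ Ys) B \<and> is_biproduct K B1 B2 B"
    using assms(1)
  proof (induction rule: finite_direct_sum.induct)
    case (Nil Z)
    then show ?case using assms(2) is_biproduct_zero(2)[OF Nil] finite_direct_sum_Obj by auto
  next
    case (Cons Xs B' X B1)
    then obtain B'' where B'': "finite_direct_sum K (Xs @ Ys) B''" "is_biproduct K B' B2 B''" by blast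
    have "X \<in> Obj K" "B'' \<in> Obj K" using is_biproduct_Obj[OF Cons(2)] is_biproduct_Obj[OF B''(2)] by auto
    then obtain B where B: "is_biproduct K X B'' B" using ex_biproduct by blast
    obtain i1 i2 p1 p2 where 1: "biproduct K X B'' B i1 i2 p1 p2" using B by (auto simp: is_biproduct_def)
    obtain j1 j2 q1 q2 where 2: "biproduct K B2 B' B'' j1 j2 q1 q2"
      using is_biproduct_swap[OF B''(2)] by (auto simp: is_biproduct_def)
    obtain k1 k2 l1 l2 where 3: "biproduct K X B' B1 k1 k2 l1 l2" using Cons(2) by (auto simp: is_biproduct_def)
    have "is_biproduct K B1 B2 B"
      using biproduct_swap[OF biproduct_assoc[OF 1 2 3]] unfolding is_biproduct_def by blast
    then show ?case using finite_direct_sum.Cons[OF B''(1) B] by auto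
  qed
  then show ?thesis using that by blast
qed

text \<open>The Schur complement of the \<open>(X, X)\<close>-entry of \<open>h\<close> reduces the claim to the remaining summands;
  since \<open>e\<close> has the same off-diagonal entries as \<open>h\<close> up to sign, no subtraction is needed.\<close>

lemma local_summand_or_right_inverse:
  assumes "finite_direct_sum K Xs B" "\<forall>X \<in> set Xs. local_ring (End_ring K X)"
    and "h \<in> Hom K B B" "e \<in> Hom K B B" "h \<boxplus> e = Idm K B"
  shows "(\<exists>k \<in> Hom K B B. h \<cdot> k = Idm K B) \<or>
    (\<exists>L C i1 i2 p1 p2 r Ys. biproduct K L C B i1 i2 p1 p2 \<and> r \<in> Hom K B L \<and> r \<cdot> e \<cdot> i1 = Idm K L \<and>
      finite_direct_sum K Ys C \<and> (\<forall>X \<in> set Ys. local_ring (End_ring K X)) \<and> length Ys < length Xs)"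
  using assms
proof (induction arbitrary: h e rule: finite_direct_sum.induct)
  case (Nil Z)
  then have "Z \<in> Obj K" by (simp add: zero_object_def)
  then have "h \<cdot> h = Idm K Z"
    using zero_object_unique(1)[OF Nil(1)] Cmp_Hom[OF Nil(3,3)] Idm_Hom by metis
  then show ?case using Nil(3) by blast
next
  case (Cons Xs B' X B)
  obtain i j \<pi> p where b: "biproduct K X B' B i j \<pi> p" using Cons(2) by (auto simp: is_biproduct_def)
  note bD = biproductD[OF b] and he = \<open>h \<boxplus> e = Idm K B\<close>
  note H = bD(1-4,10-12) \<open>h \<in> Hom K B B\<close> \<open>e \<in> Hom K B B\<close>
  let ?R = "End_ring K X" and ?u = "\<pi> \<cdot> h \<cdot> i" and ?a = "\<pi> \<cdot> e \<cdot> i"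
  have loc: "ring ?R" "\<And>a b. \<lbrakk>a \<in> carrier ?R - Units ?R; b \<in> carrier ?R - Units ?R\<rbrakk> \<Longrightarrow> a \<oplus>\<^bsub>?R\<^esub> b \<notin> Units ?R"
    using Cons.prems(1) by (auto simp: local_ring_def)
  have ua: "?u \<in> Hom K X X" "?a \<in> Hom K X X" using H by (simp_all add: hom_simps)
  have "?u \<boxplus> ?a = \<pi> \<cdot> (h \<boxplus> e) \<cdot> i" using H by (simp add: hom_simps)
  then have "?u \<boxplus> ?a = Idm K X" unfolding he using H bD(5) by (simp add: hom_simps)
  moreover have "\<one>\<^bsub>?R\<^esub> \<in> Units ?R" by (rule monoid.Units_one_closed) (use loc(1) in \<open>simp add: ring.is_monoid\<close>)
  ultimately have "?u \<in> Units ?R \<or> ?a \<in> Units ?R"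
    using loc(2)[of ?u ?a] ua by (auto simp: End_ring_def)
  then show ?case
  proof
    assume "?a \<in> Units ?R"
    \<comment> \<open>The complement \<open>e\<close> is already split mono on \<open>X\<close>, so
      \<open>L = X\<close>.\<close>
    then obtain a' where a': "a' \<in> Hom K X X" "a' \<cdot> ?a = Idm K X" by (auto simp: Units_def End_ring_def)
    have "a' \<cdot> \<pi> \<in> Hom K B X" "(a' \<cdot> \<pi>) \<cdot> e \<cdot> i = Idm K X" using a' H by (simp_all add: hom_simps)
    then show ?case using b Cons(1) Cons.prems(1) by (metis length_Cons lessI list.set_intros(2))
  next
    assume "?u \<in> Units ?R"
    then obtain v where v: "v \<in> Hom K X X" "?u \<cdot> v = Idm K X" by (auto simp: Units_def End_ring_def)
    \<comment> \<open>Column elimination: \<open>?w\<close> corrects \<open>j\<close> so that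
      \<open>h \<cdot> ?w\<close> has no component in \<open>X\<close>. The sign comes out right
      because \<open>\<pi> \<cdot> e \<cdot> j\<close> is the negative of
      \<open>\<pi> \<cdot> h \<cdot> j\<close>.\<close>
    let ?w = "j \<boxplus> i \<cdot> v \<cdot> \<pi> \<cdot> e \<cdot> j"
    have w: "?w \<in> Hom K B' B" using H v by (simp add: hom_simps)
    have r: "\<And>f. f \<in> Arr K \<Longrightarrow> Cod K f = X \<Longrightarrow> \<pi> \<cdot> i \<cdot> f = f"
      "\<And>f. f \<in> Arr K \<Longrightarrow> Cod K f = B' \<Longrightarrow> p \<cdot> j \<cdot> f = f"
      "\<And>f. f \<in> Arr K \<Longrightarrow> Cod K f = B' \<Longrightarrow> \<pi> \<cdot> j \<cdot> f = Zer K (Dom K f) X"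
      "\<And>f. f \<in> Arr K \<Longrightarrow> Cod K f = X \<Longrightarrow> p \<cdot> i \<cdot> f = Zer K (Dom K f) B'"
      "\<And>f. f \<in> Arr K \<Longrightarrow> Cod K f = X \<Longrightarrow> \<pi> \<cdot> h \<cdot> i \<cdot> v \<cdot> f = f"
      using v H bD(5-8) by (simp_all add: hom_simps flip: Cmp_assoc_simp)
    have pw: "p \<cdot> ?w = Idm K B'" using w H v r bD(6) by (simp add: hom_simps)
    have "\<pi> \<cdot> h \<cdot> ?w = \<pi> \<cdot> h \<cdot> j \<boxplus> \<pi> \<cdot> e \<cdot> j" using w H v r by (simp add: hom_simps)
    also have "\<dots> = \<pi> \<cdot> (h \<boxplus> e) \<cdot> j" using H by (simp add: hom_simps)
    also have "\<dots> = Zer K B' X" unfolding he using H bD(7) by (simp add: hom_simps)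
    finally have \<pi>hw: "\<pi> \<cdot> h \<cdot> ?w = Zer K B' X" .
    have "h \<cdot> ?w = (i \<cdot> \<pi> \<boxplus> j \<cdot> p) \<cdot> h \<cdot> ?w" unfolding bD(9) using Cmp_Hom[OF w \<open>h \<in> Hom K B B\<close>] by (simp add: hom_simps)
    also have "\<dots> = i \<cdot> (\<pi> \<cdot> h \<cdot> ?w) \<boxplus> j \<cdot> p \<cdot> h \<cdot> ?w" using H Cmp_Hom[OF w \<open>h \<in> Hom K B B\<close>]
      by (subst Cmp_Add_simps) (simp_all add: Hom_def Cmp_simps Cmp_assoc_simp)
    also have "\<dots> = j \<cdot> p \<cdot> h \<cdot> ?w" unfolding \<pi>hw using H Cmp_Hom[OF w \<open>h \<in> Hom K B B\<close>]
      by (simp add: Hom_def Cmp_simps Cmp_Zer_right Add_Zer)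
    finally have hw: "h \<cdot> ?w = j \<cdot> p \<cdot> h \<cdot> ?w" .
    \<comment> \<open>From here on \<open>w\<close> is opaque, so that simplification does not
      expand it.\<close>
    obtain w where w_def: "w = ?w" by simp
    note w = w[folded w_def] and pw = pw[folded w_def] and hw = hw[folded w_def]
    have 1: "p \<cdot> h \<cdot> w \<in> Hom K B' B'" "p \<cdot> e \<cdot> w \<in> Hom K B' B'" using H w by (simp_all add: hom_simps)
    have "p \<cdot> h \<cdot> w \<boxplus> p \<cdot> e \<cdot> w = p \<cdot> (h \<boxplus> e) \<cdot> w" using H w by (simp add: hom_simps)
    then have 2: "p \<cdot> h \<cdot> w \<boxplus> p \<cdot> e \<cdot> w = Idm K B'" unfolding he using H w pw by (simp add: hom_simps)
    have "\<forall>X \<in> set Xs. local_ring (End_ring K X)" using Cons.prems(1) by simp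
    from Cons.IH[OF this 1 2] show ?case
    proof (elim disjE bexE exE conjE)
      fix k assume k: "k \<in> Hom K B' B'" "(p \<cdot> h \<cdot> w) \<cdot> k = Idm K B'"
      \<comment> \<open>Back substitution: \<open>w \<cdot> k\<close> is a preimage of
        \<open>j\<close> under \<open>h\<close>, and with its help \<open>i \<cdot> v\<close> is
        corrected to a preimage of \<open>i\<close>.\<close>
      let ?k = "(i \<cdot> v \<boxplus> w \<cdot> k \<cdot> p \<cdot> e \<cdot> i \<cdot> v) \<cdot> \<pi> \<boxplus> w \<cdot> k \<cdot> p"
      have "h \<cdot> w \<cdot> k = (h \<cdot> w) \<cdot> k" using H w k by (simp add: hom_simps)
      also have "\<dots> = j \<cdot> ((p \<cdot> h \<cdot> w) \<cdot> k)" unfolding hw[THEN arg_cong[of _ _ "\<lambda>f. f \<cdot> k"]] using H w k(1) by (simp add: hom_simps)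
      also have "\<dots> = j" using k H by (simp add: hom_simps)
      finally have hwk: "h \<cdot> w \<cdot> k = j" .
      have hwk': "\<And>f. f \<in> Arr K \<Longrightarrow> Cod K f = B' \<Longrightarrow> h \<cdot> w \<cdot> k \<cdot> f = j \<cdot> f"
        using hwk H w k(1) by (simp add: hom_simps flip: Cmp_assoc_simp)
      have "p \<cdot> h \<cdot> i \<cdot> v \<boxplus> p \<cdot> e \<cdot> i \<cdot> v = p \<cdot> (h \<boxplus> e) \<cdot> i \<cdot> v" using H v by (simp add: hom_simps)
      also have "\<dots> = Zer K X B'" unfolding he using H v r by (simp add: hom_simps)
      finally have 3: "p \<cdot> h \<cdot> i \<cdot> v \<boxplus> p \<cdot> e \<cdot> i \<cdot> v = Zer K X B'" .
      have "h \<cdot> i \<cdot> v = (i \<cdot> \<pi> \<boxplus> j \<cdot> p) \<cdot> h \<cdot> i \<cdot> v" unfolding bD(9) using H v by (simp add: hom_simps)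
      also have "\<dots> = i \<boxplus> j \<cdot> p \<cdot> h \<cdot> i \<cdot> v" using H v r r(5)[of "Idm K X"] by (simp add: hom_simps)
      finally have 4: "h \<cdot> i \<cdot> v = i \<boxplus> j \<cdot> p \<cdot> h \<cdot> i \<cdot> v" .
      have "h \<cdot> i \<cdot> v \<boxplus> j \<cdot> p \<cdot> e \<cdot> i \<cdot> v = (i \<boxplus> j \<cdot> p \<cdot> h \<cdot> i \<cdot> v) \<boxplus> j \<cdot> p \<cdot> e \<cdot> i \<cdot> v" using 4 by simp
      also have "\<dots> = i \<boxplus> j \<cdot> (p \<cdot> h \<cdot> i \<cdot> v \<boxplus> p \<cdot> e \<cdot> i \<cdot> v)" using H v by (simp add: hom_simps Add_assoc)
      also have "\<dots> = i" unfolding 3 using H by (simp add: hom_simps)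
      finally have 5: "h \<cdot> i \<cdot> v \<boxplus> j \<cdot> p \<cdot> e \<cdot> i \<cdot> v = i" .
      have "h \<cdot> ?k = (h \<cdot> i \<cdot> v \<boxplus> j \<cdot> p \<cdot> e \<cdot> i \<cdot> v) \<cdot> \<pi> \<boxplus> j \<cdot> p" using H v w k(1) hwk' by (simp add: hom_simps)
      also have "\<dots> = Idm K B" unfolding 5 by (rule bD(9))
      finally have "h \<cdot> ?k = Idm K B" .
      moreover have "?k \<in> Hom K B B" using H v w k(1) by (simp add: hom_simps)
      ultimately show ?case by blast
    next
      fix L C i1 i2 p1 p2 r Ys
      assume L: "biproduct K L C B' i1 i2 p1 p2" "r \<in> Hom K B' L" "r \<cdot> (p \<cdot> e \<cdot> w) \<cdot> i1 = Idm K L"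
        and Ys: "finite_direct_sum K Ys C" "\<forall>X \<in> set Ys. local_ring (End_ring K X)" "length Ys < length Xs"
      note LD = biproductD[OF L(1)]
      obtain S where S: "is_biproduct K X C S" using ex_biproduct H(5) LD(11) by blast
      then obtain k1 k2 l1 l2 where "biproduct K X C S k1 k2 l1 l2" by (auto simp: is_biproduct_def)
      note A = biproduct_assoc[OF b L(1) this]
      \<comment> \<open>The correction contained in \<open>w\<close> is moved to the left of
        \<open>e\<close>; the inclusion of \<open>L\<close> can then remain
        \<open>j \<cdot> i1\<close>.\<close>
      let ?r = "r \<cdot> (p \<boxplus> p \<cdot> e \<cdot> i \<cdot> v \<cdot> \<pi>)"
      have "?r \<cdot> e \<cdot> j \<cdot> i1 = r \<cdot> (p \<cdot> e \<cdot> ?w) \<cdot> i1" using H v LD L(2) by (simp add: hom_simps)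
      then have "?r \<cdot> e \<cdot> j \<cdot> i1 = Idm K L" using L(3) w_def by simp
      moreover have "?r \<in> Hom K B L" using H v L(2) by (simp add: hom_simps)
      moreover have "finite_direct_sum K (X # Ys) S" using finite_direct_sum.Cons[OF Ys(1) S] .
      moreover have "\<forall>X \<in> set (X # Ys). local_ring (End_ring K X)" using Ys(2) Cons.prems(1) by simp
      moreover have "length (X # Ys) < length (X # Xs)" using Ys(3) by simp
      ultimately show ?case using A by blast
    qed
  qed
qed

end

context extriangulated_category
begin

section \<open>Additive closures and the shrinking of approximations\<close>

lemma direct_summand_iff_retract: "WIC K \<Longrightarrow> direct_summand K X Y \<longleftrightarrow> retract X Y"
  using direct_summand_retract retract_direct_summand unfolding retract_def by blast

lemma finite_direct_sum_member_retract:
  "\<lbrakk>finite_direct_sum K Xs B; X \<in> set Xs\<rbrakk> \<Longrightarrow> retract X B"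
proof (induction rule: finite_direct_sum.induct)
  case (Cons Xs B' Y B)
  have "retract Y B" "retract B' B"
    using direct_summand_retract Cons(2) is_biproduct_swap[OF Cons(2)] unfolding direct_summand_def by blast+
  then show ?case using Cons retract_trans by auto
qed simp

lemma subcategory_finite_direct_sum:
  assumes "subcategory K \<D>" "finite_direct_sum K Xs B" "set Xs \<subseteq> \<D>" shows "B \<in> \<D>"
  using assms(2,3)
proof (induction rule: finite_direct_sum.induct)
  case (Cons Xs B' X B)
  then show ?case using subcategoryD(3)[OF assms(1) _ _ Cons.hyps(2)] by simp
qed (use subcategory_zero[OF assms(1)] in blast)

lemma add_closure_subset:
  assumes "subcategory K \<D>" "T \<in> \<D>" shows "add_closure K T \<subseteq> \<D>"
proof
  fix X assume "X \<in> add_closure K T"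
  then obtain n Y where Y: "finite_direct_sum K (replicate n T) Y" "direct_summand K X Y"
    by (auto simp: add_closure_def)
  have "set (replicate n T) \<subseteq> \<D>" using assms(2) by auto
  then have "Y \<in> \<D>" using subcategory_finite_direct_sum[OF assms(1) Y(1)] by blast
  then show "X \<in> \<D>" using Y(2) subcategoryD(4)[OF assms(1)] unfolding direct_summand_def by blast
qed

lemma add_closure_self:
  assumes "T \<in> Obj K" shows "T \<in> add_closure K T"
proof -
  obtain Z where Z: "zero_object K Z" using ex_zero_object by blast
  have "finite_direct_sum K (replicate 1 T) T"
    using finite_direct_sum.Cons[OF finite_direct_sum.Nil[OF Z] is_biproduct_zero(1)[OF Z assms]] by simp
  then show ?thesis unfolding add_closure_def direct_summand_def using is_biproduct_zero(1)[OF Z assms] by blast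
qed

lemma add_closure_subcategory:
  assumes "WIC K" shows "subcategory K (add_closure K T)"
proof (rule subcategoryI)
  show "add_closure K T \<subseteq> Obj K"
    unfolding add_closure_def direct_summand_def using is_biproduct_Obj(1) by blast
  show "Z \<in> add_closure K T" if "zero_object K Z" for Z
  proof -
    have "Z \<in> Obj K" using that by (simp add: zero_object_def)
    then have "direct_summand K Z Z" using is_biproduct_zero(1)[OF that] unfolding direct_summand_def by blast
    then show ?thesis unfolding add_closure_def using finite_direct_sum.Nil[OF that]
      by (auto intro!: exI[of _ "0::nat"])
  qed
  fix X Y B
  show "B \<in> add_closure K T" if xy: "X \<in> add_closure K T" "Y \<in> add_closure K T" "is_biproduct K X Y B"
  proof -
    obtain n X' where X': "finite_direct_sum K (replicate n T) X'" "direct_summand K X X'"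
      using xy(1) by (auto simp: add_closure_def)
    obtain m Y' where Y': "finite_direct_sum K (replicate m T) Y'" "direct_summand K Y Y'"
      using xy(2) by (auto simp: add_closure_def)
    obtain S where S: "finite_direct_sum K (replicate n T @ replicate m T) S" "is_biproduct K X' Y' S"
      using finite_direct_sum_append[OF X'(1) Y'(1)] .
    have "direct_summand K B S"
      using retract_biproduct[OF _ _ xy(3) S(2)] X'(2) Y'(2) direct_summand_iff_retract[OF assms] by blast
    then show ?thesis using S(1) unfolding add_closure_def replicate_add[symmetric] by blast
  qed
  show "X \<in> add_closure K T" if B: "B \<in> add_closure K T" and XB: "is_biproduct K X Y B"
  proof -
    obtain n B' where B': "finite_direct_sum K (replicate n T) B'" "direct_summand K B B'"
      using B by (auto simp: add_closure_def)
    have "direct_summand K X B" using XB unfolding direct_summand_def by blast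
    then have "direct_summand K X B'" using B'(2) retract_trans direct_summand_iff_retract[OF assms] by blast
    then show ?thesis using B'(1) unfolding add_closure_def by blast
  qed
qed

text \<open>Wakamatsu's lemma; right invertibility of the endomorphisms fixing \<open>g\<close> replaces left minimality of \<open>g\<close>.\<close>

lemma wakamatsu:
  assumes ext: "\<And>A B C. \<lbrakk>is_etriangle K A B C; A \<in> \<D>; C \<in> \<D>\<rbrakk> \<Longrightarrow> B \<in> \<D>"
    and t: "etriangle K Y g D y V \<delta>" and app: "left_approximation K \<D> Y g D"
    and min: "\<And>h. \<lbrakk>h \<in> Hom K D D; h \<cdot> g = g\<rbrakk> \<Longrightarrow> \<exists>k \<in> Hom K D D. h \<cdot> k = Idm K D"
    and D': "D' \<in> \<D>"
  shows "triv V D'"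
  unfolding triv_def
proof
  fix \<xi> assume \<xi>: "\<xi> \<in> Ext K V D'"
  note d = etriangleD[OF t]
  have D: "D \<in> \<D>" using app by (simp add: left_approximation_def)
  \<comment> \<open>It suffices that \<zeta> vanishes: then \<xi> is the push-out of \<delta> along
    a map \<open>a\<close> from \<open>Y\<close>, which factors through the approximation
    \<open>g\<close>, and \<delta> dies along \<open>g\<close>.\<close>
  let ?\<zeta> = "Pull K y \<xi>"
  have \<zeta>: "?\<zeta> \<in> Ext K D D'" using Pull_Ext[OF \<xi> d(3)] .
  obtain u F q where F: "etriangle K D' u F q D ?\<zeta>" using ex_etriangle[OF \<zeta>] .
  note dF = etriangleD[OF F]
  have FD: "F \<in> \<D>" using ext[OF _ D' D] F by (auto simp: is_etriangle_def)
  have "Pull K g ?\<zeta> = EZer K Y D'"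
    using Pull_Cmp[OF \<xi> d(3,2)] etriangle_comp_zero[OF t] Pull_Zer[OF \<xi> d(4)] by simp
  then obtain g' where g': "g' \<in> Hom K Y F" "q \<cdot> g' = g" using lift_along_deflation[OF F d(2)] by blast
  obtain b where b: "b \<in> Hom K D F" "b \<cdot> g = g'" using app FD g'(1) unfolding left_approximation_def by blast
  have "q \<cdot> b \<in> Hom K D D" "(q \<cdot> b) \<cdot> g = g" using b g' dF(3) d(2) by (simp_all add: hom_simps)
  then obtain k where k: "k \<in> Hom K D D" "(q \<cdot> b) \<cdot> k = Idm K D" using min by blast
  have bk: "b \<cdot> k \<in> Hom K D F" "q \<cdot> b \<cdot> k = Idm K D" using b k dF(3) by (simp_all add: hom_simps)
  have "?\<zeta> = Pull K (b \<cdot> k) (Pull K q ?\<zeta>)" using Pull_Cmp[OF \<zeta> dF(3) bk(1)] bk(2) Pull_Idm[OF \<zeta>] by simp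
  also have "\<dots> = EZer K D D'" unfolding Pull_deflation[OF F] using Pull_EZer[OF bk(1)] dF by simp
  finally obtain a where a: "a \<in> Hom K Y D'" "Push K a \<delta> = \<xi>" using Push_connecting[OF t \<xi>] by blast
  obtain a' where a': "a' \<in> Hom K D D'" "a' \<cdot> g = a" using app D' a(1) unfolding left_approximation_def by blast
  have "\<xi> = Push K a' (Push K g \<delta>)" using Push_Cmp[OF d(1,2) a'(1)] a a' by simp
  then show "\<xi> \<in> {EZer K V D'}" unfolding Push_inflation[OF t] using Push_EZer[OF a'(1)] d by simp
qed

text \<open>Induction on the number of local summands. If an \<open>h\<close> fixing
  \<open>g\<close> has no right inverse, its complement \<open>e\<close> kills \<open>g\<close> but
  is split mono on a summand \<open>L\<close>, so \<open>g\<close> can be replaced by its component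
  in the complement \<open>C\<close>, which has fewer local summands.\<close>

lemma approximation_with_trivial_cone:
  assumes "WIC K" "subcategory K \<D>"
    and ext: "\<And>A B C. \<lbrakk>is_etriangle K A B C; A \<in> \<D>; C \<in> \<D>\<rbrakk> \<Longrightarrow> B \<in> \<D>"
    and "finite_direct_sum K Xs D" "\<forall>X \<in> set Xs. local_ring (End_ring K X)"
    and "etriangle K Y g D y V \<delta>" "left_approximation K \<D> Y g D"
  shows "\<exists>D V. is_etriangle K Y D V \<and> D \<in> \<D> \<and> (\<forall>D' \<in> \<D>. triv V D')"
  using assms(4-)
proof (induction "length Xs" arbitrary: Xs D g y V \<delta> rule: less_induct)
  case less
  note t = less.prems(3) and app = less.prems(4)
  note d = etriangleD[OF t]
  have D: "D \<in> \<D>" using app by (simp add: left_approximation_def)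
  show ?case
  proof (cases "\<forall>h \<in> Hom K D D. h \<cdot> g = g \<longrightarrow> (\<exists>k \<in> Hom K D D. h \<cdot> k = Idm K D)")
    case True
    have "triv V D'" if "D' \<in> \<D>" for D'
      by (rule wakamatsu[OF _ t app _ that]) (use ext True in blast)+
    then show ?thesis using t D unfolding is_etriangle_def by blast
  next
    case False
    then obtain h where h: "h \<in> Hom K D D" "h \<cdot> g = g" "\<not> (\<exists>k \<in> Hom K D D. h \<cdot> k = Idm K D)" by blast
    obtain e where e: "e \<in> Hom K D D" "h \<boxplus> e = Idm K D" using ex_Add_complement[OF h(1)] Idm_Hom[OF d(5)] by blast
    have "g \<boxplus> e \<cdot> g = (h \<boxplus> e) \<cdot> g" using h(1,2) e(1) d(2) by (simp add: hom_simps)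
    then have "g \<boxplus> e \<cdot> g = g" unfolding e(2) using d(2) by (simp add: hom_simps)
    then have eg: "e \<cdot> g = Zer K Y D" using Add_cancel_Zer[of g "e \<cdot> g" Y D] d(2) Cmp_Hom[OF d(2) e(1)] by blast
    obtain L C i1 i2 p1 p2 r Ys where L: "biproduct K L C D i1 i2 p1 p2" "r \<in> Hom K D L" "r \<cdot> e \<cdot> i1 = Idm K L"
        and Ys: "finite_direct_sum K Ys C" "\<forall>X \<in> set Ys. local_ring (End_ring K X)" "length Ys < length Xs"
      using local_summand_or_right_inverse[OF less.prems(1,2) h(1) e] h(3) by blast
    note b = biproductD[OF L(1)]
    note H = b(1-4,10-12) d(2,4) L(2) e(1)
    \<comment> \<open>This idempotent has image \<open>L\<close> and kills \<open>g\<close>; its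
      complement \<open>z\<close> vanishes on \<open>L\<close> and fixes \<open>g\<close>, hence
      recovers \<open>g\<close> from \<open>p2 \<cdot> g\<close>.\<close>
    have q: "i1 \<cdot> r \<cdot> e \<in> Hom K D D" using H by (simp add: hom_simps)
    obtain z where z: "z \<in> Hom K D D" "i1 \<cdot> r \<cdot> e \<boxplus> z = Idm K D"
      using ex_Add_complement[OF q] Idm_Hom[OF d(5)] by blast
    have "i1 \<boxplus> z \<cdot> i1 = i1 \<cdot> (r \<cdot> e \<cdot> i1) \<boxplus> z \<cdot> i1" unfolding L(3) using H by (simp add: hom_simps)
    also have "\<dots> = (i1 \<cdot> r \<cdot> e \<boxplus> z) \<cdot> i1" using H z(1) by (simp add: hom_simps)
    also have "\<dots> = i1" unfolding z(2) using H by (simp add: hom_simps)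
    finally have zi: "z \<cdot> i1 = Zer K L D" using Add_cancel_Zer[OF _ b(1) Cmp_Hom[OF b(1) z(1)]] by blast
    have "z \<cdot> g = i1 \<cdot> r \<cdot> (e \<cdot> g) \<boxplus> z \<cdot> g" unfolding eg using H z(1) by (simp add: hom_simps)
    also have "\<dots> = (i1 \<cdot> r \<cdot> e \<boxplus> z) \<cdot> g" using H z(1) by (simp add: hom_simps)
    also have "\<dots> = g" unfolding z(2) using H by (simp add: hom_simps)
    finally have zg: "z \<cdot> g = g" .
    have "(z \<cdot> i2) \<cdot> (p2 \<cdot> g) = (z \<cdot> i1) \<cdot> p1 \<cdot> g \<boxplus> z \<cdot> i2 \<cdot> p2 \<cdot> g" unfolding zi using H z(1) by (simp add: hom_simps)
    also have "\<dots> = z \<cdot> (i1 \<cdot> p1 \<boxplus> i2 \<cdot> p2) \<cdot> g" using H z(1) by (simp add: hom_simps)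
    also have "\<dots> = g" unfolding b(9) using H zg by (simp add: hom_simps)
    finally have m: "(z \<cdot> i2) \<cdot> (p2 \<cdot> g) = g" .
    have m': "z \<cdot> i2 \<in> Hom K C D" "p2 \<cdot> g \<in> Hom K Y C" using H z(1) by (simp_all add: hom_simps)
    have "inflation K ((z \<cdot> i2) \<cdot> (p2 \<cdot> g))" unfolding m inflation_def using t by blast
    then have "inflation K (p2 \<cdot> g)" using assms(1) m' unfolding WIC_def by blast
    then obtain y' V' \<delta>' where t': "etriangle K Y (p2 \<cdot> g) C y' V' \<delta>'"
      using HomD[OF m'(2)] unfolding inflation_def by (metis etriangleD(2) HomD(2,3))
    have "C \<in> \<D>" using subcategoryD(5)[OF assms(2) D] L(1) unfolding is_biproduct_def by blast
    moreover have "\<exists>f' \<in> Hom K C D'. f' \<cdot> (p2 \<cdot> g) = f" if Df: "D' \<in> \<D>" "f \<in> Hom K Y D'" for D' f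
    proof -
      obtain f' where f': "f' \<in> Hom K D D'" "f' \<cdot> g = f" using app Df unfolding left_approximation_def by blast
      have "(f' \<cdot> z \<cdot> i2) \<cdot> (p2 \<cdot> g) = f' \<cdot> ((z \<cdot> i2) \<cdot> (p2 \<cdot> g))" using H z(1) f'(1) by (simp add: hom_simps)
      moreover have "f' \<cdot> z \<cdot> i2 \<in> Hom K C D'" using H z(1) f'(1) by (simp add: hom_simps)
      ultimately show ?thesis using f'(2) m by auto
    qed
    ultimately have "left_approximation K \<D> Y (p2 \<cdot> g) C" using m'(2) unfolding left_approximation_def by blast
    then show ?thesis using less.hyps[OF Ys(3,1,2) t'] by blast
  qed
qed

end

context enough_extriangulated_category
begin

text \<open>The number \<open>1\<close> stands for the second extension group. The class of
  \<open>G\<close> is a map from \<open>S\<close> to the cosyzygy of \<open>D\<close>, which extends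
  to \<open>U\<close> once \<E>(V, cosyzygy D) vanishes. In the proof of \<open>\<T>_finite\<close>
  this replaces a filtration factor by its approximation.\<close>

lemma extension_lift:
  assumes "is_etriangle K D G S" "is_etriangle K S U V" "vanish 1 V D"
  obtains G' where "is_etriangle K D G' U" "is_etriangle K G G' V"
proof -
  obtain u q \<gamma> where 1: "etriangle K D u G q S \<gamma>" using assms(1) by (auto simp: is_etriangle_def)
  obtain x y \<delta> where 2: "etriangle K S x U y V \<delta>" using assms(2) by (auto simp: is_etriangle_def)
  note d1 = etriangleD[OF 1] and d2 = etriangleD[OF 2]
  obtain c I d \<sigma> where 3: "injective_in K (Obj K) I" "etriangle K D c I d (cosyzygy K D) \<sigma>"
    using cosyzygy_etriangle[OF d1(4)] .
  note d3 = etriangleD[OF 3(2)]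
  obtain f where f: "f \<in> Hom K S (cosyzygy K D)" "Pull K f \<sigma> = \<gamma>"
    using Pull_connecting[OF 3(2) d1(1) trivD[OF injective_triv[OF 3(1)] Push_Ext[OF d1(1) d3(2)]]] .
  have "triv V (cosyzygy K D)" using assms(3) vanish_cosyzygy[OF d2(6) d1(4), of 1] by simp
  then obtain f' where f': "f' \<in> Hom K U (cosyzygy K D)" "f' \<cdot> x = f" using triv_extend[OF 2 _ f(1)] by blast
  let ?\<epsilon> = "Pull K f' \<sigma>"
  have \<epsilon>: "?\<epsilon> \<in> Ext K U D" "Pull K x ?\<epsilon> = \<gamma>"
    using Pull_Ext[OF d3(1) f'(1)] Pull_Cmp[OF d3(1) f'(1) d2(2)] f f' by auto
  obtain u' G' q' where 4: "etriangle K D u' G' q' U ?\<epsilon>" using ex_etriangle[OF \<epsilon>(1)] .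
  obtain E h' k e \<delta>'' where 5: "etriangle K E h' G' (y \<cdot> q') V \<delta>''" "etriangle K D k E e S (Pull K x ?\<epsilon>)"
    using ET4op[OF 4 2] by blast
  obtain b b' where "b \<in> Hom K E G" "b' \<in> Hom K G E" "b' \<cdot> b = Idm K E" "b \<cdot> b' = Idm K G"
    using Rlz_unique[OF 5(2)[unfolded \<epsilon>(2)] 1] .
  then have "is_etriangle K G G' V" using etriangle_iso_cocone[OF 5(1)] by blast
  then show ?thesis using that 4 by (auto simp: is_etriangle_def)
qed

lemma finite_direct_sum_vanish:
  "\<lbrakk>finite_direct_sum K Xs B; Y \<in> Obj K; \<forall>X \<in> set Xs. vanish n X Y\<rbrakk> \<Longrightarrow> vanish n B Y"
proof (induction rule: finite_direct_sum.induct)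
  case (Nil Z) then show ?case using vanish_zero by blast
next
  case (Cons Xs B' X B)
  then show ?case using vanish_left_mid[OF is_etriangle_biproduct(1)] by simp
qed

lemma add_closure_vanish:
  assumes "X \<in> add_closure K T" "Y \<in> Obj K" "vanish n T Y" shows "vanish n X Y"
proof -
  obtain m B where B: "finite_direct_sum K (replicate m T) B" "direct_summand K X B"
    using assms(1) by (auto simp: add_closure_def)
  have "vanish n B Y" using finite_direct_sum_vanish[OF B(1) assms(2)] assms(3) by simp
  then show ?thesis using B(2) vanish_summand(2) assms(2) unfolding direct_summand_def by blast
qed

end

text \<open>The terms in \<omega> have no extensions with the perpendicular class, so each step of
  the resolution raises the bound by one.\<close>

lemma (in self_orthogonal_subcategory) hat_bound:
  assumes "A \<in> hat K \<omega>"
  shows "\<exists>N. \<forall>Y \<in> right_perp K \<omega>. \<forall>n \<ge> N. vanish n A Y"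
  using assms
proof (induction rule: hat_induct)
  case (base A)
  then show ?case using right_perpD(2)[OF _ \<omega>_Obj] by blast
next
  case (step A W B)
  then obtain N where N: "\<forall>Y \<in> right_perp K \<omega>. \<forall>n \<ge> N. vanish n B Y" by blast
  have "vanish n A Y" if Y: "Y \<in> right_perp K \<omega>" and n: "n \<ge> Suc N" for Y n
  proof -
    obtain m where m: "n = Suc m" "m \<ge> N" using n by (metis Suc_le_D Suc_le_mono)
    show ?thesis unfolding m(1)
      using vanish_left_cone[OF step(1)] right_perpD[OF Y \<omega>_Obj] N Y m(2) step(2) by blast
  qed
  then show ?case by blast
qed

section \<open>From coresolving subcategories to tilting subcategories\<close>

locale coresolving_subcategory = enough_extriangulated_category K
  for K :: "('o, 'm, 'e, 'z) ext_struct_scheme" (structure) +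
  fixes \<C> \<D> :: "'o set"
  assumes ks: "krull_schmidt K" and wic: "WIC K"
    and \<C>: "subcategory K \<C>" "self_orthogonal K \<C>"
    and cogen: "\<exists>\<I>. relative_injective_cogenerator K (res_class K \<C>) \<I>"
    and filtered: "finitely_filtered K (check K (res_class K \<C>))"
    and \<D>: "\<D> \<in> coresolving_subcategories K \<C>"

sublocale coresolving_subcategory \<subseteq> C: self_orthogonal_subcategory K \<C>
  using \<C> by unfold_locales

context coresolving_subcategory
begin

abbreviation "\<X> \<equiv> res_class K \<C>"

definition "\<T> = left_perp K \<D> \<inter> \<D>"

section \<open>Orthogonal approximations in \<X>\<close>

lemma \<D>_sub: "subcategory K \<D>" and \<D>_\<X>: "\<D> \<subseteq> \<X>" and \<D>_check: "check K \<D> = check K \<X>"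
  using \<D> by (auto simp: coresolving_subcategories_def)

lemma \<D>_Obj: "\<D> \<subseteq> Obj K" using subcategoryD(1)[OF \<D>_sub] .

lemma \<D>_ext: "\<lbrakk>is_etriangle K A B C; A \<in> \<D>; C \<in> \<D>\<rbrakk> \<Longrightarrow> B \<in> \<D>"
  using \<D> C.res_extension[of A C B] \<D>_\<X>
  unfolding coresolving_subcategories_def relative_coresolving_def by blast

lemma \<D>_cone: "\<lbrakk>is_etriangle K A B C; A \<in> \<D>; B \<in> \<D>\<rbrakk> \<Longrightarrow> C \<in> \<D>"
  using \<D> C.res_cone[of A B C] \<D>_\<X>
  unfolding coresolving_subcategories_def relative_coresolving_def by blast

lemma \<D>_injective: "injective_in K \<X> I \<Longrightarrow> I \<in> \<D>"
  using \<D> unfolding coresolving_subcategories_def relative_coresolving_def by blast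

text \<open>The cogenerator consists of relative injectives, which belong to \<D>, and \<D> is
  closed under cones. Dimension shifting against \<X> can thus stay inside \<D>.\<close>

lemma \<D>_cosyzygy:
  assumes "D \<in> \<D>"
  obtains I D' where "is_etriangle K D I D'" "D' \<in> \<D>" "\<And>V n. V \<in> \<X> \<Longrightarrow> vanish n V I"
proof -
  obtain \<I> where I: "\<I> \<subseteq> \<X> \<inter> right_perp K \<X>" "\<forall>Y \<in> \<X>. \<exists>I \<in> \<I>. \<exists>Y' \<in> \<X>. is_etriangle K Y I Y'"
    using cogen unfolding relative_injective_cogenerator_def by blast
  obtain I Y' where Y': "I \<in> \<I>" "Y' \<in> \<X>" "is_etriangle K D I Y'" using I(2) assms \<D>_\<X> by blast
  have IX: "I \<in> \<X>" "I \<in> right_perp K \<X>" using I(1) Y'(1) by auto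
  have v: "vanish n V I" if "V \<in> \<X>" for V n using right_perpD(2)[OF IX(2) res_Obj that] .
  have "injective_in K \<X> I"
    unfolding injective_in_def
  proof (intro conjI allI impI ballI)
    fix A x B y C \<delta> a
    assume "A \<in> \<X> \<and> B \<in> \<X> \<and> C \<in> \<X> \<and> etriangle K A x B y C \<delta>" "a \<in> Hom K A I"
    then show "\<exists>b \<in> Hom K B I. b \<cdot> x = a" using triv_extend v[of C 0] vanish_0 by metis
  qed (rule IX(1))
  then have "Y' \<in> \<D>" using \<D>_cone[OF Y'(3) assms] \<D>_injective by blast
  then show ?thesis using that Y'(3) v by blast
qed

text \<open>Wakamatsu's lemma yields the first degree only; shifting along
  \<open>\<D>_cosyzygy\<close> reduces every degree to that one.\<close>

lemma perp_\<D>_of_triv: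
  assumes "V \<in> \<X>" "\<And>D. D \<in> \<D> \<Longrightarrow> triv V D" shows "V \<in> left_perp K \<D>"
proof -
  have V: "V \<in> Obj K" using assms(1) res_Obj by blast
  have "vanish n V D" if "D \<in> \<D>" for n D
    using that
  proof (induction n arbitrary: D)
    case 0 then show ?case using assms(2) vanish_0 by simp
  next
    case (Suc n)
    obtain I D' where I: "is_etriangle K D I D'" "D' \<in> \<D>" "\<And>V n. V \<in> \<X> \<Longrightarrow> vanish n V I"
      using \<D>_cosyzygy[OF Suc.prems] by blast
    show ?case using vanish_right_cocone[OF I(1) V Suc.IH[OF I(2)] I(3)[OF assms(1)]] .
  qed
  then show ?thesis using V by (simp add: left_perp_iff[OF \<D>_Obj])
qed

lemma \<D>_approximation:
  assumes "Y \<in> \<X>"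
  obtains D V where "is_etriangle K Y D V" "D \<in> \<D>" "V \<in> \<X> \<inter> left_perp K \<D>"
proof -
  obtain g D y V \<delta> where t: "etriangle K Y g D y V \<delta>" "left_approximation K \<D> Y g D"
    using \<D> assms unfolding coresolving_subcategories_def strongly_covariantly_finite_def by blast
  obtain Xs where Xs: "finite_direct_sum K Xs D" "\<forall>X \<in> set Xs. local_ring (End_ring K X)"
    using ks etriangleD(5)[OF t(1)] unfolding krull_schmidt_def by blast
  obtain D1 V1 where 1: "is_etriangle K Y D1 V1" "D1 \<in> \<D>" "\<forall>D' \<in> \<D>. triv V1 D'"
    using approximation_with_trivial_cone[OF wic \<D>_sub _ Xs t] \<D>_ext by blast
  have "V1 \<in> \<X>" using C.res_cone[OF assms _ 1(1)] 1(2) \<D>_\<X> by blast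
  then show ?thesis using that 1 perp_\<D>_of_triv by blast
qed

lemma left_perp_\<D>D: "Z \<in> left_perp K \<D> \<Longrightarrow> D \<in> \<D> \<Longrightarrow> vanish n Z D" "Z \<in> left_perp K \<D> \<Longrightarrow> Z \<in> Obj K"
  by (auto simp: left_perp_iff[OF \<D>_Obj])

lemma left_perp_\<D>_mid:
  assumes "is_etriangle K A B C" "A \<in> left_perp K \<D>" "C \<in> left_perp K \<D>"
  shows "B \<in> left_perp K \<D>"
  unfolding left_perp_iff[OF \<D>_Obj]
  using vanish_left_mid[OF assms(1)] is_etriangle_Obj(2)[OF assms(1)] assms(2,3) left_perp_\<D>D(1) \<D>_Obj
  by blast

lemma \<T>_sub: "subcategory K \<T>"
proof (rule subcategoryI)
  show "\<T> \<subseteq> Obj K" using \<D>_Obj by (auto simp: \<T>_def)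
  show "Z \<in> \<T>" if Z: "zero_object K Z" for Z
  proof -
    have "Z \<in> Obj K" using Z by (simp add: zero_object_def)
    then have "Z \<in> left_perp K \<D>" using vanish_zero(2)[OF Z] \<D>_Obj by (auto simp: left_perp_iff[OF \<D>_Obj])
    then show ?thesis using subcategory_zero[OF \<D>_sub Z] by (simp add: \<T>_def)
  qed
  fix X Y B
  show "B \<in> \<T>" if XY: "X \<in> \<T>" "Y \<in> \<T>" and B: "is_biproduct K X Y B"
    using left_perp_\<D>_mid[OF is_etriangle_biproduct(1)[OF B]] subcategoryD(3)[OF \<D>_sub _ _ B] XY by (simp add: \<T>_def)
  show "X \<in> \<T>" if B: "B \<in> \<T>" and XY: "is_biproduct K X Y B"
  proof -
    have "B \<in> left_perp K \<D>" using B by (simp add: \<T>_def)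
    then have "vanish n X D" if "D \<in> \<D>" for n D
      using vanish_summand(2)[OF XY _ left_perp_\<D>D(1)[OF _ that]] that \<D>_Obj by blast
    then have "X \<in> left_perp K \<D>"
      using is_biproduct_Obj(1)[OF XY] by (simp add: left_perp_iff[OF \<D>_Obj])
    then show ?thesis using subcategoryD(4)[OF \<D>_sub _ XY] B by (simp add: \<T>_def)
  qed
qed

lemma \<D>_right_perp_\<T>: "\<D> \<subseteq> right_perp K \<T>"
proof
  fix D assume "D \<in> \<D>"
  then show "D \<in> right_perp K \<T>"
    using left_perp_\<D>D(1) \<D>_Obj
    unfolding right_perp_iff[OF subcategoryD(1)[OF \<T>_sub]] by (auto simp: \<T>_def)
qed

lemma \<T>_so: "self_orthogonal K \<T>"
  unfolding self_orthogonal_def using \<D>_right_perp_\<T> by (auto simp: \<T>_def)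

end

sublocale coresolving_subcategory \<subseteq> T: self_orthogonal_subcategory K \<T>
  using \<T>_sub \<T>_so by unfold_locales

section \<open>Uniform bounds, the tilting property and finiteness\<close>

context coresolving_subcategory
begin

text \<open>Injective dimension at most \<open>m\<close> relative to the left perpendicular class of
  \<D>; in the shifted degrees, \<open>m = 0\<close> means that all positive extensions
  vanish.\<close>

definition perp_bounded :: "nat \<Rightarrow> 'o \<Rightarrow> bool" where
  "perp_bounded m U \<longleftrightarrow> (\<forall>Z \<in> left_perp K \<D>. \<forall>n \<ge> m. vanish n Z U)"

lemma perp_boundedD: "\<lbrakk>perp_bounded m U; Z \<in> left_perp K \<D>; m \<le> n\<rbrakk> \<Longrightarrow> vanish n Z U"
  by (simp add: perp_bounded_def)

lemma check_perp_bounded: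
  assumes "U \<in> check K \<D>" shows "\<exists>m. perp_bounded m U"
  using assms
proof (induction rule: check_induct)
  case (base A)
  then show ?case using left_perp_\<D>D(1) unfolding perp_bounded_def by blast
next
  case (step A W B)
  then obtain m where m: "perp_bounded m B" by blast
  have "vanish n Z A" if Z: "Z \<in> left_perp K \<D>" and n: "n \<ge> Suc m" for Z n
  proof -
    obtain k where k: "n = Suc k" "k \<ge> m" using n by (metis Suc_le_D Suc_le_mono)
    show ?thesis unfolding k(1)
      by (rule vanish_right_cocone[OF step(1) left_perp_\<D>D(2)[OF Z] perp_boundedD[OF m Z k(2)] left_perp_\<D>D(1)[OF Z step(2)]])
  qed
  then show ?case unfolding perp_bounded_def by blast
qed

text \<open>The cone \<open>V\<close> of an orthogonal approximation has a bound smaller by one, and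
  the middle term, an extension of two left orthogonal objects, lies in \<T>. At bound zero the
  approximation splits.\<close>

lemma \<T>_coresolution:
  assumes "perp_bounded m U" "U \<in> \<X> \<inter> left_perp K \<D>" shows "U \<in> check K \<T>"
  using assms
proof (induction m arbitrary: U)
  case 0
  obtain D V where V: "is_etriangle K U D V" "D \<in> \<D>" "V \<in> \<X> \<inter> left_perp K \<D>"
    using \<D>_approximation 0(2) by blast
  have "triv V U" using perp_boundedD[OF 0(1), of V 0] V(3) by (simp add: vanish_0)
  then have "U \<in> \<D>" using triv_split[OF V(1)] subcategoryD(4)[OF \<D>_sub V(2)] by blast
  then show ?case using 0(2) check_base[OF T.\<omega>_Obj] by (simp add: \<T>_def)
next
  case (Suc m)
  obtain D V where V: "is_etriangle K U D V" "D \<in> \<D>" "V \<in> \<X> \<inter> left_perp K \<D>"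
    using \<D>_approximation Suc.prems(2) by blast
  have "perp_bounded m V"
    unfolding perp_bounded_def
  proof (intro ballI allI impI)
    fix Z n assume Z: "Z \<in> left_perp K \<D>" and "m \<le> n"
    then have "vanish (Suc n) Z U" using perp_boundedD[OF Suc.prems(1)] by simp
    then show "vanish n Z V"
      using vanish_right_cone[OF V(1) left_perp_\<D>D(2)[OF Z] left_perp_\<D>D(1)[OF Z V(2)]] by simp
  qed
  then have "V \<in> check K \<T>" using Suc.IH V(3) by blast
  moreover have "D \<in> \<T>" using left_perp_\<D>_mid[OF V(1)] V Suc.prems(2) by (simp add: \<T>_def)
  ultimately show ?case using check_step[OF V(1)] by blast
qed

lemma perp_\<X>_check: "\<X> \<inter> left_perp K \<D> \<subseteq> check K \<T>"
proof
  fix U assume U: "U \<in> \<X> \<inter> left_perp K \<D>"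
  then have "U \<in> check K \<D>" unfolding \<D>_check using check_base[OF res_Obj] by blast
  then show "U \<in> check K \<T>" using check_perp_bounded \<T>_coresolution[OF _ U] by blast
qed

lemma \<C>_check_\<T>: "\<C> \<subseteq> check K \<T>"
proof
  fix A assume A: "A \<in> \<C>"
  then have "A \<in> left_perp K \<D>"
    using C.res_vanish[OF A] \<D>_\<X> C.\<omega>_Obj by (auto simp: left_perp_iff[OF \<D>_Obj])
  then show "A \<in> check K \<T>" using perp_\<X>_check C.\<omega>_res A by blast
qed

lemma filtration_bounded:
  assumes "\<And>S. S \<in> \<S> \<Longrightarrow> perp_bounded m S" "has_filtration K \<S> M" shows "perp_bounded m M"
  using assms(2)
proof (induction rule: has_filtration.induct)
  case (zero Z) then show ?case using vanish_zero(1) by (auto simp: perp_bounded_def)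
next
  case (step M' S M)
  then show ?case
    using vanish_right_mid[OF step(3)] perp_boundedD assms(1) unfolding perp_bounded_def by blast
qed

lemma uniform_bound: obtains N where "\<And>M. M \<in> check K \<X> \<Longrightarrow> perp_bounded N M"
proof -
  obtain \<S> where S: "finite \<S>" "\<S> \<subseteq> check K \<X>" "\<forall>M \<in> check K \<X>. has_filtration K \<S> M"
    using filtered unfolding finitely_filtered_def by blast
  have "\<forall>S \<in> \<S>. \<exists>m. perp_bounded m S" using check_perp_bounded S(2) \<D>_check by blast
  then obtain f where f: "\<And>S. S \<in> \<S> \<Longrightarrow> perp_bounded (f S) S" by metis
  \<comment> \<open>The sum is just a common upper bound of finitely many numbers.\<close>
  have "perp_bounded (sum f \<S>) S" if "S \<in> \<S>" for S
    using f[OF that] member_le_sum[OF that, of f] S(1) unfolding perp_bounded_def by auto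
  then show ?thesis using that filtration_bounded S(3) by blast
qed

text \<open>The mirror image of \<open>\<T>_coresolution\<close>: passing to the cocone of a
  \<C>-cover lowers the bound, and at bound zero the cover splits.\<close>

lemma hat_of_bound:
  assumes "A \<in> \<X>" "\<And>Y n. \<lbrakk>Y \<in> \<X>; m \<le> n\<rbrakk> \<Longrightarrow> vanish n A Y" shows "A \<in> hat K \<C>"
  using assms
proof (induction m arbitrary: A)
  case 0
  obtain W B where W: "W \<in> \<C>" "B \<in> \<X>" "is_etriangle K B W A" using res_unfold[OF 0(1)] .
  have "triv A B" using 0(2)[OF W(2), of 0] by (simp add: vanish_0)
  then have "A \<in> \<C>" using triv_split[OF W(3)] subcategoryD(5)[OF C.sub W(1)] by blast
  then show ?case using hat_base[OF C.\<omega>_Obj] by blast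
next
  case (Suc m)
  obtain W B where W: "W \<in> \<C>" "B \<in> \<X>" "is_etriangle K B W A" using res_unfold[OF Suc.prems(1)] .
  have "vanish n B Y" if Y: "Y \<in> \<X>" and n: "m \<le> n" for Y n
    using vanish_left_cocone[OF W(3) _ C.res_vanish[OF W(1) Y] Suc.prems(2)[OF Y]] Y n res_Obj by auto
  then have "B \<in> hat K \<C>" using Suc.IH W(2) by blast
  then show ?case using hat_step[OF W(3,1)] by blast
qed

lemma ex_bounded_tilting_pair: obtains N where "bounded_tilting_pair K \<C> \<T> N"
proof -
  obtain N where N: "\<And>M. M \<in> check K \<X> \<Longrightarrow> perp_bounded N M" using uniform_bound by blast
  \<comment> \<open>The bound on objects of \<X> is read in the other argument: \<T> is left
    orthogonal to \<D>, so the same \<open>N\<close> limits its extensions into \<X> and makes its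
    \<C>-resolutions finite.\<close>
  have v: "vanish n T Y" if "T \<in> \<T>" "Y \<in> \<X>" "N \<le> n" for T Y n
    using perp_boundedD[OF N] check_base[OF res_Obj that(2)] that(1,3) by (simp add: \<T>_def)
  have "\<T> \<subseteq> hat K \<C>"
  proof
    fix A assume A: "A \<in> \<T>"
    then have "A \<in> \<X>" using \<D>_\<X> by (auto simp: \<T>_def)
    then show "A \<in> hat K \<C>" using hat_of_bound[of A N] v[OF A] by blast
  qed
  then have "tilting_pair K \<C> \<T>"
    unfolding tilting_pair_def using C.sub C.so T.sub T.so \<C>_check_\<T> by blast
  then have "bounded_tilting_pair K \<C> \<T> N" using v by unfold_locales
  then show ?thesis using that by blast
qed

text \<open>The first direction, applied to the \<T> just constructed, describes its class as a
  perpendicular class and so puts \<D> into it. Conversely, the orthogonal approximation of a member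
  splits, its cone being in \<open>check K \<T>\<close>.\<close>

lemma res_\<T>: "res_class K \<T> = \<D>"
proof -
  obtain N where "bounded_tilting_pair K \<C> \<T> N" using ex_bounded_tilting_pair .
  then interpret B: bounded_tilting_pair K \<C> \<T> N .
  show ?thesis
  proof
    show "\<D> \<subseteq> res_class K \<T>"
      unfolding B.res_\<T>_eq using \<D>_\<X> \<D>_right_perp_\<T> by blast
    show "res_class K \<T> \<subseteq> \<D>"
    proof
      fix A assume A: "A \<in> res_class K \<T>"
      then have AX: "A \<in> \<X>" using B.res_\<T>_eq by blast
      obtain D V where V: "is_etriangle K A D V" "D \<in> \<D>" "V \<in> \<X> \<inter> left_perp K \<D>" using \<D>_approximation[OF AX] .
      have "triv V A" using T.check_triv[OF _ res_right_perp[OF A]] V(3) perp_\<X>_check by blast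
      then show "A \<in> \<D>" using triv_split[OF V(1)] subcategoryD(4)[OF \<D>_sub V(2)] by blast
    qed
  qed
qed

text \<open>Filtration factors lie in \<open>check K \<X>\<close> and perhaps not in \<X>, where
  \<open>\<D>_approximation\<close> applies. In the inductive step a \<T>-cover of \<open>D1\<close>
  yields \<open>Z\<close> over \<open>B\<close> with cocone \<open>L\<close> in \<D>; pulling
  \<open>Z\<close> back against \<open>W\<close> leaves an extension of \<open>W\<close> by
  \<open>L\<close>, which is in \<D>.\<close>

lemma check_\<X>_approximation:
  assumes "S \<in> check K \<X>"
  obtains D V where "is_etriangle K S D V" "D \<in> \<D>" "V \<in> check K \<T>"
proof -
  have "S \<in> check K \<D>" using assms \<D>_check by simp
  then have "\<exists>D V. is_etriangle K S D V \<and> D \<in> \<D> \<and> V \<in> check K \<T>"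
  proof (induction rule: check_induct)
    case (base A)
    obtain Z where Z: "zero_object K Z" using ex_zero_object by blast
    then show ?case
      using base is_etriangle_zero(1)[OF Z] \<D>_Obj check_base[OF T.\<omega>_Obj] subcategory_zero[OF T.sub] by blast
  next
    case (step A W B)
    then obtain D1 V1 where 1: "is_etriangle K B D1 V1" "D1 \<in> \<D>" "V1 \<in> check K \<T>" by blast
    obtain T1 L where 2: "T1 \<in> \<T>" "L \<in> \<D>" "is_etriangle K L T1 D1" using res_unfold[of D1 \<T>] 1(2) res_\<T> by metis
    obtain Z where Z: "is_etriangle K Z T1 V1" "is_etriangle K L Z B" using is_etriangle_ET4op[OF 2(3) 1(1)] .
    obtain M where M: "is_etriangle K A M Z" "is_etriangle K L M W" using is_etriangle_pullback[OF step(1) Z(2)] .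
    have "M \<in> \<D>" using \<D>_ext[OF M(2) 2(2) step(2)] .
    moreover have "Z \<in> check K \<T>" using check_step[OF Z(1) 2(1) 1(3)] .
    ultimately show ?case using M(1) by blast
  qed
  then show ?thesis using that by blast
qed

text \<open>Each filtration factor is approximated by \<D> and the approximation is covered by \<T>.
  These finitely many covers suffice, since approximations and covers can be spliced along a
  filtration.\<close>

lemma \<T>_finite: "finite_subcategory K \<T>"
proof -
  obtain \<S> where S: "finite \<S>" "\<S> \<subseteq> check K \<X>" "\<forall>M \<in> check K \<X>. has_filtration K \<S> M"
    using filtered unfolding finitely_filtered_def by blast
  have "\<exists>D V L W. is_etriangle K S D V \<and> D \<in> \<D> \<and> V \<in> check K \<T> \<and> is_etriangle K L W D \<and> W \<in> \<T> \<and> L \<in> \<D>"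
    if "S \<in> \<S>" for S
  proof -
    obtain D V where 1: "is_etriangle K S D V" "D \<in> \<D>" "V \<in> check K \<T>" using check_\<X>_approximation S(2) \<open>S \<in> \<S>\<close> by blast
    obtain W L where "W \<in> \<T>" "L \<in> \<D>" "is_etriangle K L W D" using res_unfold[of D \<T>] 1(2) res_\<T> by metis
    then show ?thesis using 1 by blast
  qed
  then obtain D V L W where f: "\<And>S. S \<in> \<S> \<Longrightarrow> is_etriangle K S (D S) (V S) \<and> D S \<in> \<D> \<and> V S \<in> check K \<T> \<and>
      is_etriangle K (L S) (W S) (D S) \<and> W S \<in> \<T> \<and> L S \<in> \<D>" by metis
  obtain Ss where Ss: "set Ss = \<S>" using finite_list[OF S(1)] by blast
  have W\<T>: "set (map W Ss) \<subseteq> \<T>" using f Ss by auto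
  \<comment> \<open>The generator: the sum of the chosen covers of all filtration factors.\<close>
  obtain T0 where T0: "finite_direct_sum K (map W Ss) T0" using ex_finite_direct_sum[of "map W Ss"] W\<T> T.\<omega>_Obj by blast
  have T0\<T>: "T0 \<in> \<T>" using subcategory_finite_direct_sum[OF T.sub T0 W\<T>] .
  then have T0Obj: "T0 \<in> Obj K" using T.\<omega>_Obj by blast
  let ?A = "add_closure K T0"
  note A_sub = add_closure_subcategory[OF wic, of T0]
  have A\<T>: "?A \<subseteq> \<T>" using add_closure_subset[OF T.sub T0\<T>] .
  have WA: "W S \<in> ?A" if "S \<in> \<S>" for S
  proof -
    have "direct_summand K (W S) T0"
      using finite_direct_sum_member_retract[OF T0] that Ss direct_summand_iff_retract[OF wic] by auto
    then show ?thesis using add_closure_self[OF T0Obj] subcategoryD(4)[OF A_sub] unfolding direct_summand_def by blast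
  qed
  have filt: "\<exists>D V L W. is_etriangle K M D V \<and> D \<in> \<D> \<and> V \<in> check K \<T> \<and> is_etriangle K L W D \<and> W \<in> ?A \<and> L \<in> \<D>"
    if "has_filtration K \<S> M" for M
    using that
  proof (induction rule: has_filtration.induct)
    case (zero Z)
    have Z: "Z \<in> Obj K" "is_etriangle K Z Z Z" using zero is_etriangle_zero(1)[OF zero] by (auto simp: zero_object_def)
    have "Z \<in> check K \<T>" using check_base[OF T.\<omega>_Obj] subcategory_zero[OF T.sub zero] .
    then show ?case using Z subcategory_zero[OF A_sub zero] subcategory_zero[OF \<D>_sub zero] by blast
  next
    case (step M' S M)
    then obtain D' V' L' W' where 1: "is_etriangle K M' D' V'" "D' \<in> \<D>" "V' \<in> check K \<T>" "is_etriangle K L' W' D'"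
        "W' \<in> ?A" "L' \<in> \<D>" by blast
    note 2 = f[OF step(2), THEN conjunct1] f[OF step(2), THEN conjunct2]
    obtain G where G: "is_etriangle K M G V'" "is_etriangle K D' G S" using is_etriangle_pushout[OF step(3) 1(1)] .
    have D'perp: "D' \<in> right_perp K \<T>" using res_right_perp[of D' \<T>] 1(2) res_\<T> by simp
    \<comment> \<open>\<open>D'\<close> and \<open>S\<close> are joined by \<open>G\<close>; lifting
      this extension along \<open>S \<rightarrow> D S\<close> puts an object of \<D> in place of the
      factor \<open>S\<close>.\<close>
    obtain G' where G': "is_etriangle K D' G' (D S)" "is_etriangle K G G' (V S)"
      using extension_lift[OF G(2) 2(1)] T.check_vanish[OF _ D'perp] 2(2) by blast
    obtain H where H: "is_etriangle K M G' H" "is_etriangle K V' H (V S)" using is_etriangle_ET4[OF G(1) G'(2)] .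
    have "triv (W S) D'" using right_perpD(2)[OF D'perp T.\<omega>_Obj, of "W S" 0] 2(2) by (simp add: vanish_0)
    moreover obtain WW where WW: "is_biproduct K W' (W S) WW"
      using ex_biproduct[of W' "W S"] 1(5) 2(2) A\<T> T.\<omega>_Obj by blast
    ultimately obtain F where F: "is_etriangle K L' F (L S)" "is_etriangle K F WW G'"
      using horseshoe_res[OF G'(1) 1(4)] 2(2) by blast
    have "G' \<in> \<D>" using \<D>_ext[OF G'(1) 1(2)] 2(2) by blast
    moreover have "H \<in> check K \<T>" using T.check_ext_closed[OF 1(3) _ H(2)] 2(2) by blast
    moreover have "F \<in> \<D>" using \<D>_ext[OF F(1) 1(6)] 2(2) by blast
    moreover have "WW \<in> ?A" using subcategoryD(3)[OF A_sub 1(5) WA[OF step(2)] WW] .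
    ultimately show ?case using H(1) F(2) by blast
  qed
  have "\<T> \<subseteq> ?A"
  proof
    fix T assume T: "T \<in> \<T>"
    then have T\<D>: "T \<in> \<D>" "T \<in> left_perp K \<D>" by (auto simp: \<T>_def)
    then have "T \<in> check K \<X>" using check_base[OF res_Obj] \<D>_\<X> by blast
    then obtain D V L W where 1: "is_etriangle K T D V" "D \<in> \<D>" "V \<in> check K \<T>" "is_etriangle K L W D" "W \<in> ?A" "L \<in> \<D>"
      using filt S(3) by metis
    \<comment> \<open>The approximation splits because \<E>(V, T) vanishes. So \<open>V\<close> lies
      in \<D>, and the cocone \<open>E\<close> of \<open>W \<rightarrow> D \<rightarrow> T\<close>
      is an extension of \<open>V\<close> by \<open>L\<close>. As \<E>(T, E) vanishes too,
      \<open>T\<close> is a summand of \<open>W\<close>.\<close>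
    have "T \<in> right_perp K \<T>" using res_right_perp[of T \<T>] T\<D>(1) res_\<T> by simp
    then have bi: "is_biproduct K T V D" using triv_split[OF 1(1)] T.check_triv[OF 1(3)] by blast
    then have V: "V \<in> \<D>" "is_etriangle K V D T"
      using subcategoryD(5)[OF \<D>_sub 1(2)] is_etriangle_biproduct(2) by blast+
    obtain E where E: "is_etriangle K E W T" "is_etriangle K L E V" using is_etriangle_ET4op[OF 1(4) V(2)] .
    have "E \<in> \<D>" using \<D>_ext[OF E(2) 1(6) V(1)] .
    then have "triv T E" using left_perp_\<D>D(1)[OF T\<D>(2), of E 0] by (simp add: vanish_0)
    then show "T \<in> ?A" using triv_split[OF E(1)] subcategoryD(5)[OF A_sub 1(5)] by blast
  qed
  then show ?thesis unfolding finite_subcategory_def using A\<T> T0Obj by blast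
qed

lemma \<T>_finite_tilting: "\<T> \<in> finite_tilting_subcategories K \<C>"
proof -
  obtain N where "bounded_tilting_pair K \<C> \<T> N" using ex_bounded_tilting_pair .
  then interpret B: bounded_tilting_pair K \<C> \<T> N .
  show ?thesis unfolding finite_tilting_subcategories_def using B.tp \<T>_finite by blast
qed

end

text \<open>One finite resolution of the generator gives a bound, which finite sums and summands
  inherit.\<close>

lemma (in enough_extriangulated_category) finite_tilting_bounded:
  assumes "\<T> \<in> finite_tilting_subcategories K \<C>"
  obtains N where "bounded_tilting_pair K \<C> \<T> N"
proof -
  have tp: "tilting_pair K \<C> \<T>" using assms by (simp add: finite_tilting_subcategories_def)
  obtain T where T: "T \<in> Obj K" "\<T> = add_closure K T"
    using assms unfolding finite_tilting_subcategories_def finite_subcategory_def by blast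
  interpret C: self_orthogonal_subcategory K \<C> using tp by unfold_locales (auto simp: tilting_pair_def)
  have "T \<in> hat K \<C>" using tp add_closure_self[OF T(1)] T(2) by (auto simp: tilting_pair_def)
  then obtain N where N: "\<forall>Y \<in> right_perp K \<C>. \<forall>n \<ge> N. vanish n T Y" using C.hat_bound by blast
  have "vanish n X Y" if "X \<in> \<T>" "Y \<in> res_class K \<C>" "N \<le> n" for X Y n
    using add_closure_vanish[of X T Y n] that N T(2) res_right_perp[OF that(2)] res_Obj by blast
  then have "bounded_tilting_pair K \<C> \<T> N" using tp by unfold_locales
  then show ?thesis using that by blast
qed

theorem theorem5p9:
  fixes K :: "('o, 'm, 'e) ext_struct" and \<C> :: "'o set"
  assumes "extriangulated_category K"
    and "krull_schmidt K"
    and "enough_projectives K"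
    and "enough_injectives K"
    and "WIC K"
    and "subcategory K \<C>"
    and "self_orthogonal K \<C>"
    and "\<exists>\<I>. relative_injective_cogenerator K (res_class K \<C>) \<I>"
    and "finitely_filtered K (check K (res_class K \<C>))"
  shows "(\<forall>\<T> \<in> finite_tilting_subcategories K \<C>.
            res_class K \<T> = right_perp K \<T> \<inter> res_class K \<C>) \<and>
         bij_betw (res_class K)
           (finite_tilting_subcategories K \<C>) (coresolving_subcategories K \<C>) \<and>
         (\<forall>\<D> \<in> coresolving_subcategories K \<C>.
            left_perp K \<D> \<inter> \<D> \<in> finite_tilting_subcategories K \<C> \<and>
            res_class K (left_perp K \<D> \<inter> \<D>) = \<D>) \<and>
         (\<forall>\<T> \<in> finite_tilting_subcategories K \<C>.
            left_perp K (res_class K \<T>) \<inter> res_class K \<T> = \<T>)"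
proof -
  interpret extriangulated_category K by fact
  interpret enough_extriangulated_category K using assms(3,4) by unfold_locales
  have eq: "res_class K \<T> = right_perp K \<T> \<inter> res_class K \<C>"
    and cor: "res_class K \<T> \<in> coresolving_subcategories K \<C>"
    and inv: "left_perp K (res_class K \<T>) \<inter> res_class K \<T> = \<T>"
    if T: "\<T> \<in> finite_tilting_subcategories K \<C>" for \<T>
  proof -
    obtain N where "bounded_tilting_pair K \<C> \<T> N" using finite_tilting_bounded[OF T] .
    then interpret B: bounded_tilting_pair K \<C> \<T> N .
    show "res_class K \<T> = right_perp K \<T> \<inter> res_class K \<C>" by (rule B.res_\<T>_eq)
    show "res_class K \<T> \<in> coresolving_subcategories K \<C>" by (rule B.res_\<T>_coresolving)
    show "left_perp K (res_class K \<T>) \<inter> res_class K \<T> = \<T>" by (rule B.T.left_perp_res)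
  qed
  have til: "left_perp K \<D> \<inter> \<D> \<in> finite_tilting_subcategories K \<C>"
    and res: "res_class K (left_perp K \<D> \<inter> \<D>) = \<D>"
    if D: "\<D> \<in> coresolving_subcategories K \<C>" for \<D>
  proof -
    interpret D: coresolving_subcategory K \<C> \<D> using assms D by unfold_locales
    show "left_perp K \<D> \<inter> \<D> \<in> finite_tilting_subcategories K \<C>"
      using D.\<T>_finite_tilting by (simp add: D.\<T>_def)
    show "res_class K (left_perp K \<D> \<inter> \<D>) = \<D>" using D.res_\<T> by (simp add: D.\<T>_def)
  qed
  have "bij_betw (res_class K) (finite_tilting_subcategories K \<C>) (coresolving_subcategories K \<C>)"
    by (rule bij_betw_byWitness[where f' = "\<lambda>\<D>. left_perp K \<D> \<inter> \<D>"]) (use cor inv til res in auto)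
  then show ?thesis using eq inv til res by blast
qed

end
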